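(* For every integer $s\ge 1$ the quotient $v_{2s}^{(s)}/v_{2s}^{(0)}$ is an integer. In particular, $$\frac{v_{2s}^{(s)}}{v_{2s}^{(0)}} = 2^{2s(s-1)}\binom{2s}{s}.$$
   Context: For a positive integer $d$ and an integer $s$ with $0\le s\le d/2$, let $\mathcal{E}_d^{(s)}$ be the set of all $(a_1,\dots,a_d)\in\mathbb{R}^d$ such that every complex root $\xi$ of the polynomial $X^d+a_1X^{d-1}+\cdots+a_{d-1}X+a_d$ satisfies $|\xi|<1$ and this polynomial has exactly $s$ pairs of complex conjugate nonreal roots (roots counted with multiplicity; so it has $d-2s$ real roots). Let $v_d^{(s)}=\lambda_d(\mathcal{E}_d^{(s)})$, where $\lambda_d$ is $d$-dimensional Lebesgue measure. *)

theory Defs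
  imports "HOL-Analysis.Analysis" "HOL-Computational_Algebra.Computational_Algebra"
begin

text \<open>
  A point \<open>(a\<^sub>1, \<dots>, a\<^sub>d)\<close> of \<open>\<real>\<^sup>d\<close> is a function on the index set \<open>{1..d}\<close>, extensional
  (that is, \<open>undefined\<close> outside \<open>{1..d}\<close>), so that \<open>d\<close> can be a term rather than a type.
\<close>

definition monic_poly :: "nat \<Rightarrow> (nat \<Rightarrow> real) \<Rightarrow> complex poly" where
  "monic_poly d a = monom 1 d + (\<Sum>i=1..d. monom (complex_of_real (a i)) (d - i))"

text \<open>
  The library's \<open>proots\<close> is the multiset of roots with multiplicity. As the coefficients are
  real, the nonreal roots come in conjugate pairs, each pair having exactly one member in the
  open upper half plane; counting these members counts the pairs.
\<close>

definition nonreal_pairs :: "complex poly \<Rightarrow> nat" where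
  "nonreal_pairs p = size {#z \<in># proots p. Im z > 0#}"

definition E_set :: "nat \<Rightarrow> nat \<Rightarrow> (nat \<Rightarrow> real) set" where
  "E_set d s = {a \<in> {1..d} \<rightarrow>\<^sub>E UNIV.
     (\<forall>\<xi>. poly (monic_poly d a) \<xi> = 0 \<longrightarrow> norm \<xi> < 1) \<and>
     nonreal_pairs (monic_poly d a) = s}"

text \<open>
  As in the library's \<open>lebesgue = completion lborel\<close>, Lebesgue measure is the completion of the
  \<open>d\<close>-fold product of one-dimensional Lebesgue-Borel measure.
\<close>

definition lebesgue_dim :: "nat \<Rightarrow> (nat \<Rightarrow> real) measure" where
  "lebesgue_dim d = completion (\<Pi>\<^sub>M i\<in>{1..d}. lborel)"

definition v :: "nat \<Rightarrow> nat \<Rightarrow> real" where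
  "v d s = measure (lebesgue_dim d) (E_set d s)"

end

theory Submission
  imports "Jordan_Normal_Form.Determinant" Defs
begin

text \<open>
  Write a monic real polynomial of degree \<open>2s\<close> as \<open>t q\<close> with a monic real quadratic \<open>t\<close>. On
  coefficients, the map \<open>(q, t) \<mapsto> t q\<close> has Jacobian determinant \<open>Res(q, t) = q(x) q(y)\<close>, where \<open>x, y\<close> are
  the roots of \<open>t\<close>. Count the quadratic factors \<open>t\<close> of a squarefree polynomial with the sign of
  \<open>Res(q, t)\<close>. If there are no real roots and only factors \<open>(X - z)(X - cnj z)\<close> are admitted, every sign is
  positive and the count is \<open>s\<close>. If all roots are real, the factor with roots \<open>x < y\<close> has the sign
  \<open>- \<epsilon>(x) \<epsilon>(y)\<close>, where \<open>\<epsilon>\<close> alternates along the roots, so \<open>\<Sum>\<epsilon> = 0\<close> and the count is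
  \<open>- ((\<Sum>\<epsilon>)\<^sup>2 - 2s) / 2 = s\<close> again (\<open>fibre_count_nonreal\<close>, \<open>fibre_count_real\<close>). Therefore the set \<open>E\<close> of
  squarefree polynomials with all roots in \<open>Z\<close>, where \<open>Z\<close> is either \<open>(-1, 1)\<close> or the nonreal part of
  the open unit disc, satisfies one and the same identity with a signed integrand,

    \<open>s \<integral>\<^bsub>E(2s)\<^esub> h(a) da = \<integral>\<^bsub>T\<^esub> \<integral>\<^bsub>E(2s-2)\<^esub> h(t q) Res(q, t) dq dt\<close>,   with \<open>T = E(2)\<close>  (\<open>recursion\<close>).

  Iterating it gives \<open>s! vol E(2s) = \<integral> \<Prod>\<^bsub>j<k\<^esub> Res(t\<^sub>j, t\<^sub>k)\<close> over \<open>T\<^sup>s\<close>. If \<open>x\<^sub>j, y\<^sub>j\<close> are the roots of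
  \<open>t\<^sub>j\<close>, the integrand times \<open>\<Prod>(y\<^sub>j - x\<^sub>j)\<close> is the Vandermonde determinant of all roots, and the Leibniz
  expansion turns the integral into the Pfaffian-like sum

    \<open>\<Sum>\<^bsub>\<sigma>\<^esub> sign \<sigma> \<Prod>\<^bsub>j<s\<^esub> M(\<sigma>(2j), \<sigma>(2j+1)) / 2\<close>,   \<open>M(a, b) = \<integral>\<^bsub>T\<^esub> (x\<^sup>a y\<^sup>b - x\<^sup>b y\<^sup>a) / (y - x) dt\<close>.

  As \<open>M(a, b)\<close> vanishes when \<open>a + b\<close> is even, the sum collapses to \<open>s!\<close> times the determinant of the block
  \<open>M(2i, 2j+1)\<close> (\<open>volume_eq_fdet\<close>). That block has the entries \<open>4 / ((a+1)(a+b+2))\<close> for real roots and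
  \<open>8 / ((b+1)\<^sup>2 - (a+1)\<^sup>2)\<close> for nonreal ones, with \<open>a = 2i\<close>, \<open>b = 2j+1\<close>. Up to scalings of the rows both are
  Cauchy matrices, and comparing the recursions of the two Cauchy determinants in \<open>s\<close> gives the quotient
  (\<open>fdet_ratio\<close>). It is an integer, since the right-hand side visibly is one.
\<close>

section \<open>An area formula counting preimages with sign\<close>

text \<open>
  The derivative is invertible where its determinant does not vanish, so the map is injective on a
  ball around each such point; countably many of these balls suffice by the Lindelof property.
\<close>
lemma countable_injective_cover:
  fixes G :: "real^'n \<Rightarrow> real^'n" and M :: "real^'n \<Rightarrow> real^'n^'n"
  assumes der: "\<And>p. (G has_derivative (\<lambda>h. M p *v h)) (at p)"
    and cont: "continuous_on UNIV M"
  obtains U :: "nat \<Rightarrow> (real^'n) set"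
    where "\<And>n. open (U n)" "\<And>n. inj_on G (U n)" "{p. det (M p) \<noteq> 0} \<subseteq> (\<Union>n. U n)"
proof -
  have "\<exists>r>0. inj_on G (ball p r)" if nz: "det (M p) \<noteq> 0" for p
  proof -
    obtain N :: "real^'n^'n" where inv: "N ** M p = mat 1"
      using nz invertible_det_nz[of "M p"] invertible_left_inverse[of "M p"] by blast
    have "\<exists>d>0. \<forall>x. dist p x < d \<longrightarrow> onorm (\<lambda>v. M x *v v - M p *v v) < e" if "e > 0" for e
    proof -
      let ?c = "real CARD('n) * real CARD('n)"
      have c: "?c > 0" by simp
      have "e / (2 * ?c) > 0" using that c by auto
      then obtain d where d: "d > 0" "\<And>x. dist x p < d \<Longrightarrow> dist (M x) (M p) < e / (2 * ?c)"
        using cont unfolding continuous_on_iff by (metis UNIV_I)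
      have "onorm (\<lambda>v. M x *v v - M p *v v) < e" if "dist p x < d" for x
      proof -
        have "\<bar>(M x - M p) $ i $ j\<bar> \<le> e / (2 * ?c)" for i j
        proof -
          have "\<bar>(M x - M p) $ i $ j\<bar> \<le> norm ((M x - M p) $ i)"
            by (rule component_le_norm_cart)
          also have "\<dots> \<le> norm (M x - M p)"
            by (rule Finite_Cartesian_Product.norm_nth_le)
          also have "\<dots> < e / (2 * ?c)"
            using d(2)[of x] that by (simp add: dist_norm norm_minus_commute)
          finally show ?thesis by simp
        qed
        then have "onorm (\<lambda>v. (M x - M p) *v v) \<le> ?c * (e / (2 * ?c))"
          by (rule onorm_le_matrix_component)
        also have "\<dots> < e" using \<open>e > 0\<close> c by (simp add: field_simps)
        finally show ?thesis
          by (simp add: matrix_vector_mult_diff_rdistrib[abs_def])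
      qed
      then show ?thesis using d(1) by blast
    qed
    moreover have "(*v) N \<circ> (*v) (M p) = id"
      using inv by (simp add: fun_eq_iff matrix_vector_mul_assoc)
    moreover have "bounded_linear ((*v) N)" by simp
    ultimately obtain r where "r > 0" "ball p r \<subseteq> UNIV" "inj_on G (ball p r)"
      using has_derivative_locally_injective[of p UNIV "(*v) N" "\<lambda>x. (*v) (M x)" G]
        der by blast
    then show ?thesis by blast
  qed
  then obtain r where r: "\<And>p. det (M p) \<noteq> 0 \<Longrightarrow> r p > 0 \<and> inj_on G (ball p (r p))"
    by metis
  let ?F = "(\<lambda>p. ball p (r p)) ` {p. det (M p) \<noteq> 0}"
  obtain F' where F': "F' \<subseteq> ?F" "countable F'" "\<Union>F' = \<Union>?F"
    using Lindelof[of ?F] by auto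
  define U where "U = from_nat_into (insert {} F')"
  have U: "range U = insert {} F'"
    unfolding U_def using F'(2) by (intro range_from_nat_into) auto
  then have "U n \<in> insert {} F'" for n by (metis rangeI)
  then have Un: "U n = {} \<or> U n \<in> ?F" for n using F'(1) by blast
  show ?thesis
  proof
    show "open (U n)" "inj_on G (U n)" for n
      using Un[of n] r by auto
    have "{p. det (M p) \<noteq> 0} \<subseteq> \<Union>?F" using r by fastforce
    also have "\<dots> = (\<Union>n. U n)" using U F'(3) by auto
    finally show "{p. det (M p) \<noteq> 0} \<subseteq> (\<Union>n. U n)" .
  qed
qed

text \<open>
  If the image has finite measure, this is the change of variables for the Henstock integral. Both sides
  are infinite together, because integrability of the Jacobian is equivalent to finiteness of
  the measure of the image.
\<close>
lemma emeasure_injective_image: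
  fixes G :: "real^'n::{finite,wellorder} \<Rightarrow> real^'n::_" and M :: "real^'n::_ \<Rightarrow> real^'n::_^'n::_"
  assumes der: "\<And>p. (G has_derivative (\<lambda>h. M p *v h)) (at p)"
    and [measurable]: "(\<lambda>p. det (M p)) \<in> borel_measurable borel"
    and S[measurable]: "S \<in> sets borel" and inj: "inj_on G S"
  shows "emeasure lebesgue (G ` S) = (\<integral>\<^sup>+t. indicator S t * ennreal \<bar>det (M t)\<bar> \<partial>lborel)"
proof -
  have S': "S \<in> sets lebesgue" using S by auto
  have der': "(G has_derivative (*v) (M p)) (at p within S)" for p
    using der[of p] by (simp add: has_derivative_at_withinI)
  have GS: "G ` S \<in> sets lebesgue"
    by (rule differentiable_image_in_sets_lebesgue[OF S'])
       (auto simp: differentiable_on_def differentiable_def intro!: exI der')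
  let ?f = "\<lambda>t. \<bar>det (M t)\<bar>"
  have nn: "(\<integral>\<^sup>+t. indicator S t * ennreal (?f t) \<partial>lborel) = (\<integral>\<^sup>+t. ennreal (indicator S t * ?f t) \<partial>lebesgue)"
    by (subst nn_integral_completion) (auto intro!: nn_integral_cong split: split_indicator)
  show ?thesis
  proof (cases "?f integrable_on S")
    case True
    then have "?f absolutely_integrable_on S"
      by (intro nonnegative_absolutely_integrable_1) auto
    then have int: "integrable lebesgue (\<lambda>t. indicator S t * ?f t)"
      and eq: "integral S ?f = integral\<^sup>L lebesgue (\<lambda>t. indicator S t * ?f t)"
      using set_lebesgue_integral_eq_integral(2)[of S ?f]
      by (auto simp: set_integrable_def set_lebesgue_integral_def)
    have "G ` S \<in> lmeasurable"
      using measurable_differentiable_image_eq[OF S' der' inj] True by simp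
    then have "emeasure lebesgue (G ` S) = ennreal (measure lebesgue (G ` S))"
      by (simp add: emeasure_eq_measure2 fmeasurableD2)
    also have "measure lebesgue (G ` S) = integral S ?f"
      using measure_differentiable_image_eq[OF S' der' inj] True by simp
    also have "ennreal \<dots> = (\<integral>\<^sup>+t. ennreal (indicator S t * ?f t) \<partial>lebesgue)"
      unfolding eq by (rule nn_integral_eq_integral[symmetric]) (auto intro!: int AE_I2)
    finally show ?thesis unfolding nn .
  next
    case False
    have "(\<integral>\<^sup>+t. ennreal (indicator S t * ?f t) \<partial>lebesgue) = \<infinity>"
    proof (rule ccontr)
      assume "\<not> ?thesis"
      then have "integrable lebesgue (\<lambda>t. indicator S t * ?f t)"
        by (intro integrableI_nonneg) (auto simp: less_top intro!: measurable_completion)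
      then have "set_integrable lebesgue S ?f" by (simp add: set_integrable_def)
      then have "?f integrable_on S"
        using set_lebesgue_integral_eq_integral(1) by blast
      then show False using False by simp
    qed
    moreover have "G ` S \<notin> lmeasurable"
      using measurable_differentiable_image_eq[OF S' der' inj] False by simp
    then have "emeasure lebesgue (G ` S) = \<infinity>"
      using GS by (metis fmeasurableI infinity_ennreal_def top.not_eq_extremum)
    ultimately show ?thesis unfolding nn by simp
  qed
qed

text \<open>
  An image under a differentiable map is Lebesgue measurable but possibly not Borel, hence the
  integral with respect to the completed measure on the right.
\<close>
lemma nn_integral_injective_substitution:
  fixes G :: "real^'n::{finite,wellorder} \<Rightarrow> real^'n::_" and M :: "real^'n::_ \<Rightarrow> real^'n::_^'n::_"
  assumes der: "\<And>p. (G has_derivative (\<lambda>h. M p *v h)) (at p)"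
    and Mm[measurable]: "(\<lambda>p. det (M p)) \<in> borel_measurable borel"
    and S[measurable]: "S \<in> sets borel" and inj: "inj_on G S"
    and f[measurable]: "f \<in> borel_measurable borel"
  shows "(\<integral>\<^sup>+t. indicator S t * ennreal \<bar>det (M t)\<bar> * f (G t) \<partial>lborel) =
         (\<integral>\<^sup>+c. f c * indicator (G ` S) c \<partial>lebesgue)"
    and "G ` S \<in> sets lebesgue"
proof -
  have S': "S \<in> sets lebesgue" using S by auto
  have "continuous_on UNIV G"
    using der by (intro has_derivative_continuous_on[where f' = "\<lambda>p h. M p *v h"]) (auto intro: has_derivative_at_withinI)
  then have [measurable]: "G \<in> borel_measurable borel" by (rule borel_measurable_continuous_onI)
  show GS[measurable]: "G ` S \<in> sets lebesgue"
    by (rule differentiable_image_in_sets_lebesgue[OF S'])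
       (auto simp: differentiable_on_def differentiable_def intro!: exI has_derivative_at_withinI[OF der])
  let ?N1 = "distr (density lborel (\<lambda>t. indicator S t * ennreal \<bar>det (M t)\<bar>)) borel G"
  let ?N2 = "distr (density lebesgue (indicator (G ` S))) borel (\<lambda>c. c)"
  have id[measurable]: "(\<lambda>c. c) \<in> measurable (density lebesgue (indicator (G ` S))) borel"
    by (auto simp: measurable_def)
  have "?N1 = ?N2"
  proof (rule measure_eqI)
    fix X assume "X \<in> sets ?N1"
    then have X[measurable]: "X \<in> sets borel" by simp
    have "emeasure ?N1 X = (\<integral>\<^sup>+t. indicator (S \<inter> G -` X) t * ennreal \<bar>det (M t)\<bar> \<partial>lborel)"
    proof -
      have GX: "G -` X \<in> sets borel"
        using measurable_sets[OF \<open>G \<in> borel_measurable borel\<close> X] by simp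
      then have "emeasure ?N1 X = (\<integral>\<^sup>+t. indicator S t * ennreal \<bar>det (M t)\<bar> * indicator (G -` X) t \<partial>lborel)"
        by (simp add: emeasure_distr emeasure_density)
      also have "\<dots> = (\<integral>\<^sup>+t. indicator (S \<inter> G -` X) t * ennreal \<bar>det (M t)\<bar> \<partial>lborel)"
        by (intro nn_integral_cong) (auto split: split_indicator)
      finally show ?thesis .
    qed
    also have "\<dots> = emeasure lebesgue (G ` (S \<inter> G -` X))"
    proof (rule emeasure_injective_image[OF der Mm, symmetric])
      show "S \<inter> G -` X \<in> sets borel"
        using measurable_sets[OF \<open>G \<in> borel_measurable borel\<close> X] by auto
      show "inj_on G (S \<inter> G -` X)" using inj by (rule inj_on_subset) auto
    qed
    also have "G ` (S \<inter> G -` X) = G ` S \<inter> X" by auto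
    also have "emeasure lebesgue (G ` S \<inter> X) = (\<integral>\<^sup>+c. indicator (G ` S \<inter> X) c \<partial>lebesgue)"
      using GS X by (intro nn_integral_indicator[symmetric]) auto
    also have "\<dots> = (\<integral>\<^sup>+c. indicator (G ` S) c * indicator X c \<partial>lebesgue)"
      by (intro nn_integral_cong) (auto split: split_indicator)
    also have "\<dots> = emeasure (density lebesgue (indicator (G ` S))) X"
      using GS X by (intro emeasure_density[symmetric]) auto
    also have "\<dots> = emeasure ?N2 X"
      using emeasure_distr[OF id X] by simp
    finally show "emeasure ?N1 X = emeasure ?N2 X" .
  qed simp
  then have "integral\<^sup>N ?N1 f = integral\<^sup>N ?N2 f" by simp
  moreover have "integral\<^sup>N ?N1 f = (\<integral>\<^sup>+t. indicator S t * ennreal \<bar>det (M t)\<bar> * f (G t) \<partial>lborel)"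
    by (simp add: nn_integral_distr nn_integral_density)
  moreover have "integral\<^sup>N ?N2 f = (\<integral>\<^sup>+c. f c * indicator (G ` S) c \<partial>lebesgue)"
    using id by (simp add: nn_integral_distr nn_integral_density measurable_completion mult_ac)
  ultimately show "(\<integral>\<^sup>+t. indicator S t * ennreal \<bar>det (M t)\<bar> * f (G t) \<partial>lborel) =
         (\<integral>\<^sup>+c. f c * indicator (G ` S) c \<partial>lebesgue)" by simp
qed

text \<open>
  Cut \<open>S\<close> into countably many Borel pieces on which the map is injective, and add up. At a value \<open>c\<close>
  the indicators of the images of the pieces add up to the number of preimages of \<open>c\<close>.
\<close>
theorem area_formula:
  fixes G :: "real^'n::{finite,wellorder} \<Rightarrow> real^'n::_" and M :: "real^'n::_ \<Rightarrow> real^'n::_^'n::_"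
  assumes der: "\<And>p. (G has_derivative (\<lambda>h. M p *v h)) (at p)"
    and cont: "continuous_on UNIV M"
    and S[measurable]: "S \<in> sets borel" and nz: "\<And>t. t \<in> S \<Longrightarrow> det (M t) \<noteq> 0"
    and f[measurable]: "f \<in> borel_measurable borel"
  shows "(\<integral>\<^sup>+t. indicator S t * ennreal \<bar>det (M t)\<bar> * f (G t) \<partial>lborel) =
         (\<integral>\<^sup>+c. f c * emeasure (count_space UNIV) (S \<inter> G -` {c}) \<partial>lebesgue)"
    and "(\<lambda>c. emeasure (count_space UNIV) (S \<inter> G -` {c})) \<in> borel_measurable lebesgue"
proof -
  have "continuous_on UNIV (\<lambda>p. det (M p))"
    unfolding det_def by (intro continuous_intros cont)
  then have Mm[measurable]: "(\<lambda>p. det (M p)) \<in> borel_measurable borel"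
    by (rule borel_measurable_continuous_onI)
  have "continuous_on UNIV G"
    using der by (intro has_derivative_continuous_on[where f' = "\<lambda>p h. M p *v h"]) (auto intro: has_derivative_at_withinI)
  then have [measurable]: "G \<in> borel_measurable borel" by (rule borel_measurable_continuous_onI)
  obtain U :: "nat \<Rightarrow> _ set" where U: "\<And>n. open (U n)" "\<And>n. inj_on G (U n)" "{p. det (M p) \<noteq> 0} \<subseteq> (\<Union>n. U n)"
    by (rule countable_injective_cover[OF der cont]) blast
  define V where "V n = S \<inter> disjointed U n" for n
  have V[measurable]: "V n \<in> sets borel" for n
  proof -
    have "range (disjointed U) \<subseteq> sets borel"
      using U(1) by (intro sets.range_disjointed_sets) auto
    then show ?thesis using S unfolding V_def by auto
  qed
  have inj: "inj_on G (V n)" for n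
    using U(2)[of n] by (rule inj_on_subset) (auto simp: V_def disjointed_def)
  have disj: "disjoint_family V"
    using disjoint_family_disjointed[of U] by (auto simp: V_def disjoint_family_on_def)
  have SV: "S = (\<Union>n. V n)"
    using U(3) nz UN_disjointed_eq[of U] by (auto simp: V_def)
  have ind: "indicator S t = (\<Sum>n. indicator (V n) t :: ennreal)" for t
    unfolding SV by (rule suminf_indicator[OF disj, symmetric])
  have count: "emeasure (count_space UNIV) (S \<inter> G -` {c}) = (\<Sum>n. indicator (G ` V n) c)" for c
  proof -
    have "emeasure (count_space UNIV) (S \<inter> G -` {c}) = emeasure (count_space UNIV) (\<Union>n. V n \<inter> G -` {c})"
      unfolding SV by (rule arg_cong[where f = "emeasure _"]) auto
    also have "\<dots> = (\<Sum>n. emeasure (count_space UNIV) (V n \<inter> G -` {c}))"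
      using disj by (intro suminf_emeasure[symmetric]) (auto simp: disjoint_family_on_def)
    also have "\<dots> = (\<Sum>n. indicator (G ` V n) c)"
    proof (rule suminf_cong)
      fix n show "emeasure (count_space UNIV) (V n \<inter> G -` {c}) = indicator (G ` V n) c"
    proof (cases "c \<in> G ` V n")
      case True
      then obtain t where "t \<in> V n" "G t = c" by auto
      then have "V n \<inter> G -` {c} = {t}" using inj[of n] by (auto dest: inj_onD)
      then show ?thesis using True by simp
    next
      case False
      then have "V n \<inter> G -` {c} = {}" by auto
      then show ?thesis using False by simp
    qed
    qed
    finally show ?thesis .
  qed
  have GV: "G ` V n \<in> sets lebesgue" for n
    by (rule nn_integral_injective_substitution(2)[OF der Mm V inj f])
  have indGV[measurable]: "(\<lambda>c. indicator (G ` V n) c :: ennreal) \<in> borel_measurable lebesgue" for n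
    by (rule borel_measurable_indicator[OF GV])
  show "(\<lambda>c. emeasure (count_space UNIV) (S \<inter> G -` {c})) \<in> borel_measurable lebesgue"
    unfolding count by (intro borel_measurable_suminf_order indGV)
  have f'[measurable]: "f \<in> borel_measurable lebesgue" using f by (auto intro: measurable_completion)
  have "(\<integral>\<^sup>+t. indicator S t * ennreal \<bar>det (M t)\<bar> * f (G t) \<partial>lborel) =
        (\<integral>\<^sup>+t. (\<Sum>n. indicator (V n) t * ennreal \<bar>det (M t)\<bar> * f (G t)) \<partial>lborel)"
    unfolding ind by (simp add: ennreal_suminf_multc)
  also have "\<dots> = (\<Sum>n. \<integral>\<^sup>+t. indicator (V n) t * ennreal \<bar>det (M t)\<bar> * f (G t) \<partial>lborel)"
    by (rule nn_integral_suminf) measurable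
  also have "\<dots> = (\<Sum>n. \<integral>\<^sup>+c. f c * indicator (G ` V n) c \<partial>lebesgue)"
    using nn_integral_injective_substitution(1)[OF der Mm V inj f] by simp
  also have "\<dots> = (\<integral>\<^sup>+c. (\<Sum>n. f c * indicator (G ` V n) c) \<partial>lebesgue)"
    by (intro nn_integral_suminf[symmetric] borel_measurable_times_ennreal f' indGV)
  also have "\<dots> = (\<integral>\<^sup>+c. f c * emeasure (count_space UNIV) (S \<inter> G -` {c}) \<partial>lebesgue)"
    unfolding count by (simp add: ennreal_suminf_cmult)
  finally show "(\<integral>\<^sup>+t. indicator S t * ennreal \<bar>det (M t)\<bar> * f (G t) \<partial>lborel) =
         (\<integral>\<^sup>+c. f c * emeasure (count_space UNIV) (S \<inter> G -` {c}) \<partial>lebesgue)" .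
qed

text \<open>
  This is the version that is integrated below: the number of preimages may vary from point to point,
  only the difference between positively and negatively oriented preimages is known. Keeping
  the negative part on the right-hand side avoids subtraction of possibly infinite integrals.
\<close>
theorem signed_area_formula:
  fixes G :: "real^'n::{finite,wellorder} \<Rightarrow> real^'n::_" and M :: "real^'n::_ \<Rightarrow> real^'n::_^'n::_"
  assumes der: "\<And>p. (G has_derivative (\<lambda>h. M p *v h)) (at p)"
    and cont: "continuous_on UNIV M"
    and S[measurable]: "S \<in> sets borel"
    and f[measurable]: "f \<in> borel_measurable borel"
    and fin: "\<And>c. f c \<noteq> 0 \<Longrightarrow> finite {t \<in> S. G t = c \<and> det (M t) \<noteq> 0}"
    and deg: "\<And>c. f c \<noteq> 0 \<Longrightarrow>
       card {t \<in> S. G t = c \<and> det (M t) > 0} = card {t \<in> S. G t = c \<and> det (M t) < 0} + k"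
  shows "(\<integral>\<^sup>+t. indicator S t * ennreal (det (M t)) * f (G t) \<partial>lborel) =
         (\<integral>\<^sup>+t. indicator S t * ennreal (- det (M t)) * f (G t) \<partial>lborel) + of_nat k * (\<integral>\<^sup>+c. f c \<partial>lborel)"
proof -
  have "continuous_on UNIV (\<lambda>p. det (M p))"
    unfolding det_def by (intro continuous_intros cont)
  then have Mm[measurable]: "(\<lambda>p. det (M p)) \<in> borel_measurable borel"
    by (rule borel_measurable_continuous_onI)
  define P where "P = {t \<in> S. det (M t) > 0}"
  define Q where "Q = {t \<in> S. det (M t) < 0}"
  have P[measurable]: "P \<in> sets borel" and Q[measurable]: "Q \<in> sets borel"
    unfolding P_def Q_def by measurable
  let ?N = "\<lambda>X c. emeasure (count_space UNIV) (X \<inter> G -` {c})"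
  have f'[measurable]: "f \<in> borel_measurable lebesgue" using f by (auto intro: measurable_completion)
  have N[measurable]: "?N Q \<in> borel_measurable lebesgue"
    by (rule area_formula(2)[OF der cont Q _ f]) (auto simp: Q_def)
  have "f c * ?N P c = f c * ?N Q c + of_nat k * f c" for c
  proof (cases "f c = 0")
    case False
    have "P \<inter> G -` {c} = {t \<in> S. G t = c \<and> det (M t) > 0}" "Q \<inter> G -` {c} = {t \<in> S. G t = c \<and> det (M t) < 0}"
      by (auto simp: P_def Q_def)
    moreover have "finite (P \<inter> G -` {c})" "finite (Q \<inter> G -` {c})"
      by (rule finite_subset[OF _ fin[OF False]], force simp: P_def Q_def)+
    ultimately show ?thesis
      using deg[OF False] by (simp add: emeasure_count_space_finite algebra_simps)
  qed auto
  then have "(\<integral>\<^sup>+c. f c * ?N P c \<partial>lebesgue) = (\<integral>\<^sup>+c. f c * ?N Q c + of_nat k * f c \<partial>lebesgue)"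
    by simp
  also have "\<dots> = (\<integral>\<^sup>+c. f c * ?N Q c \<partial>lebesgue) + of_nat k * (\<integral>\<^sup>+c. f c \<partial>lebesgue)"
    by (simp add: nn_integral_add nn_integral_cmult)
  also have "(\<integral>\<^sup>+c. f c \<partial>lebesgue) = (\<integral>\<^sup>+c. f c \<partial>lborel)"
    using f by (simp add: nn_integral_completion)
  also have "(\<integral>\<^sup>+c. f c * ?N P c \<partial>lebesgue) = (\<integral>\<^sup>+t. indicator P t * ennreal \<bar>det (M t)\<bar> * f (G t) \<partial>lborel)"
    by (rule area_formula(1)[OF der cont P _ f, symmetric]) (auto simp: P_def)
  also have "\<dots> = (\<integral>\<^sup>+t. indicator S t * ennreal (det (M t)) * f (G t) \<partial>lborel)"
    by (rule nn_integral_cong) (auto simp: P_def ennreal_neg split: split_indicator)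
  also have "(\<integral>\<^sup>+c. f c * ?N Q c \<partial>lebesgue) = (\<integral>\<^sup>+t. indicator Q t * ennreal \<bar>det (M t)\<bar> * f (G t) \<partial>lborel)"
    by (rule area_formula(1)[OF der cont Q _ f, symmetric]) (auto simp: Q_def)
  also have "\<dots> = (\<integral>\<^sup>+t. indicator S t * ennreal (- det (M t)) * f (G t) \<partial>lborel)"
    by (rule nn_integral_cong) (auto simp: Q_def ennreal_neg split: split_indicator)
  finally show ?thesis .
qed

lemma lborel_real_pair_eq_vec: "(lborel :: (real \<times> real) measure) = distr lborel borel (\<lambda>v::real^2. (v $ 1, v $ 2))"
proof (rule lborel_eqI)
  have [measurable]: "(\<lambda>v::real^2. (v $ 1, v $ 2)) \<in> borel_measurable borel"
    by (intro borel_measurable_continuous_onI continuous_intros)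
  fix l u :: "real \<times> real"
  assume le: "\<And>b. b \<in> Basis \<Longrightarrow> l \<bullet> b \<le> u \<bullet> b"
  have [simp]: "axis 1 (1::real) \<noteq> (axis 2 1 :: real^2)" by (simp add: axis_eq_axis)
  have B: "(Basis :: (real^2) set) = {axis 1 1, axis 2 1}"
    by (auto simp: Basis_vec_def UNIV_2)
  have lu: "fst l \<le> fst u" "snd l \<le> snd u"
    using le[of "(1, 0)"] le[of "(0, 1)"] by (auto simp: Basis_prod_def inner_prod_def)
  have "emeasure (distr lborel borel (\<lambda>v::real^2. (v $ 1, v $ 2))) (box l u) =
     emeasure lborel (box (vector [fst l, snd l]) (vector [fst u, snd u]) :: (real^2) set)"
    by (subst emeasure_distr)
      (auto simp: B mem_box Basis_prod_def inner_prod_def inner_axis vector_2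
        intro!: arg_cong[where f = "emeasure _"])
  also have "\<dots> = ennreal (\<Prod>b\<in>Basis. ((vector [fst u, snd u] :: real^2) - vector [fst l, snd l]) \<bullet> b)"
    using lu by (intro emeasure_lborel_box) (auto simp: B inner_axis vector_2)
  also have "\<dots> = (\<Prod>b\<in>Basis. (u - l) \<bullet> b)"
    by (auto simp: B Basis_prod_def inner_prod_def inner_axis vector_2 inner_diff_left mult.commute)
  finally show "emeasure (distr lborel borel (\<lambda>v::real^2. (v $ 1, v $ 2))) (box l u) = ennreal (\<Prod>b\<in>Basis. (u - l) \<bullet> b)" .
qed simp

text \<open>
  Coefficient pairs of quadratics are the points of the plane below, whereas determinants belong to
  vectors and matrices; the coordinates identify the two without changing Lebesgue measure.
\<close>
theorem signed_area_formula_plane: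
  fixes g :: "real \<times> real \<Rightarrow> real \<times> real" and a b c d :: "real \<times> real \<Rightarrow> real"
  defines "J \<equiv> \<lambda>p. a p * d p - b p * c p"
  assumes der: "\<And>p. (g has_derivative (\<lambda>h. (a p * fst h + b p * snd h, c p * fst h + d p * snd h))) (at p)"
    and cont: "continuous_on UNIV a" "continuous_on UNIV b" "continuous_on UNIV c" "continuous_on UNIV d"
    and S[measurable]: "S \<in> sets borel"
    and f[measurable]: "f \<in> borel_measurable borel"
    and fin: "\<And>z. f z \<noteq> 0 \<Longrightarrow> finite {t \<in> S. g t = z \<and> J t \<noteq> 0}"
    and deg: "\<And>z. f z \<noteq> 0 \<Longrightarrow>
       card {t \<in> S. g t = z \<and> J t > 0} = card {t \<in> S. g t = z \<and> J t < 0} + k"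
  shows "(\<integral>\<^sup>+t. indicator S t * ennreal (J t) * f (g t) \<partial>lborel) =
         (\<integral>\<^sup>+t. indicator S t * ennreal (- J t) * f (g t) \<partial>lborel) + of_nat k * (\<integral>\<^sup>+z. f z \<partial>lborel)"
proof -
  define \<phi> :: "real^2 \<Rightarrow> real \<times> real" where "\<phi> v = (v $ 1, v $ 2)" for v
  define \<psi> :: "real \<times> real \<Rightarrow> real^2" where "\<psi> p = vector [fst p, snd p]" for p
  define G where "G = \<psi> \<circ> g \<circ> \<phi>"
  define M :: "real^2 \<Rightarrow> real^2^2" where
    "M v = vector [vector [a (\<phi> v), b (\<phi> v)], vector [c (\<phi> v), d (\<phi> v)]]" for v
  have \<phi>\<psi>[simp]: "\<phi> (\<psi> p) = p" for p by (simp add: \<phi>_def \<psi>_def vector_2)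
  have \<psi>\<phi>[simp]: "\<psi> (\<phi> v) = v" for v by (simp add: \<phi>_def \<psi>_def vector_2 vec_eq_iff forall_2)
  have lin\<phi>: "bounded_linear \<phi>"
    unfolding \<phi>_def by (intro bounded_linear_Pair bounded_linear_vec_nth)
  have \<psi>_eq: "\<psi> p = fst p *\<^sub>R axis 1 1 + snd p *\<^sub>R axis 2 1" for p
    by (auto simp: \<psi>_def vec_eq_iff forall_2 vector_2 axis_def)
  have lin\<psi>: "bounded_linear \<psi>"
    unfolding \<psi>_eq
    by (intro bounded_linear_add bounded_linear_compose[OF bounded_linear_scaleR_left] bounded_linear_fst bounded_linear_snd)
  have cont\<phi>: "continuous_on UNIV \<phi>" using lin\<phi> by (simp add: linear_continuous_on)
  have [measurable]: "\<phi> \<in> borel_measurable borel"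
    using cont\<phi> by (rule borel_measurable_continuous_onI)
  have detM: "det (M v) = J (\<phi> v)" for v
    by (simp add: det_2 M_def J_def vector_2)
  have derG: "(G has_derivative (\<lambda>h. M v *v h)) (at v)" for v
  proof -
    have "(\<psi> \<circ> (g \<circ> \<phi>) has_derivative \<psi> \<circ> ((\<lambda>h. (a (\<phi> v) * fst h + b (\<phi> v) * snd h, c (\<phi> v) * fst h + d (\<phi> v) * snd h)) \<circ> \<phi>)) (at v)"
      by (intro diff_chain_at der bounded_linear_imp_has_derivative lin\<phi> lin\<psi>)
    moreover have "\<psi> \<circ> ((\<lambda>h. (a (\<phi> v) * fst h + b (\<phi> v) * snd h, c (\<phi> v) * fst h + d (\<phi> v) * snd h)) \<circ> \<phi>) = (\<lambda>h. M v *v h)"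
      by (auto simp: fun_eq_iff M_def \<psi>_def \<phi>_def vec_eq_iff forall_2 vector_2 matrix_vector_mult_def sum_2)
    ultimately show ?thesis by (simp add: G_def o_assoc)
  qed
  have contM: "continuous_on UNIV M"
  proof -
    have c': "continuous_on UNIV (\<lambda>v. a (\<phi> v))" "continuous_on UNIV (\<lambda>v. b (\<phi> v))"
      "continuous_on UNIV (\<lambda>v. c (\<phi> v))" "continuous_on UNIV (\<lambda>v. d (\<phi> v))"
      by (rule continuous_on_compose2[OF _ cont\<phi>], rule cont, simp)+
    have "M = (\<lambda>v. \<chi> i j. if i = 1 then if j = 1 then a (\<phi> v) else b (\<phi> v)
        else if j = 1 then c (\<phi> v) else d (\<phi> v))"
      by (auto simp: fun_eq_iff M_def vec_eq_iff forall_2 vector_2)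
    moreover have "continuous_on UNIV (\<lambda>v. if i = 1 then if j = 1 then a (\<phi> v) else b (\<phi> v)
        else if j = 1 then c (\<phi> v) else d (\<phi> v))" for i j :: 2
      using c' by (cases "i = 1"; cases "j = 1") simp_all
    ultimately show ?thesis by (simp add: continuous_on_vec_lambda)
  qed
  have fib: "{v \<in> \<phi> -` S. G v = w \<and> P (J (\<phi> v))} = \<psi> ` {t \<in> S. g t = \<phi> w \<and> P (J t)}" for w P
  proof (intro Set.set_eqI iffI)
    fix v assume "v \<in> {v \<in> \<phi> -` S. G v = w \<and> P (J (\<phi> v))}"
    then have "\<phi> v \<in> {t \<in> S. g t = \<phi> w \<and> P (J t)}" by (auto simp: G_def)
    then show "v \<in> \<psi> ` {t \<in> S. g t = \<phi> w \<and> P (J t)}"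
      by (intro image_eqI[of _ _ "\<phi> v"]) simp_all
  next
    fix v assume "v \<in> \<psi> ` {t \<in> S. g t = \<phi> w \<and> P (J t)}"
    then obtain t where t: "v = \<psi> t" "t \<in> S" "g t = \<phi> w" "P (J t)" by blast
    have "G v = \<psi> (g (\<phi> (\<psi> t)))" by (simp add: G_def t(1))
    then show "v \<in> {v \<in> \<phi> -` S. G v = w \<and> P (J (\<phi> v))}"
      using t by (simp only: \<phi>\<psi> \<psi>\<phi> mem_Collect_eq vimage_eq)
  qed
  have inj\<psi>: "inj \<psi>" by (metis \<phi>\<psi> injI)
  have cardfib: "card (\<psi> ` X) = card X" for X
    using inj\<psi> by (simp add: card_image inj_on_subset)
  have S\<phi>: "\<phi> -` S \<in> sets borel"
    using measurable_sets[of \<phi> borel borel S] by auto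
  have f\<phi>: "(\<lambda>v. f (\<phi> v)) \<in> borel_measurable borel" by measurable
  have der': "continuous_on UNIV g"
    by (rule has_derivative_continuous_on[OF has_derivative_at_withinI[OF der]])
  then have g[measurable]: "g \<in> borel_measurable borel" by (rule borel_measurable_continuous_onI)
  have [measurable]: "J \<in> borel_measurable borel"
    unfolding J_def by (intro borel_measurable_continuous_onI continuous_intros cont)
  have *: "(\<integral>\<^sup>+v. indicator (\<phi> -` S) v * ennreal (det (M v)) * f (\<phi> (G v)) \<partial>lborel) =
         (\<integral>\<^sup>+v. indicator (\<phi> -` S) v * ennreal (- det (M v)) * f (\<phi> (G v)) \<partial>lborel) +
         of_nat k * (\<integral>\<^sup>+v. f (\<phi> v) \<partial>lborel)"
  proof (rule signed_area_formula[OF derG contM S\<phi> f\<phi>])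
    show "finite {t \<in> \<phi> -` S. G t = w \<and> det (M t) \<noteq> 0}" if "f (\<phi> w) \<noteq> 0" for w
      unfolding detM fib[of w "\<lambda>x. x \<noteq> 0"] using fin[OF that] by simp
    show "card {t \<in> \<phi> -` S. G t = w \<and> det (M t) > 0} = card {t \<in> \<phi> -` S. G t = w \<and> det (M t) < 0} + k"
      if "f (\<phi> w) \<noteq> 0" for w
      unfolding detM fib[of w "\<lambda>x. x > 0"] fib[of w "\<lambda>x. x < 0"] cardfib by (rule deg[OF that])
  qed
  have tr: "integral\<^sup>N lborel F = (\<integral>\<^sup>+v. F (\<phi> v) \<partial>lborel)" if "F \<in> borel_measurable borel" for F
    unfolding lborel_real_pair_eq_vec \<phi>_def[symmetric] using that by (subst nn_integral_distr) auto
  show ?thesis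
    using * unfolding detM G_def
    by (subst tr, measurable, subst tr, measurable, subst tr, measurable) (simp add: indicator_def)
qed

section \<open>Determinants and Pfaffian-like sums\<close>

text \<open>
  The size of the matrices is a variable of the induction below, so entries are given by a
  function of two indices and the size is an argument.
\<close>
definition fdet :: "nat \<Rightarrow> (nat \<Rightarrow> nat \<Rightarrow> 'a::comm_ring_1) \<Rightarrow> 'a" where
  "fdet n A = Determinant.det (Matrix.mat n n (\<lambda>(i, j). A i j))"

lemma fdet_leibniz:
  "fdet n A = (\<Sum>p | p permutes {..<n}. of_int (sign p) * (\<Prod>i<n. A i (p i)))"
proof -
  have "fdet n A = (\<Sum>p | p permutes {0..<n}. of_int (sign p) *
          (\<Prod>i = 0..<n. Matrix.mat n n (\<lambda>(i, j). A i j) $$ (i, p i)))"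
    unfolding fdet_def by (subst det_def') auto
  also have "\<dots> = (\<Sum>p | p permutes {0..<n}. of_int (sign p) * (\<Prod>i = 0..<n. A i (p i)))"
    by (intro sum.cong refl arg_cong2[where f = "(*)"] prod.cong)
       (auto simp: permutes_in_image dest!: permutes_in_image)
  finally show ?thesis
    by (simp add: lessThan_atLeast0)
qed

lemma fdet_cong:
  assumes "\<And>i j. i < n \<Longrightarrow> j < n \<Longrightarrow> A i j = B i j"
  shows "fdet n A = fdet n B"
  unfolding fdet_def using assms by (intro arg_cong[where f = Determinant.det] eq_matI) auto

text \<open>
  The new matrix is the product of a unitriangular matrix \<open>L\<close> with the old one.
\<close>
lemma fdet_row_operations:
  fixes A L :: "nat \<Rightarrow> nat \<Rightarrow> 'a::comm_ring_1"
  assumes "(\<forall>i<n. \<forall>k<i. L i k = 0) \<or> (\<forall>k<n. \<forall>i<k. L i k = 0)"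
    and "\<And>i. i < n \<Longrightarrow> L i i = 1"
  shows "fdet n (\<lambda>i j. \<Sum>k<n. L i k * A k j) = fdet n A"
proof -
  let ?L = "Matrix.mat n n (\<lambda>(i, j). L i j)" and ?A = "Matrix.mat n n (\<lambda>(i, j). A i j)"
  have L: "?L \<in> carrier_mat n n" and A: "?A \<in> carrier_mat n n" by auto
  have "prod_list (diag_mat ?L) = 1"
    using assms(2) by (simp add: prod_list_diag_prod)
  moreover have "Determinant.det ?L = prod_list (diag_mat ?L)"
    using assms(1)
  proof
    assume "\<forall>i<n. \<forall>k<i. L i k = 0"
    then show ?thesis by (intro det_upper_triangular[OF _ L]) auto
  next
    assume "\<forall>k<n. \<forall>i<k. L i k = 0"
    then show ?thesis by (intro det_lower_triangular[OF _ L]) auto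
  qed
  ultimately have "Determinant.det ?L = 1" by simp
  moreover have "Matrix.mat n n (\<lambda>(i, j). \<Sum>k<n. L i k * A k j) = ?L * ?A"
    by (rule eq_matI) (auto simp: scalar_prod_def lessThan_atLeast0)
  ultimately show ?thesis
    unfolding fdet_def by (simp add: Determinant.det_mult[OF L A])
qed

lemma fdet_last_column:
  fixes A :: "nat \<Rightarrow> nat \<Rightarrow> 'a::comm_ring_1"
  assumes "r \<le> n" and "\<And>i. i \<le> n \<Longrightarrow> i \<noteq> r \<Longrightarrow> A i n = 0"
  shows "fdet (Suc n) A = (- 1) ^ (r + n) * A r n * fdet n (\<lambda>i j. A (if i < r then i else Suc i) j)"
proof -
  let ?A = "Matrix.mat (Suc n) (Suc n) (\<lambda>(i, j). A i j)"
  have "fdet (Suc n) A = (\<Sum>i<Suc n. ?A $$ (i, n) * cofactor ?A i n)"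
    unfolding fdet_def by (intro laplace_expansion_column) auto
  also have "\<dots> = (\<Sum>i<Suc n. if i = r then A r n * cofactor ?A r n else 0)"
    using assms by (intro sum.cong) auto
  also have "\<dots> = A r n * cofactor ?A r n"
    using assms(1) by (subst sum.delta) auto
  also have "mat_delete ?A r n = Matrix.mat n n (\<lambda>(i, j). A (if i < r then i else Suc i) j)"
    unfolding mat_delete_def by (rule eq_matI) auto
  then have "cofactor ?A r n = (- 1) ^ (r + n) * fdet n (\<lambda>i j. A (if i < r then i else Suc i) j)"
    unfolding cofactor_def fdet_def by simp
  finally show ?thesis by (simp add: mult_ac)
qed

lemma fdet_scale:
  fixes A :: "nat \<Rightarrow> nat \<Rightarrow> 'a::comm_ring_1"
  shows "fdet n (\<lambda>i j. u i * w j * A i j) = (\<Prod>i<n. u i) * (\<Prod>j<n. w j) * fdet n A"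
proof -
  have "(\<Prod>i<n. u i * w (p i) * A i (p i)) = (\<Prod>i<n. u i) * (\<Prod>j<n. w j) * (\<Prod>i<n. A i (p i))"
    if "p permutes {..<n}" for p
    using prod.permute[OF that, of w] by (simp add: prod.distrib o_def)
  then show ?thesis
    unfolding fdet_leibniz sum_distrib_left by (intro sum.cong refl) (auto simp: mult_ac)
qed

text \<open>
  Subtracting \<open>\<rho> n\<close> times each row from the next one leaves a single nonzero entry, at the top of the
  last column, and below the top row every other column becomes a multiple of a Vandermonde column.
\<close>
theorem fdet_vandermonde:
  fixes \<rho> :: "nat \<Rightarrow> 'a::comm_ring_1"
  shows "fdet n (\<lambda>i j. \<rho> j ^ i) = (\<Prod>l<n. \<Prod>k<l. \<rho> l - \<rho> k)"
proof (induction n)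
  case 0
  show ?case by (simp add: fdet_leibniz)
next
  case (Suc n)
  define L where "L i k = (if i = k then 1 else if i = Suc k then - \<rho> n else 0)" for i k :: nat
  have "(\<Sum>k<Suc n. L i k * \<rho> j ^ k) = (if i = 0 then 1 else \<rho> j ^ (i - 1) * (\<rho> j - \<rho> n))"
    if "i < Suc n" for i j
  proof (cases i)
    case 0
    then have "(\<Sum>k<Suc n. L i k * \<rho> j ^ k) = (\<Sum>k<Suc n. if k = 0 then 1 else 0)"
      by (intro sum.cong) (auto simp: L_def)
    then show ?thesis using 0 by (subst (asm) sum.delta) auto
  next
    case (Suc m)
    have "(\<Sum>k<Suc n. L i k * \<rho> j ^ k) = (\<Sum>k\<in>{m, Suc m}. L i k * \<rho> j ^ k)"
      using that Suc by (intro sum.mono_neutral_right) (auto simp: L_def)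
    then show ?thesis using Suc by (simp add: L_def algebra_simps)
  qed
  then have "fdet (Suc n) (\<lambda>i j. \<Sum>k<Suc n. L i k * \<rho> j ^ k) =
      fdet (Suc n) (\<lambda>i j. if i = 0 then 1 else \<rho> j ^ (i - 1) * (\<rho> j - \<rho> n))"
    by (intro fdet_cong) auto
  moreover have "fdet (Suc n) (\<lambda>i j. \<Sum>k<Suc n. L i k * \<rho> j ^ k) = fdet (Suc n) (\<lambda>i j. \<rho> j ^ i)"
    by (rule fdet_row_operations) (auto simp: L_def)
  ultimately have "fdet (Suc n) (\<lambda>i j. \<rho> j ^ i) = (- 1) ^ n * fdet n (\<lambda>i j. \<rho> j ^ i * (\<rho> j - \<rho> n))"
    by (simp add: fdet_last_column[of 0])
  also have "fdet n (\<lambda>i j. \<rho> j ^ i * (\<rho> j - \<rho> n)) = (\<Prod>j<n. \<rho> j - \<rho> n) * fdet n (\<lambda>i j. \<rho> j ^ i)"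
    using fdet_scale[of n "\<lambda>_. 1" "\<lambda>j. \<rho> j - \<rho> n" "\<lambda>i j. \<rho> j ^ i"] by (simp add: mult_ac)
  also have "(- 1) ^ n * ((\<Prod>j<n. \<rho> j - \<rho> n) * fdet n (\<lambda>i j. \<rho> j ^ i))
      = (\<Prod>j<n. - 1 * (\<rho> j - \<rho> n)) * fdet n (\<lambda>i j. \<rho> j ^ i)"
    unfolding prod.distrib by (simp add: mult_ac)
  finally show ?case by (simp add: Suc.IH mult_ac)
qed

text \<open>
  Clearing the last column with the last row replaces the entry \<open>1 / (p i + q j)\<close> by itself times a factor
  depending on \<open>i\<close> and a factor depending on \<open>j\<close>, so that the smaller Cauchy determinant splits off.
\<close>
theorem fdet_cauchy_Suc:
  fixes p q :: "nat \<Rightarrow> 'a::field"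
  assumes "\<And>i j. i \<le> n \<Longrightarrow> j \<le> n \<Longrightarrow> p i + q j \<noteq> 0"
  shows "fdet (Suc n) (\<lambda>i j. 1 / (p i + q j)) =
     fdet n (\<lambda>i j. 1 / (p i + q j)) * (1 / (p n + q n)) *
       (\<Prod>i<n. (p n - p i) * (q n - q i) / ((p i + q n) * (p n + q i)))"
proof -
  define L where "L i k = (if i = k then 1 else if k = n then - (p n + q n) / (p i + q n) else 0)" for i k
  let ?A = "\<lambda>i j. 1 / (p i + q j)"
  let ?B = "\<lambda>i j. if i = n then ?A i j
      else (p n - p i) / (p i + q n) * ((q n - q j) / (p n + q j)) * ?A i j"
  have "(\<Sum>k<Suc n. L i k * ?A k j) = ?B i j" if "i < Suc n" "j < Suc n" for i j
  proof -
    have nz: "p i + q j \<noteq> 0" "p n + q n \<noteq> 0" "p i + q n \<noteq> 0" "p n + q j \<noteq> 0"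
      using assms that by auto
    have "(\<Sum>k<Suc n. L i k * ?A k j) = (\<Sum>k\<in>{i, n}. L i k * ?A k j)"
      using that by (intro sum.mono_neutral_right) (auto simp: L_def)
    also have "\<dots> = ?B i j"
    proof (cases "i = n")
      case False
      have "1 / (p i + q j) + (- p n - q n) / ((p i + q n) * (p n + q j)) =
          ((p i + q n) * (p n + q j) - (p n + q n) * (p i + q j)) /
          ((p i + q n) * (p n + q j) * (p i + q j))"
        using nz by (simp add: divide_simps) (simp add: algebra_simps)
      also have "(p i + q n) * (p n + q j) - (p n + q n) * (p i + q j) = (p n - p i) * (q n - q j)"
        by (simp add: algebra_simps)
      finally show ?thesis using False by (simp add: L_def)
    qed (simp add: L_def)
    finally show ?thesis .
  qed
  then have "fdet (Suc n) (\<lambda>i j. \<Sum>k<Suc n. L i k * ?A k j) = fdet (Suc n) ?B"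
    by (intro fdet_cong) auto
  moreover have "fdet (Suc n) (\<lambda>i j. \<Sum>k<Suc n. L i k * ?A k j) = fdet (Suc n) ?A"
    by (rule fdet_row_operations) (auto simp: L_def)
  moreover have "fdet (Suc n) ?B = (- 1) ^ (n + n) * ?B n n * fdet n (\<lambda>i j. ?B (if i < n then i else Suc i) j)"
    by (rule fdet_last_column) auto
  ultimately have "fdet (Suc n) ?A = ?A n n * fdet n (\<lambda>i j. ?B (if i < n then i else Suc i) j)"
    by (simp add: power_add flip: power_mult_distrib)
  also have "fdet n (\<lambda>i j. ?B (if i < n then i else Suc i) j) =
      fdet n (\<lambda>i j. (p n - p i) / (p i + q n) * ((q n - q j) / (p n + q j)) * ?A i j)"
    by (rule fdet_cong) auto
  also have "\<dots> = (\<Prod>i<n. (p n - p i) / (p i + q n)) * (\<Prod>j<n. (q n - q j) / (p n + q j)) * fdet n ?A"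
    by (rule fdet_scale)
  finally show ?thesis
    by (simp add: prod.distrib prod_dividef mult_ac)
qed

text \<open>
  When all \<open>B j\<close> are one antisymmetric matrix, this is \<open>2\<^sup>s s!\<close> times its Pfaffian. Different
  matrices \<open>B j\<close> are needed because the integrand depends on a different variable in each pair.
\<close>
definition pair_alt :: "nat \<Rightarrow> (nat \<Rightarrow> nat \<Rightarrow> nat \<Rightarrow> 'a::comm_ring_1) \<Rightarrow> 'a" where
  "pair_alt s B = (\<Sum>\<sigma> | \<sigma> permutes {..<2 * s}.
     of_int (sign \<sigma>) * (\<Prod>j<s. B j (\<sigma> (2 * j)) (\<sigma> (2 * j + 1))))"

lemma prod_pairs: "(\<Prod>l<2 * s. f l) = (\<Prod>j<s. f (2 * j) * f (2 * j + 1 :: nat))"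
  by (induction s) (auto simp: mult_ac)

text \<open>
  Exchanging \<open>\<sigma> (2k)\<close> and \<open>\<sigma> (2k + 1)\<close> changes the sign of \<open>\<sigma>\<close> and nothing else.
\<close>
lemma pair_alt_symmetric_zero:
  fixes B :: "nat \<Rightarrow> nat \<Rightarrow> nat \<Rightarrow> 'a::field_char_0"
  assumes "k < s" and sym: "\<And>a b. B k a b = B k b a"
  shows "pair_alt s B = 0"
proof -
  let ?S = "{\<sigma>. \<sigma> permutes {..<2 * s}}"
  let ?\<tau> = "Transposition.transpose (2 * k) (2 * k + 1)"
  let ?f = "\<lambda>\<sigma>. of_int (sign \<sigma>) * (\<Prod>j<s. B j (\<sigma> (2 * j)) (\<sigma> (2 * j + 1))) :: 'a"
  have \<tau>: "?\<tau> permutes {..<2 * s}"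
    using assms(1) by (intro permutes_swap_id) auto
  have "(\<Prod>j<s. B j ((\<sigma> \<circ> ?\<tau>) (2 * j)) ((\<sigma> \<circ> ?\<tau>) (2 * j + 1))) =
        (\<Prod>j<s. B j (\<sigma> (2 * j)) (\<sigma> (2 * j + 1)))" for \<sigma>
  proof (rule prod.cong)
    fix j
    have *: "2 * j \<noteq> 2 * k + 1" "2 * k \<noteq> 2 * j + 1" by presburger+
    show "B j ((\<sigma> \<circ> ?\<tau>) (2 * j)) ((\<sigma> \<circ> ?\<tau>) (2 * j + 1)) = B j (\<sigma> (2 * j)) (\<sigma> (2 * j + 1))"
      using * sym by (cases "j = k") (auto simp: Transposition.transpose_def)
  qed simp
  moreover have "sign (\<sigma> \<circ> ?\<tau>) = - sign \<sigma>" if "\<sigma> permutes {..<2 * s}" for \<sigma>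
    using that \<tau> by (subst sign_compose)
      (auto simp: sign_swap_id intro: permutes_imp_permutation[of "{..<2 * s}"])
  ultimately have "(\<Sum>\<sigma>\<in>?S. ?f (\<sigma> \<circ> ?\<tau>)) = (\<Sum>\<sigma>\<in>?S. - ?f \<sigma>)"
    by (intro sum.cong) auto
  moreover have "(\<Sum>\<sigma>\<in>?S. ?f (\<sigma> \<circ> ?\<tau>)) = (\<Sum>\<sigma>\<in>?S. ?f \<sigma>)"
    using sum_permutations_compose_right[OF \<tau>, of ?f] by simp
  ultimately have "pair_alt s B = - pair_alt s B"
    unfolding pair_alt_def by (simp add: sum_negf)
  then show ?thesis by simp
qed

text \<open>
  The sum is linear in each \<open>B j\<close> separately, so the matrices can be exchanged one at a time, each time
  at the cost of a sum with a symmetric matrix, which is zero.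
\<close>
lemma pair_alt_cong_symmetric:
  fixes B B' :: "nat \<Rightarrow> nat \<Rightarrow> nat \<Rightarrow> 'a::field_char_0"
  assumes sym: "\<And>j a b. B j a b - B' j a b = B j b a - B' j b a"
  shows "pair_alt s B = pair_alt s B'"
proof -
  define C where "C m j = (if j < m then B' j else B j)" for m j
  have "pair_alt s B = pair_alt s (C m)" if "m \<le> s" for m
    using that
  proof (induction m)
    case 0
    then show ?case by (simp add: C_def)
  next
    case (Suc m)
    define S where "S j = (if j = m then (\<lambda>a b. B m a b - B' m a b) else C m j)" for j
    have split: "(\<Prod>j<s. X j (\<sigma> (2 * j)) (\<sigma> (2 * j + 1))) = X m (\<sigma> (2 * m)) (\<sigma> (2 * m + 1)) *
        (\<Prod>j\<in>{..<s} - {m}. C m j (\<sigma> (2 * j)) (\<sigma> (2 * j + 1)))"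
      if "\<And>j. j \<noteq> m \<Longrightarrow> X j = C m j" for X :: "nat \<Rightarrow> nat \<Rightarrow> nat \<Rightarrow> 'a" and \<sigma>
      using Suc.prems that by (subst prod.remove[of _ m]) auto
    have "pair_alt s (C m) - pair_alt s (C (Suc m)) = pair_alt s S"
      unfolding pair_alt_def sum_subtractf[symmetric]
      apply (subst (1 2 3) split)
         apply (auto simp: C_def S_def algebra_simps)
      done
    also have "\<dots> = 0"
      using Suc.prems sym by (intro pair_alt_symmetric_zero[of m]) (auto simp: S_def)
    finally show ?case using Suc by simp
  qed
  from this[of s] show ?thesis
    by (simp add: pair_alt_def C_def)
qed

text \<open>
  Injectivity makes \<open>A\<close> invariant as soon as it is mapped into itself, and then its complement as well.
\<close>
lemma permutes_split:
  assumes "A \<inter> B = {}" "finite A" "finite B" "\<sigma> permutes A \<union> B" "\<And>x. x \<in> A \<Longrightarrow> \<sigma> x \<in> A"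
  shows "\<exists>p q. p permutes A \<and> q permutes B \<and> \<sigma> = p \<circ> q"
proof -
  have inj: "inj \<sigma>" using assms(4) by (rule permutes_inj)
  have AA: "\<sigma> ` A = A"
    using assms by (intro card_subset_eq) (auto simp: card_image inj_on_subset[OF inj])
  have BB: "\<sigma> ` B = B"
  proof (rule card_subset_eq)
    show "\<sigma> ` B \<subseteq> B"
    proof safe
      fix x assume "x \<in> B"
      then have "\<sigma> x \<in> A \<union> B" using permutes_in_image[OF assms(4), of x] by auto
      moreover have "\<sigma> x \<notin> A"
      proof
        assume "\<sigma> x \<in> A"
        then have "x \<in> A" using AA inj by (metis imageE injD)
        then show False using \<open>x \<in> B\<close> assms(1) by auto
      qed
      ultimately show "\<sigma> x \<in> B" by auto
    qed
  qed (use assms in \<open>auto simp: card_image inj_on_subset[OF inj]\<close>)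
  define p where "p x = (if x \<in> A then \<sigma> x else x)" for x
  define q where "q x = (if x \<in> B then \<sigma> x else x)" for x
  have "p permutes A" 
    by (rule bij_imp_permutes) (use AA inj in \<open>auto simp: p_def bij_betw_def inj_on_def dest: injD\<close>)
  moreover have "q permutes B"
    by (rule bij_imp_permutes) (use BB inj in \<open>auto simp: q_def bij_betw_def inj_on_def dest: injD\<close>)
  moreover have "\<sigma> = p \<circ> q"
  proof
    fix x
    consider "x \<in> A" | "x \<in> B" | "x \<notin> A \<union> B" by auto
    then show "\<sigma> x = (p \<circ> q) x"
    proof cases
      case 2
      then have "\<sigma> x \<in> B" using BB by auto
      then show ?thesis using 2 assms(1) by (auto simp: p_def q_def)
    qed (use assms in \<open>auto simp: p_def q_def permutes_not_in\<close>)
  qed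
  ultimately show ?thesis by blast
qed

lemma map_permutation_surj:
  assumes "inj_on f A" "p permutes f ` A"
  shows "\<exists>p'. p' permutes A \<and> p = map_permutation A f p'"
proof (intro exI conjI)
  let ?p = "map_permutation (f ` A) (inv_into A f) p"
  have bij: "bij_betw (inv_into A f) (f ` A) A"
    using assms(1) by (intro bij_betw_inv_into) (auto simp: bij_betw_def)
  show "?p permutes A"
    by (rule map_permutation_permutes[OF bij assms(2)])
  have "map_permutation A f ?p = map_permutation (f ` A) (f \<circ> inv_into A f) p"
    by (rule map_permutation_compose[OF bij assms(1)])
  also have "\<dots> = map_permutation (f ` A) id p"
    using assms by (intro map_permutation_cong) (auto simp: f_inv_into_f inj_on_def)
  also have "\<dots> = p" using assms(2) by simp
  finally show "p = map_permutation A f ?p" by simp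
qed

text \<open>
  Only the permutations that preserve the parity contribute. They are the pairs of a permutation \<open>p\<close> of
  the even and a permutation \<open>q\<close> of the odd indices, and the summand depends on \<open>q\<close> relative to \<open>p\<close> only:
  for each of the \<open>s!\<close> choices of \<open>p\<close> the sum over \<open>q\<close> is the determinant.
\<close>
lemma pair_alt_even_odd:
  fixes K :: "nat \<Rightarrow> nat \<Rightarrow> 'a::field_char_0"
  assumes "\<And>a b. \<not> (even a \<and> odd b) \<Longrightarrow> K a b = 0"
  shows "pair_alt s (\<lambda>_. K) = fact s * fdet s (\<lambda>i j. K (2 * i) (2 * j + 1))"
proof -
  let ?A = "(\<lambda>i. 2 * i) ` {..<s}" and ?B = "(\<lambda>i. 2 * i + 1) ` {..<s}"
  let ?S = "{p. p permutes {..<s}}"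
  define E where "E = map_permutation {..<s} (\<lambda>i::nat. 2 * i)"
  define Od where "Od = map_permutation {..<s} (\<lambda>i::nat. 2 * i + 1)"
  have injA: "inj_on (\<lambda>i::nat. 2 * i) {..<s}" and injB: "inj_on (\<lambda>i::nat. 2 * i + 1) {..<s}"
    by (auto simp: inj_on_def)
  have bijA: "bij_betw (\<lambda>i::nat. 2 * i) {..<s} ?A" and bijB: "bij_betw (\<lambda>i::nat. 2 * i + 1) {..<s} ?B"
    using injA injB by (auto simp: bij_betw_def)
  have union: "{..<2 * s} = ?A \<union> ?B"
  proof (safe)
    fix x assume "x < 2 * s" "x \<notin> ?B"
    then show "x \<in> ?A" by (cases "even x") (auto elim!: evenE oddE)
  qed auto
  have disj: "?A \<inter> ?B = {}" by (auto, presburger)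
  have E_perm: "E p permutes ?A" and O_perm: "Od p permutes ?B" if "p \<in> ?S" for p
    using that map_permutation_permutes[OF bijA] map_permutation_permutes[OF bijB]
    by (auto simp: E_def Od_def)
  have E_app: "E p (2 * j) = 2 * p j" and O_app: "Od p (2 * j + 1) = 2 * p j + 1"
    if "j < s" for p j
    using that inv_into_f_f[OF injA, of j] inv_into_f_f[OF injB, of j]
    by (auto simp: E_def Od_def map_permutation_def restrict_id_def)
  have E_odd: "E p (2 * j + 1) = 2 * j + 1" and O_even: "Od p (2 * j) = 2 * j" if "p \<in> ?S" for p j
  proof -
    have "2 * j + 1 \<notin> ?A" "2 * j \<notin> ?B" by (auto, presburger+)
    then show "E p (2 * j + 1) = 2 * j + 1" "Od p (2 * j) = 2 * j"
      using permutes_not_in[OF E_perm[OF that]] permutes_not_in[OF O_perm[OF that]] by blast+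
  qed
  let ?F = "\<lambda>(p, q). E p \<circ> Od q"
  have F_even: "(E p \<circ> Od q) (2 * j) = 2 * p j" and F_odd: "(E p \<circ> Od q) (2 * j + 1) = 2 * q j + 1"
    if "p \<in> ?S" "q \<in> ?S" "j < s" for p q j
    using that E_app[of j p] O_app[of j q] E_odd[of p "q j"] O_even[of q j] by auto
  have F_perm: "(E p \<circ> Od q) permutes {..<2 * s}" if "p \<in> ?S" "q \<in> ?S" for p q
    unfolding union using E_perm[OF that(1)] O_perm[OF that(2)]
    by (intro permutes_compose) (auto elim: permutes_subset)
  have F_sign: "sign (E p \<circ> Od q) = sign p * sign q" if "p \<in> ?S" "q \<in> ?S" for p q
  proof -
    have "permutation (E p)" "permutation (Od q)"
      using E_perm[OF that(1)] O_perm[OF that(2)] by (auto intro: permutes_imp_permutation[rotated])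
    then have "sign (E p \<circ> Od q) = sign (E p) * sign (Od q)" by (rule sign_compose)
    moreover have "sign (E p) = sign p"
      unfolding E_def using that injA by (intro sign_map_permutation) auto
    moreover have "sign (Od q) = sign q"
      unfolding Od_def using that injB by (intro sign_map_permutation) auto
    ultimately show ?thesis by simp
  qed
  have surjA: "\<exists>p'\<in>?S. p = E p'" if "p permutes ?A" for p
    using map_permutation_surj[OF injA that] by (auto simp: E_def)
  have surjB: "\<exists>p'\<in>?S. p = Od p'" if "p permutes ?B" for p
    using map_permutation_surj[OF injB that] by (auto simp: Od_def)
  define G where "G = {\<sigma>. \<sigma> permutes {..<2 * s} \<and> (\<forall>x\<in>?A. \<sigma> x \<in> ?A)}"
  have bij: "bij_betw ?F (?S \<times> ?S) G"
    unfolding bij_betw_def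
  proof (intro conjI)
    show "inj_on ?F (?S \<times> ?S)"
    proof (rule inj_onI, clarify)
      fix p q p' q' assume *: "p permutes {..<s}" "q permutes {..<s}" "p' permutes {..<s}" "q' permutes {..<s}"
        "E p \<circ> Od q = E p' \<circ> Od q'"
      have "p j = p' j \<and> q j = q' j" for j
      proof (cases "j < s")
        case True
        then show ?thesis
          using F_even[of p q j] F_even[of p' q' j] F_odd[of p q j] F_odd[of p' q' j] * by auto
      next
        case False
        then show ?thesis using * by (auto simp: permutes_def)
      qed
      then show "p = p' \<and> q = q'" by auto
    qed
    show "?F ` (?S \<times> ?S) = G"
    proof safe
      fix p q assume pq: "p permutes {..<s}" "q permutes {..<s}"
      show "E p \<circ> Od q \<in> G"
        using F_perm[of p q] F_even[of p q] pq
        by (auto simp: G_def permutes_in_image intro!: imageI simp del: o_apply) 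
          (metis imageI lessThan_iff permutes_in_image)
    next
      fix \<sigma> assume "\<sigma> \<in> G"
      then obtain p q where "p permutes ?A" "q permutes ?B" "\<sigma> = p \<circ> q"
        using permutes_split[OF disj, of \<sigma>] unfolding G_def union by blast
      then obtain p' q' where "p' \<in> ?S" "q' \<in> ?S" "\<sigma> = E p' \<circ> Od q'"
        using surjA[of p] surjB[of q] by auto
      then show "\<sigma> \<in> ?F ` (?S \<times> ?S)" by force
    qed
  qed
  let ?f = "\<lambda>\<sigma>. of_int (sign \<sigma>) * (\<Prod>j<s. K (\<sigma> (2 * j)) (\<sigma> (2 * j + 1))) :: 'a"
  have "pair_alt s (\<lambda>_. K) = sum ?f G"
    unfolding pair_alt_def
  proof (rule sum.mono_neutral_right)
    show "\<forall>\<sigma>\<in>{\<sigma>. \<sigma> permutes {..<2 * s}} - G. ?f \<sigma> = 0"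
    proof
      fix \<sigma> assume "\<sigma> \<in> {\<sigma>. \<sigma> permutes {..<2 * s}} - G"
      then obtain j where j: "j < s" "\<sigma> (2 * j) \<notin> ?A" and \<sigma>: "\<sigma> permutes {..<2 * s}"
        by (auto simp: G_def)
      then have "\<sigma> (2 * j) < 2 * s" using permutes_in_image[OF \<sigma>, of "2 * j"] by auto
      then have "odd (\<sigma> (2 * j))" using j(2) by (auto elim!: evenE)
      then have "K (\<sigma> (2 * j)) (\<sigma> (2 * j + 1)) = 0" using assms by auto
      then show "?f \<sigma> = 0" using j(1) by (auto intro!: prod_zero)
    qed
  qed (auto simp: G_def finite_permutations)
  also have "\<dots> = (\<Sum>(p, q)\<in>?S \<times> ?S. ?f (E p \<circ> Od q))"
    using sum.reindex_bij_betw[OF bij, of ?f] by (simp add: case_prod_unfold)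
  also have "\<dots> = (\<Sum>p\<in>?S. \<Sum>q\<in>?S. of_int (sign p * sign q) * (\<Prod>j<s. K (2 * p j) (2 * q j + 1)))"
    unfolding sum.cartesian_product
    using F_even F_odd F_sign by (intro sum.cong refl) (auto simp del: o_apply intro!: prod.cong)
  also have "\<dots> = (\<Sum>p\<in>?S. fdet s (\<lambda>i j. K (2 * i) (2 * j + 1)))"
  proof (rule sum.cong[OF refl])
    fix p assume "p \<in> ?S"
    then have p: "p permutes {..<s}" by simp
    \<comment> \<open>substitute \<open>q \<circ> p\<close> for \<open>q\<close>, which makes the summand independent of \<open>p\<close>\<close>
    have "(\<Sum>q\<in>?S. of_int (sign p * sign q) * (\<Prod>j<s. K (2 * p j) (2 * q j + 1))) =
          (\<Sum>q\<in>?S. of_int (sign p * sign (q \<circ> p)) * (\<Prod>j<s. K (2 * p j) (2 * (q \<circ> p) j + 1)))"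
      by (rule sum_permutations_compose_right[OF p])
    also have "\<dots> = (\<Sum>q\<in>?S. of_int (sign q) * (\<Prod>j<s. K (2 * j) (2 * q j + 1)))"
    proof (rule sum.cong[OF refl])
      fix q assume "q \<in> ?S"
      then have "sign p * sign (q \<circ> p) = sign q"
        using p by (subst sign_compose) (auto intro: permutes_imp_permutation[of "{..<s}"] simp: sign_idempotent mult_ac)
      moreover have "(\<Prod>j<s. K (2 * p j) (2 * (q \<circ> p) j + 1)) = (\<Prod>j<s. K (2 * j) (2 * q j + 1))"
        using prod.permute[OF p, of "\<lambda>j. K (2 * j) (2 * q j + 1)"] by (simp add: o_def)
      ultimately show "of_int (sign p * sign (q \<circ> p)) * (\<Prod>j<s. K (2 * p j) (2 * (q \<circ> p) j + 1)) =
        (of_int (sign q) * (\<Prod>j<s. K (2 * j) (2 * q j + 1)) :: 'a)" by simp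
    qed
    finally show "(\<Sum>q\<in>?S. of_int (sign p * sign q) * (\<Prod>j<s. K (2 * p j) (2 * q j + 1))) =
      fdet s (\<lambda>i j. K (2 * i) (2 * j + 1))" by (simp add: fdet_leibniz)
  qed
  also have "\<dots> = fact s * fdet s (\<lambda>i j. K (2 * i) (2 * j + 1))"
    using card_permutations[of "{..<s}" s] by simp
  finally show ?thesis .
qed

section \<open>Division by a quadratic polynomial\<close>

text \<open>
  Horner's scheme for the monic polynomial whose coefficients after the leading one are \<open>a 1, \<dots>, a n\<close>.
  Unlike \<open>poly\<close> it builds the polynomial from the top, in the direction of polynomial division.
\<close>
fun horner :: "(nat \<Rightarrow> real) \<Rightarrow> nat \<Rightarrow> complex \<Rightarrow> complex" where
  "horner a 0 z = 1"
| "horner a (Suc n) z = z * horner a n z + of_real (a (Suc n))"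

fun horner_deriv :: "(nat \<Rightarrow> real) \<Rightarrow> nat \<Rightarrow> complex \<Rightarrow> complex" where
  "horner_deriv a 0 z = 0"
| "horner_deriv a (Suc n) z = horner a n z + z * horner_deriv a n z"

lemma monic_poly_0: "monic_poly 0 a = 1"
  by (simp add: monic_poly_def monom_0 one_pCons)

lemma monic_poly_Suc: "monic_poly (Suc d) a = pCons (of_real (a (Suc d))) (monic_poly d a)"
proof -
  have "(\<Sum>i=1..d. monom (complex_of_real (a i)) (Suc d - i)) = pCons 0 (\<Sum>i=1..d. monom (complex_of_real (a i)) (d - i))"
  proof -
    have X: "pCons 0 (sum f A) = (\<Sum>i\<in>A. pCons 0 (f i))" for f :: "nat \<Rightarrow> complex poly" and A
    proof -
      have "pCons 0 (p + q) = pCons 0 p + pCons 0 q" for p q :: "complex poly" by simp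
      then show ?thesis by (induction A rule: infinite_finite_induct) (auto simp del: add_pCons)
    qed
    show ?thesis
      unfolding X by (rule sum.cong) (auto simp: Suc_diff_le monom_Suc)
  qed
  then show ?thesis
    by (simp add: monic_poly_def monom_Suc monom_0)
qed

lemma poly_monic_poly: "poly (monic_poly d a) z = horner a d z"
  by (induction d) (auto simp: monic_poly_0 monic_poly_Suc)

lemma poly_pderiv_monic_poly: "poly (pderiv (monic_poly d a)) z = horner_deriv a d z"
  by (induction d) (auto simp: monic_poly_0 monic_poly_Suc pderiv_pCons poly_monic_poly)

lemma degree_monic_poly: "degree (monic_poly d a) = d" and lead_coeff_monic_poly: "lead_coeff (monic_poly d a) = 1"
proof -
  have "degree (monic_poly d a) = d \<and> coeff (monic_poly d a) d = 1"
  proof (induction d)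
    case (Suc d)
    then have "monic_poly d a \<noteq> 0" by auto
    then show ?case using Suc by (simp add: monic_poly_Suc)
  qed (simp add: monic_poly_0)
  then show "degree (monic_poly d a) = d" "lead_coeff (monic_poly d a) = 1" by auto
qed

lemma monic_poly_nz: "monic_poly d a \<noteq> 0"
  using lead_coeff_monic_poly[of d a] by auto

lemma horner_cong: "(\<And>k. 1 \<le> k \<Longrightarrow> k \<le> d \<Longrightarrow> a k = b k) \<Longrightarrow> horner a d z = horner b d z"
  by (induction d) auto

lemma horner_cnj: "horner a d (cnj z) = cnj (horner a d z)"
  by (induction d) auto

text \<open>
  The coefficient sequence of a polynomial multiplied by the variable, with \<open>0\<close> in place of the missing
  entry; it keeps the recursions below uniform at the lower end.
\<close>
definition lag :: "(nat \<Rightarrow> real) \<Rightarrow> nat \<Rightarrow> real" where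
  "lag f k = (case k of 0 \<Rightarrow> 0 | Suc j \<Rightarrow> f j)"

lemma lag_simps [simp]: "lag f 0 = 0" "lag f (Suc k) = f k"
  by (auto simp: lag_def)

text \<open>
  The coefficients of the power series quotient of \<open>1 + a\<^sub>1 X + a\<^sub>2 X\<^sup>2 + \<dots>\<close> by \<open>1 + \<alpha> X + \<beta> X\<^sup>2\<close>, where
  \<open>t = (\<alpha>, \<beta>)\<close> stands for the quadratic polynomial \<open>X\<^sup>2 + \<alpha> X + \<beta>\<close> throughout. The first ones
  are the coefficients of the polynomial quotient, listed from the top.
\<close>
fun quot :: "(nat \<Rightarrow> real) \<Rightarrow> real \<times> real \<Rightarrow> nat \<Rightarrow> real" where
  "quot a t 0 = 1"
| "quot a t (Suc 0) = a 1 - fst t"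
| "quot a t (Suc (Suc k)) = a (Suc (Suc k)) - fst t * quot a t (Suc k) - snd t * quot a t k"

lemma quot_Suc: "quot a t (Suc k) = a (Suc k) - fst t * quot a t k - snd t * lag (quot a t) k"
  by (cases k) auto

declare quot.simps(2,3) [simp del]

lemma quot_cong: "(\<And>k. 1 \<le> k \<Longrightarrow> k \<le> n \<Longrightarrow> a k = b k) \<Longrightarrow> quot a t n = quot b t n"
proof (induction n rule: less_induct)
  case (less n)
  show ?case
  proof (cases n)
    case (Suc m)
    have "lag (quot a t) m = lag (quot b t) m"
      using less Suc by (cases m) auto
    then show ?thesis using less Suc by (simp add: quot_Suc)
  qed simp
qed

lemma quot_quot: "quot (quot a t) t k = quot a t k - fst t * lag (quot (quot a t) t) k - snd t * lag (lag (quot (quot a t) t)) k"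
  by (cases k) (auto simp: quot_Suc[of "quot a t"])

text \<open>
  If \<open>b\<close> lists the coefficients of a monic polynomial of degree \<open>d\<close>, starting with the leading \<open>1\<close>, these
  are the two lowest coefficients of its product with the quadratic \<open>t\<close>. All the other coefficients of
  the product are \<open>shear t b\<close>.
\<close>
definition low_coeffs :: "nat \<Rightarrow> real \<times> real \<Rightarrow> (nat \<Rightarrow> real) \<Rightarrow> real \<times> real" where
  "low_coeffs d t b = (fst t * b d + snd t * lag b d, snd t * b d)"

definition shear :: "real \<times> real \<Rightarrow> (nat \<Rightarrow> real) \<Rightarrow> nat \<Rightarrow> real" where
  "shear t b k = b k + fst t * (b(0 := 1)) (k - 1) + snd t * lag (b(0 := 1)) (k - 1)"

definition times_quad :: "nat \<Rightarrow> real \<times> real \<Rightarrow> (nat \<Rightarrow> real) \<Rightarrow> nat \<Rightarrow> real" where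
  "times_quad d t b = (\<lambda>k\<in>{1..d}. shear t b k)
     (Suc d := fst (low_coeffs d t (b(0 := 1))), Suc (Suc d) := snd (low_coeffs d t (b(0 := 1))))"

text \<open>
  The partial products after \<open>k\<close> coefficients carry the two lowest coefficients along, so that the
  identity can be proved by induction on \<open>k\<close>.
\<close>
lemma horner_shear:
  "(z\<^sup>2 + of_real (fst t) * z + of_real (snd t)) * horner b k z =
   z\<^sup>2 * horner (shear t b) k z + z * of_real (fst (low_coeffs k t (b(0 := 1)))) + of_real (snd (low_coeffs k t (b(0 := 1))))"
proof (induction k)
  case (Suc k)
  have "(z\<^sup>2 + of_real (fst t) * z + of_real (snd t)) * horner b (Suc k) z =
     z * ((z\<^sup>2 + of_real (fst t) * z + of_real (snd t)) * horner b k z) +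
     (z\<^sup>2 + of_real (fst t) * z + of_real (snd t)) * of_real (b (Suc k))"
    by (simp add: algebra_simps)
  also have "\<dots> = z\<^sup>2 * horner (shear t b) (Suc k) z + z * of_real (fst (low_coeffs (Suc k) t (b(0 := 1)))) +
    of_real (snd (low_coeffs (Suc k) t (b(0 := 1))))"
    unfolding Suc.IH by (cases k) (auto simp: shear_def low_coeffs_def algebra_simps power2_eq_square)
  finally show ?case .
qed (simp add: low_coeffs_def)

lemma horner_times_quad:
  "horner (times_quad d t b) (Suc (Suc d)) z = (z\<^sup>2 + of_real (fst t) * z + of_real (snd t)) * horner b d z"
proof -
  have "horner (times_quad d t b) d z = horner (shear t b) d z"
    by (rule horner_cong) (auto simp: times_quad_def)
  then show ?thesis
    unfolding horner_shear by (simp add: times_quad_def algebra_simps power2_eq_square)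
qed

lemma shear_quot:
  assumes "1 \<le> k" shows "shear t (quot a t) k = a k"
proof -
  have "(quot a t)(0 := 1) = quot a t" by auto
  then show ?thesis using assms by (cases k) (auto simp: shear_def quot_Suc)
qed

text \<open>
  The two roots of the quadratic \<open>t\<close>. Everything below is symmetric or antisymmetric in them, so that
  either order would do.
\<close>
definition rx :: "real \<times> real \<Rightarrow> complex" where
  "rx t = (- of_real (fst t) - csqrt (of_real ((fst t)\<^sup>2 - 4 * snd t))) / 2"

definition ry :: "real \<times> real \<Rightarrow> complex" where
  "ry t = (- of_real (fst t) + csqrt (of_real ((fst t)\<^sup>2 - 4 * snd t))) / 2"

lemma root_relations: "rx t + ry t = - of_real (fst t)" "rx t * ry t = of_real (snd t)"
proof -
  show "rx t + ry t = - of_real (fst t)" by (simp add: rx_def ry_def add_divide_distrib[symmetric])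
  have "rx t * ry t = ((of_real (fst t))\<^sup>2 - (csqrt (of_real ((fst t)\<^sup>2 - 4 * snd t)))\<^sup>2) / 4"
    by (simp add: rx_def ry_def power2_eq_square algebra_simps)
  also have "\<dots> = of_real (snd t)" by simp
  finally show "rx t * ry t = of_real (snd t)" .
qed

lemma quadratic_factor: "z\<^sup>2 + of_real (fst t) * z + of_real (snd t) = (z - rx t) * (z - ry t)"
proof -
  have "(z - rx t) * (z - ry t) = z\<^sup>2 - (rx t + ry t) * z + rx t * ry t"
    by (simp add: algebra_simps power2_eq_square)
  then show ?thesis unfolding root_relations by simp
qed

lemma rx_eq_ry_iff: "rx t = ry t \<longleftrightarrow> (fst t)\<^sup>2 = 4 * snd t"
proof -
  have "rx t = ry t \<longleftrightarrow> csqrt (of_real ((fst t)\<^sup>2 - 4 * snd t)) = 0"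
    by (auto simp: rx_def ry_def) 
  also have "\<dots> \<longleftrightarrow> (fst t)\<^sup>2 = 4 * snd t"
    by (metis csqrt_eq_0 eq_iff_diff_eq_0 of_real_eq_0_iff)
  finally show ?thesis .
qed

lemma roots_unique:
  assumes "x + y = - of_real (fst t)" "x * y = of_real (snd t)"
  shows "{x, y} = {rx t, ry t}"
proof -
  have *: "(z - x) * (z - y) = (z - rx t) * (z - ry t)" for z
  proof -
    have "(z - x) * (z - y) = z\<^sup>2 - (x + y) * z + x * y"
      by (simp add: algebra_simps power2_eq_square)
    then show ?thesis unfolding assms quadratic_factor[symmetric] by simp
  qed
  show ?thesis
    using *[of x] *[of y] *[of "rx t"] *[of "ry t"] by auto
qed

text \<open>
  This is the norm of the remainder of the polynomial \<open>b\<close> modulo the quadratic \<open>t\<close>, hence the resultant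
  of the two (\<open>res_eq\<close>). The form with coefficients is the one in which the Jacobian determinant
  of \<open>low_coeffs\<close> appears.
\<close>
definition res :: "nat \<Rightarrow> real \<times> real \<Rightarrow> (nat \<Rightarrow> real) \<Rightarrow> real" where
  "res d t b = (quot b t d)\<^sup>2 + fst t * quot b t d * lag (quot b t) d + snd t * (lag (quot b t) d)\<^sup>2"

text \<open>
  The right-hand side is the value at \<open>z\<close> of the remainder modulo \<open>t\<close>, obtained by Horner's scheme with
  \<open>z\<^sup>2 = - \<alpha> z - \<beta>\<close>.
\<close>
lemma horner_at_root:
  assumes "z\<^sup>2 + of_real (fst t) * z + of_real (snd t) = 0"
  shows "horner b n z = of_real (lag (quot b t) n) * z + of_real (quot b t n + fst t * lag (quot b t) n)"
proof (induction n)
  case (Suc n)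
  have z2: "z * z = - of_real (fst t) * z - of_real (snd t)"
  proof -
    have "z * z = (z\<^sup>2 + of_real (fst t) * z + of_real (snd t)) + (- of_real (fst t) * z - of_real (snd t))"
      by (simp add: power2_eq_square)
    then show ?thesis unfolding assms by simp
  qed
  have "horner b (Suc n) z = of_real (lag (quot b t) n) * (z * z) +
      z * of_real (quot b t n + fst t * lag (quot b t) n) + of_real (b (Suc n))"
    by (simp add: Suc.IH algebra_simps)
  also have "\<dots> = of_real (lag (quot b t) (Suc n)) * z + of_real (quot b t (Suc n) + fst t * lag (quot b t) (Suc n))"
    unfolding z2 by (simp add: quot_Suc algebra_simps)
  finally show ?case .
qed simp

lemma res_eq: "of_real (res d t b) = horner b d (rx t) * horner b d (ry t)"
proof -
  let ?r = "of_real (lag (quot b t) d) :: complex" and ?s = "of_real (quot b t d + fst t * lag (quot b t) d) :: complex"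
  have "horner b d (rx t) * horner b d (ry t) = (?r * rx t + ?s) * (?r * ry t + ?s)"
    using quadratic_factor[of "rx t" t] quadratic_factor[of "ry t" t] by (simp add: horner_at_root)
  also have "\<dots> = ?r\<^sup>2 * (rx t * ry t) + ?r * ?s * (rx t + ry t) + ?s\<^sup>2"
    by (simp add: algebra_simps power2_eq_square)
  also have "\<dots> = of_real (res d t b)"
    unfolding root_relations by (simp add: res_def algebra_simps power2_eq_square)
  finally show ?thesis by simp
qed

lemma res_cong: "(\<And>k. 1 \<le> k \<Longrightarrow> k \<le> d \<Longrightarrow> a k = b k) \<Longrightarrow> res d t a = res d t b"
proof -
  assume "\<And>k. 1 \<le> k \<Longrightarrow> k \<le> d \<Longrightarrow> a k = b k"
  then have "quot a t d = quot b t d" "lag (quot a t) d = lag (quot b t) d"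
    by (auto simp: lag_def split: nat.split intro!: quot_cong)
  then show "res d t a = res d t b" by (simp add: res_def)
qed

text \<open>
  Differentiating \<open>(1 + \<alpha> X + \<beta> X\<^sup>2) b = a\<close> at fixed \<open>a\<close> gives \<open>- X b / (1 + \<alpha> X + \<beta> X\<^sup>2)\<close> for the
  derivative in \<open>\<alpha>\<close>, and one factor \<open>X\<close> more for that in \<open>\<beta>\<close>; a quotient of the quotient appears. The shifted
  sequence is treated along with it because the recursion refers to two predecessors.
\<close>
lemma quot_has_derivative:
  "((\<lambda>t. quot a t k) has_derivative
     (\<lambda>h. - lag (quot (quot a t) t) k * fst h - lag (lag (quot (quot a t) t)) k * snd h)) (at t)"
  "((\<lambda>t. lag (quot a t) k) has_derivative
     (\<lambda>h. - lag (lag (quot (quot a t) t)) k * fst h - lag (lag (lag (quot (quot a t) t))) k * snd h)) (at t)"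
proof (induction k)
  case (Suc k)
  let ?c = "quot (quot a t) t"
  have "((\<lambda>t. a (Suc k) - fst t * quot a t k - snd t * lag (quot a t) k) has_derivative
     (\<lambda>h. - lag ?c (Suc k) * fst h - lag (lag ?c) (Suc k) * snd h)) (at t)"
  proof (rule has_derivative_eq_rhs, (rule derivative_intros Suc.IH)+, rule ext)
    fix h :: "real \<times> real"
    have "quot a t k = ?c k + fst t * lag ?c k + snd t * lag (lag ?c) k"
      using quot_quot[of a t k] by simp
    moreover have "lag (quot a t) k = lag ?c k + fst t * lag (lag ?c) k + snd t * lag (lag (lag ?c)) k"
      using quot_quot[of a t "k - 1"] by (cases k) auto
    ultimately show "0 - (fst t * (- lag ?c k * fst h - lag (lag ?c) k * snd h) + fst h * quot a t k) -
         (snd t * (- lag (lag ?c) k * fst h - lag (lag (lag ?c)) k * snd h) + snd h * lag (quot a t) k) =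
        - lag ?c (Suc k) * fst h - lag (lag ?c) (Suc k) * snd h"
      by (simp add: algebra_simps)
  qed
  then show "((\<lambda>t. quot a t (Suc k)) has_derivative
     (\<lambda>h. - lag ?c (Suc k) * fst h - lag (lag ?c) (Suc k) * snd h)) (at t)"
    by (simp only: quot_Suc)
  show "((\<lambda>t. lag (quot a t) (Suc k)) has_derivative
     (\<lambda>h. - lag (lag ?c) (Suc k) * fst h - lag (lag (lag ?c)) (Suc k) * snd h)) (at t)"
    using Suc.IH(1) by simp
qed simp_all

text \<open>
  Fix the upper coefficients \<open>a\<^sub>1, \<dots>, a\<^sub>d\<close> of a polynomial that is divisible by \<open>t\<close>; then \<open>t\<close> determines the two
  lowest coefficients. The determinant of the derivative of this map of the plane is \<open>res d t (quot a t)\<close>.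
\<close>
lemma low_coeffs_has_derivative:
  fixes a t d
  defines "c \<equiv> quot (quot a t) t"
  shows "((\<lambda>t. low_coeffs d t (quot a t)) has_derivative
     (\<lambda>h. (c d * fst h + lag c d * snd h, (- snd t * lag c d) * fst h + (c d + fst t * lag c d) * snd h))) (at t)"
proof -
  have b: "quot a t d = c d + fst t * lag c d + snd t * lag (lag c) d"
    using quot_quot[of a t d] by (simp add: c_def)
  have b': "lag (quot a t) d = lag c d + fst t * lag (lag c) d + snd t * lag (lag (lag c)) d"
    using quot_quot[of a t "d - 1"] by (cases d) (auto simp: c_def)
  show ?thesis
    unfolding low_coeffs_def
  proof (rule has_derivative_eq_rhs, (rule derivative_intros quot_has_derivative)+, rule ext)
    fix h :: "real \<times> real"
    show "(fst t * (- lag (quot (quot a t) t) d * fst h - lag (lag (quot (quot a t) t)) d * snd h) + fst h * quot a t d +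
          (snd t * (- lag (lag (quot (quot a t) t)) d * fst h - lag (lag (lag (quot (quot a t) t))) d * snd h) + snd h * lag (quot a t) d),
          snd t * (- lag (quot (quot a t) t) d * fst h - lag (lag (quot (quot a t) t)) d * snd h) + snd h * quot a t d) =
         (c d * fst h + lag c d * snd h, (- snd t * lag c d) * fst h + (c d + fst t * lag c d) * snd h)"
      unfolding b b' c_def[symmetric] by (simp add: algebra_simps)
  qed
qed

lemma continuous_quot:
  assumes "\<And>k. continuous_on UNIV (\<lambda>t. f t k)"
  shows "continuous_on UNIV (\<lambda>t. quot (f t) t k)" "continuous_on UNIV (\<lambda>t. lag (quot (f t) t) k)"
proof (induction k)
  case (Suc k)
  show "continuous_on UNIV (\<lambda>t. quot (f t) t (Suc k))"
    unfolding quot_Suc by (intro continuous_intros assms Suc.IH)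
qed simp_all

section \<open>Quadratic factors counted with sign\<close>

text \<open>
  Requiring simple roots costs a null set of polynomials only and makes all counts below exact.
\<close>
definition polys_in :: "complex set \<Rightarrow> nat \<Rightarrow> (nat \<Rightarrow> real) set" where
  "polys_in Z d = {a \<in> {1..d} \<rightarrow>\<^sub>E UNIV. \<forall>z. horner a d z = 0 \<longrightarrow> z \<in> Z \<and> horner_deriv a d z \<noteq> 0}"

text \<open>
  This is \<open>polys_in Z 2\<close> in the notation for quadratics.
\<close>
definition quads_in :: "complex set \<Rightarrow> (real \<times> real) set" where
  "quads_in Z = {t. rx t \<in> Z \<and> ry t \<in> Z \<and> rx t \<noteq> ry t}"

lemma horner_deriv_times_quad:
  "horner_deriv (times_quad d t b) (Suc (Suc d)) z =
     (2 * z + of_real (fst t)) * horner b d z + (z - rx t) * (z - ry t) * horner_deriv b d z"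
proof -
  have "poly (monic_poly (Suc (Suc d)) (times_quad d t b)) = poly ([:of_real (snd t), of_real (fst t), 1:] * monic_poly d b)"
    by (rule ext) (simp add: poly_monic_poly horner_times_quad power2_eq_square algebra_simps del: horner.simps)
  then have eq: "monic_poly (Suc (Suc d)) (times_quad d t b) = [:of_real (snd t), of_real (fst t), 1:] * monic_poly d b"
    by (simp only: poly_eq_poly_eq_iff)
  have "horner_deriv (times_quad d t b) (Suc (Suc d)) z =
     (z\<^sup>2 + of_real (fst t) * z + of_real (snd t)) * horner_deriv b d z + (2 * z + of_real (fst t)) * horner b d z"
    unfolding poly_pderiv_monic_poly[symmetric] eq pderiv_mult
    by (simp add: pderiv_pCons poly_monic_poly poly_pderiv_monic_poly power2_eq_square algebra_simps)
  then show ?thesis unfolding quadratic_factor by simp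
qed

text \<open>
  A product has simple roots precisely when its factors have simple roots and the resultant does not
  vanish. In the recursion the resultant is a factor of the integrand, so its zeros are harmless.
\<close>
lemma times_quad_in_polys_in_iff:
  assumes t: "t \<in> quads_in Z" and b: "b \<in> {1..d} \<rightarrow>\<^sub>E UNIV" and r: "res d t b \<noteq> 0"
  shows "times_quad d t b \<in> polys_in Z (Suc (Suc d)) \<longleftrightarrow> b \<in> polys_in Z d"
proof -
  have ext: "times_quad d t b \<in> {1..Suc (Suc d)} \<rightarrow>\<^sub>E UNIV"
    by (auto simp: times_quad_def PiE_def extensional_def)
  have nz: "horner b d (rx t) \<noteq> 0" "horner b d (ry t) \<noteq> 0"
    using r res_eq[of d t b] by auto
  have rr: "2 * rx t + of_real (fst t) = rx t - ry t" "2 * ry t + of_real (fst t) = ry t - rx t"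
    using root_relations(1)[of t] by (simp_all add: algebra_simps eq_neg_iff_add_eq_0)
  have H: "horner (times_quad d t b) (Suc (Suc d)) z = (z - rx t) * (z - ry t) * horner b d z" for z
    unfolding horner_times_quad quadratic_factor ..
  have tZ: "rx t \<in> Z" "ry t \<in> Z" "rx t \<noteq> ry t"
    using t by (auto simp: quads_in_def)
  have "(\<forall>z. horner (times_quad d t b) (Suc (Suc d)) z = 0 \<longrightarrow> z \<in> Z \<and> horner_deriv (times_quad d t b) (Suc (Suc d)) z \<noteq> 0) \<longleftrightarrow>
        (\<forall>z. horner b d z = 0 \<longrightarrow> z \<in> Z \<and> horner_deriv b d z \<noteq> 0)" (is "?L \<longleftrightarrow> ?R")
  proof
    assume ?L
    show ?R
    proof (intro allI impI)
      fix z assume z: "horner b d z = 0"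
      then have "z \<in> Z" "horner_deriv (times_quad d t b) (Suc (Suc d)) z \<noteq> 0"
        using \<open>?L\<close> H by auto
      then show "z \<in> Z \<and> horner_deriv b d z \<noteq> 0"
        unfolding horner_deriv_times_quad using z by auto
    qed
  next
    assume ?R
    show ?L
    proof (intro allI impI)
      fix z assume "horner (times_quad d t b) (Suc (Suc d)) z = 0"
      then consider "z = rx t" | "z = ry t" | "z \<noteq> rx t" "z \<noteq> ry t" "horner b d z = 0"
        unfolding H by auto
      then show "z \<in> Z \<and> horner_deriv (times_quad d t b) (Suc (Suc d)) z \<noteq> 0"
      proof cases
        case 1
        then have "horner_deriv (times_quad d t b) (Suc (Suc d)) z = (rx t - ry t) * horner b d (rx t)"
          by (simp only: horner_deriv_times_quad rr) simp
        then show ?thesis using 1 tZ nz by simp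
      next
        case 2
        then have "horner_deriv (times_quad d t b) (Suc (Suc d)) z = (ry t - rx t) * horner b d (ry t)"
          by (simp only: horner_deriv_times_quad rr) simp
        then show ?thesis using 2 tZ nz by simp
      next
        case 3
        then show ?thesis using \<open>?R\<close> unfolding horner_deriv_times_quad by simp
      qed
    qed
  qed
  then show ?thesis using b ext unfolding polys_in_def by blast
qed

definition root_set :: "(nat \<Rightarrow> real) \<Rightarrow> nat \<Rightarrow> complex set" where
  "root_set a d = {z. horner a d z = 0}"

lemma finite_root_set: "finite (root_set a d)"
  using poly_roots_finite[OF monic_poly_nz[of d a]] by (simp add: root_set_def poly_monic_poly)

lemma polys_in_decompose:
  assumes "a \<in> polys_in Z d"
  shows "monic_poly d a = (\<Prod>z\<in>root_set a d. [:- z, 1:])"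
    and "horner a d z = (\<Prod>r\<in>root_set a d. z - r)"
    and "card (root_set a d) = d" and "root_set a d \<subseteq> Z"
proof -
  have "rsquarefree (monic_poly d a)"
    using assms by (auto simp: rsquarefree_roots poly_monic_poly poly_pderiv_monic_poly polys_in_def)
  from complex_poly_decompose_rsquarefree[OF this]
  show eq: "monic_poly d a = (\<Prod>z\<in>root_set a d. [:- z, 1:])"
    using lead_coeff_monic_poly[of d a] by (simp add: root_set_def poly_monic_poly)
  show "horner a d z = (\<Prod>r\<in>root_set a d. z - r)"
    unfolding poly_monic_poly[symmetric] eq by (simp add: poly_prod)
  have "degree (monic_poly d a) = card (root_set a d)"
    unfolding eq by (subst degree_prod_eq_sum_degree) auto
  then show "card (root_set a d) = d" using degree_monic_poly[of d a] by simp
  show "root_set a d \<subseteq> Z" using assms by (auto simp: polys_in_def root_set_def)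
qed

text \<open>
  Division of the polynomial \<open>a\<close> by \<open>t\<close>: the last two summands are the remainder.
\<close>
lemma horner_low_coeffs:
  "horner a (Suc (Suc d)) z = (z - rx t) * (z - ry t) * horner (quot a t) d z
     + z * of_real (a (Suc d) - fst (low_coeffs d t (quot a t))) + of_real (a (Suc (Suc d)) - snd (low_coeffs d t (quot a t)))"
proof -
  have 0: "(quot a t)(0 := 1) = quot a t" by auto
  have "horner (shear t (quot a t)) d z = horner a d z"
    by (rule horner_cong) (simp add: shear_quot)
  then have "(z - rx t) * (z - ry t) * horner (quot a t) d z =
    z\<^sup>2 * horner a d z + z * of_real (fst (low_coeffs d t (quot a t))) + of_real (snd (low_coeffs d t (quot a t)))"
    using horner_shear[of z t "quot a t" d] unfolding 0 quadratic_factor by simp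
  then show ?thesis by (simp add: algebra_simps power2_eq_square)
qed

text \<open>
  The remainder is linear and vanishes at two distinct points only if it is zero.
\<close>
lemma low_coeffs_eq_iff:
  assumes "rx t \<noteq> ry t"
  shows "low_coeffs d t (quot a t) = (a (Suc d), a (Suc (Suc d))) \<longleftrightarrow>
         horner a (Suc (Suc d)) (rx t) = 0 \<and> horner a (Suc (Suc d)) (ry t) = 0"
proof -
  define u where "u = complex_of_real (a (Suc d) - fst (low_coeffs d t (quot a t)))"
  define v where "v = complex_of_real (a (Suc (Suc d)) - snd (low_coeffs d t (quot a t)))"
  have H: "horner a (Suc (Suc d)) (rx t) = rx t * u + v" "horner a (Suc (Suc d)) (ry t) = ry t * u + v"
    unfolding u_def v_def
    by (simp_all only: horner_low_coeffs[of _ _ _ t] diff_self mult_zero_left mult_zero_right add_0)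
  have "rx t * u + v = 0 \<and> ry t * u + v = 0 \<longleftrightarrow> u = 0 \<and> v = 0"
  proof
    assume *: "rx t * u + v = 0 \<and> ry t * u + v = 0"
    then have "rx t * u = ry t * u" by (metis add_right_cancel)
    then have "u = 0" using assms by simp
    then show "u = 0 \<and> v = 0" using * by simp
  qed simp
  moreover have "u = 0 \<and> v = 0 \<longleftrightarrow> low_coeffs d t (quot a t) = (a (Suc d), a (Suc (Suc d)))"
    unfolding u_def v_def of_real_eq_0_iff by (auto simp: prod_eq_iff)
  ultimately show ?thesis unfolding H by simp
qed

lemma res_fibre:
  assumes a: "a \<in> polys_in Z (Suc (Suc d))" and t: "rx t \<noteq> ry t"
    and top: "low_coeffs d t (quot a t) = (a (Suc d), a (Suc (Suc d)))"
  shows "horner (quot a t) d z = (\<Prod>r\<in>root_set a (Suc (Suc d)) - {rx t, ry t}. z - r)"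
proof -
  let ?R = "root_set a (Suc (Suc d))"
  let ?q = "[:- rx t, 1:] * [:- ry t, 1:]"
  have xy: "rx t \<in> ?R" "ry t \<in> ?R"
    using low_coeffs_eq_iff[OF t] top by (auto simp: root_set_def)
  have "poly (monic_poly (Suc (Suc d)) a) = poly (?q * monic_poly d (quot a t))"
    by (rule ext) (simp add: poly_monic_poly horner_low_coeffs[of a d _ t] top algebra_simps del: horner.simps)
  then have "monic_poly (Suc (Suc d)) a = ?q * monic_poly d (quot a t)"
    by (simp only: poly_eq_poly_eq_iff)
  moreover have "monic_poly (Suc (Suc d)) a = ?q * (\<Prod>z\<in>?R - {rx t, ry t}. [:- z, 1:])"
  proof -
    have "?R - {rx t, ry t} = ?R - {rx t} - {ry t}" by auto
    moreover have "(\<Prod>z\<in>?R. [:- z, 1:]) = [:- rx t, 1:] * (\<Prod>z\<in>?R - {rx t}. [:- z, 1:])"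
      using finite_root_set xy(1) by (rule prod.remove)
    moreover have "(\<Prod>z\<in>?R - {rx t}. [:- z, 1:]) = [:- ry t, 1:] * (\<Prod>z\<in>?R - {rx t} - {ry t}. [:- z, 1:])"
      using finite_root_set[of a "Suc (Suc d)"] xy(2) t by (intro prod.remove) auto
    ultimately show ?thesis
      unfolding polys_in_decompose(1)[OF a] by (simp only: mult.assoc)
  qed
  moreover have "?q \<noteq> 0" by simp
  ultimately have "monic_poly d (quot a t) = (\<Prod>z\<in>?R - {rx t, ry t}. [:- z, 1:])"
    using mult_cancel_left[of ?q] by metis
  then show ?thesis
    unfolding poly_monic_poly[symmetric] by (simp add: poly_prod)
qed

definition region_real :: "complex set" where
  "region_real = {z. Im z = 0 \<and> norm z < 1}"

definition region_nonreal :: "complex set" where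
  "region_nonreal = {z. Im z \<noteq> 0 \<and> norm z < 1}"

text \<open>
  The summand at \<open>x\<close> is \<open>(-1)\<close> to the number of elements above \<open>x\<close>, which alternates; adding a new
  maximum flips all earlier signs and contributes \<open>1\<close>.
\<close>
lemma sum_alternating_signs:
  fixes R :: "real set"
  assumes "finite R"
  shows "(\<Sum>x\<in>R. \<Prod>r\<in>R - {x}. sgn (x - r)) = (if even (card R) then 0 else 1)"
  using assms
proof (induction R rule: finite_linorder_max_induct)
  case (insert w R)
  have w: "w \<notin> R" using insert.hyps by auto
  have "(\<Prod>r\<in>insert w R - {x}. sgn (x - r)) = - (\<Prod>r\<in>R - {x}. sgn (x - r))" if "x \<in> R" for x
  proof -
    have "insert w R - {x} = insert w (R - {x})" using w that by auto
    then show ?thesis using insert.hyps w that by simp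
  qed
  moreover have "(\<Prod>r\<in>insert w R - {w}. sgn (w - r)) = 1"
    using insert.hyps w by (intro prod.neutral) auto
  ultimately have "(\<Sum>x\<in>insert w R. \<Prod>r\<in>insert w R - {x}. sgn (x - r)) = 1 - (\<Sum>x\<in>R. \<Prod>r\<in>R - {x}. sgn (x - r))"
    using insert.hyps w by (simp add: sum_negf)
  then show ?case using insert.IH insert.hyps w by simp
qed simp

text \<open>
  With \<open>e x\<close> the sign of the product of all \<open>x - r\<close>, the sign belonging to the pair \<open>x < y\<close> is \<open>- e x * e y\<close>.
  Expanding \<open>(\<Sum>x. e x)\<^sup>2 = 0\<close> and using \<open>(e x)\<^sup>2 = 1\<close> gives \<open>0 = 2m - 2 \<Sum>\<close>, where the sum is that of the signs.
\<close>
lemma count_signed_pairs: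
  fixes R :: "real set"
  assumes fin: "finite R" and card: "card R = 2 * m"
  defines "P \<equiv> \<lambda>x y. \<Prod>r\<in>R - {x, y}. (x - r) * (y - r)"
  shows "card {(x, y). x \<in> R \<and> y \<in> R \<and> x < y \<and> P x y > 0} =
         card {(x, y). x \<in> R \<and> y \<in> R \<and> x < y \<and> P x y < 0} + m"
proof -
  define A where "A = {(x, y). x \<in> R \<and> y \<in> R \<and> x < y}"
  define B where "B = {(x, y). x \<in> R \<and> y \<in> R \<and> y < x}"
  have finA: "finite A" and finB: "finite B"
    by (rule finite_subset[of _ "R \<times> R"]; use fin in \<open>auto simp: A_def B_def\<close>)+
  define e where "e x = (\<Prod>r\<in>R - {x}. sgn (x - r))" for x
  have sgn_P: "sgn (P x y) = (\<Prod>r\<in>R - {x, y}. sgn (x - r)) * (\<Prod>r\<in>R - {x, y}. sgn (y - r))" for x y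
  proof -
    have "sgn (\<Prod>r\<in>X. f r) = (\<Prod>r\<in>X. sgn (f r))" for X and f :: "real \<Rightarrow> real"
      by (induction X rule: infinite_finite_induct) (auto simp: sgn_mult)
    then show ?thesis by (simp add: P_def sgn_mult prod.distrib)
  qed
  have ee: "e x * e y = - sgn (P x y)" if "(x, y) \<in> A" for x y
  proof -
    have xy: "x \<in> R" "y \<in> R" "x < y" using that by (auto simp: A_def)
    have "e x = sgn (x - y) * (\<Prod>r\<in>R - {x} - {y}. sgn (x - r))"
      unfolding e_def using fin xy by (subst prod.remove[of _ y]) auto
    moreover have "e y = sgn (y - x) * (\<Prod>r\<in>R - {y} - {x}. sgn (y - r))"
      unfolding e_def using fin xy by (subst prod.remove[of _ x]) auto
    moreover have "R - {x} - {y} = R - {x, y}" "R - {y} - {x} = R - {x, y}" by auto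
    ultimately show ?thesis using xy by (simp add: sgn_P)
  qed
  have e1: "e x * e x = 1" if "x \<in> R" for x
  proof -
    have "e x * e x = (\<Prod>r\<in>R - {x}. sgn (x - r) * sgn (x - r))" unfolding e_def prod.distrib ..
    also have "\<dots> = 1" by (rule prod.neutral) (auto simp: sgn_if)
    finally show ?thesis .
  qed
  have "(\<Sum>(x, y)\<in>R \<times> R. e x * e y) = (\<Sum>x\<in>R. e x) * (\<Sum>y\<in>R. e y)"
    by (simp add: sum_product sum.cartesian_product)
  also have "(\<Sum>x\<in>R. e x) = 0" using sum_alternating_signs[OF fin] card by (simp add: e_def)
  finally have "0 = (\<Sum>(x, y)\<in>R \<times> R. e x * e y)" by simp
  also have "R \<times> R = (\<lambda>x. (x, x)) ` R \<union> (A \<union> B)" by (auto simp: A_def B_def)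
  also have "(\<Sum>(x, y)\<in>(\<lambda>x. (x, x)) ` R \<union> (A \<union> B). e x * e y) =
     (\<Sum>(x, y)\<in>(\<lambda>x. (x, x)) ` R. e x * e y) + ((\<Sum>(x, y)\<in>A. e x * e y) + (\<Sum>(x, y)\<in>B. e x * e y))"
    using fin finA finB by (subst sum.union_disjoint, auto simp: A_def B_def)+
  also have "(\<Sum>(x, y)\<in>(\<lambda>x. (x, x)) ` R. e x * e y) = 2 * real m"
    using card e1 by (subst sum.reindex) (auto simp: inj_on_def)
  also have "(\<Sum>(x, y)\<in>B. e x * e y) = (\<Sum>(x, y)\<in>A. e x * e y)"
    by (rule sum.reindex_bij_witness[of _ "\<lambda>(x, y). (y, x)" "\<lambda>(x, y). (y, x)"]) (auto simp: A_def B_def mult.commute)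
  also have "(\<Sum>(x, y)\<in>A. e x * e y) = - (\<Sum>(x, y)\<in>A. sgn (P x y))"
    unfolding sum_negf[symmetric] using ee by (intro sum.cong) auto
  finally have S: "(\<Sum>(x, y)\<in>A. sgn (P x y)) = real m" by simp
  define Ap where "Ap = {(x, y). x \<in> R \<and> y \<in> R \<and> x < y \<and> P x y > 0}"
  define An where "An = {(x, y). x \<in> R \<and> y \<in> R \<and> x < y \<and> P x y < 0}"
  have nz: "P x y \<noteq> 0" for x y using fin by (auto simp: P_def)
  have "A = Ap \<union> An" "Ap \<inter> An = {}"
    using nz by (auto simp: A_def Ap_def An_def neq_iff)
  moreover have "finite Ap" "finite An"
    using finA by (auto simp: A_def Ap_def An_def elim: finite_subset[rotated])
  ultimately have "(\<Sum>(x, y)\<in>A. sgn (P x y)) = (\<Sum>(x, y)\<in>Ap. sgn (P x y)) + (\<Sum>(x, y)\<in>An. sgn (P x y))"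
    by (simp add: sum.union_disjoint)
  also have "(\<Sum>(x, y)\<in>Ap. sgn (P x y)) = (\<Sum>(x, y)\<in>Ap. 1)" by (rule sum.cong) (auto simp: Ap_def)
  also have "(\<Sum>(x, y)\<in>An. sgn (P x y)) = (\<Sum>(x, y)\<in>An. - 1)" by (rule sum.cong) (auto simp: An_def)
  finally have "real (card Ap) = real (card An) + real m" using S by (simp add: case_prod_unfold)
  then show ?thesis unfolding Ap_def An_def by linarith
qed

text \<open>
  The quadratic factors of the polynomial \<open>a\<close> of degree \<open>d + 2\<close> with two distinct roots in \<open>Z\<close>.
\<close>
definition fibre :: "complex set \<Rightarrow> nat \<Rightarrow> (nat \<Rightarrow> real) \<Rightarrow> (real \<times> real) set" where
  "fibre Z d a = {t \<in> quads_in Z. low_coeffs d t (quot a t) = (a (Suc d), a (Suc (Suc d)))}"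

lemma fibre_iff:
  assumes "a \<in> polys_in Z (Suc (Suc d))"
  shows "t \<in> fibre Z d a \<longleftrightarrow> rx t \<noteq> ry t \<and> rx t \<in> root_set a (Suc (Suc d)) \<and> ry t \<in> root_set a (Suc (Suc d))"
proof (cases "rx t = ry t")
  case False
  have "t \<in> fibre Z d a \<longleftrightarrow> rx t \<in> Z \<and> ry t \<in> Z \<and> rx t \<in> root_set a (Suc (Suc d)) \<and> ry t \<in> root_set a (Suc (Suc d))"
    unfolding fibre_def quads_in_def mem_Collect_eq low_coeffs_eq_iff[OF False] root_set_def using False by blast
  then show ?thesis using False polys_in_decompose(4)[OF assms] by blast
qed (auto simp: fibre_def quads_in_def)

lemma res_of_fibre:
  assumes "a \<in> polys_in Z (Suc (Suc d))" "t \<in> fibre Z d a"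
  shows "of_real (res d t (quot a t)) = (\<Prod>r\<in>root_set a (Suc (Suc d)) - {rx t, ry t}. (rx t - r) * (ry t - r))"
proof -
  have "rx t \<noteq> ry t" "low_coeffs d t (quot a t) = (a (Suc d), a (Suc (Suc d)))"
    using assms(2) by (auto simp: fibre_def quads_in_def)
  then show ?thesis
    using res_fibre[OF assms(1), of t] by (simp add: res_eq prod.distrib)
qed

text \<open>
  Pairs \<open>x < y\<close> of roots correspond to the quadratic factors, so this is \<open>count_signed_pairs\<close>.
\<close>
lemma fibre_count_real:
  assumes a: "a \<in> polys_in region_real (Suc (Suc (2 * m)))"
  shows "finite (fibre region_real (2 * m) a)"
    and "card {t \<in> fibre region_real (2 * m) a. res (2 * m) t (quot a t) > 0} =
         card {t \<in> fibre region_real (2 * m) a. res (2 * m) t (quot a t) < 0} + Suc m"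
proof -
  let ?R = "root_set a (Suc (Suc (2 * m)))"
  define R where "R = Re ` ?R"
  have real: "z = of_real (Re z)" if "z \<in> ?R" for z
    using polys_in_decompose(4)[OF a] that by (auto simp: region_real_def complex_eq_iff)
  have RR: "?R = of_real ` R"
    unfolding R_def image_image using real by force
  have finR: "finite R" unfolding R_def by (intro finite_imageI finite_root_set)
  have "card ?R = card R" unfolding RR by (rule card_image) (auto simp: inj_on_def)
  then have cardR: "card R = 2 * Suc m"
    using polys_in_decompose(3)[OF a] by simp
  define P where "P x y = (\<Prod>r\<in>R - {x, y}. (x - r) * (y - r))" for x y
  define A where "A = {(x, y). x \<in> R \<and> y \<in> R \<and> x < y}"
  define \<Phi> :: "real \<times> real \<Rightarrow> real \<times> real" where "\<Phi> = (\<lambda>(x, y). (- (x + y), x * y))"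
  have roots\<Phi>: "{rx (\<Phi> (x, y)), ry (\<Phi> (x, y))} = {of_real x, of_real y}" for x y
    by (rule roots_unique[symmetric]) (auto simp: \<Phi>_def)
  have inj: "inj_on \<Phi> A"
  proof (rule inj_onI, clarify)
    fix x y x' y' assume *: "(x, y) \<in> A" "(x', y') \<in> A" "\<Phi> (x, y) = \<Phi> (x', y')"
    then have "{complex_of_real x, of_real y} = {of_real x', of_real y'}"
      using roots\<Phi>[of x y] roots\<Phi>[of x' y'] by simp
    then have "x = x' \<and> y = y' \<or> x = y' \<and> y = x'" by (auto simp: doubleton_eq_iff)
    then show "x = x' \<and> y = y'" using * by (auto simp: A_def)
  qed
  have fib: "fibre region_real (2 * m) a = \<Phi> ` A"
  proof (intro Set.set_eqI iffI)
    fix t assume "t \<in> fibre region_real (2 * m) a"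
    then have t: "rx t \<noteq> ry t" "rx t \<in> ?R" "ry t \<in> ?R" using fibre_iff[OF a] by auto
    then obtain x y where xy: "rx t = of_real x" "ry t = of_real y" "x \<in> R" "y \<in> R" unfolding RR by auto
    have "of_real (fst t) = complex_of_real (- (x + y))" "of_real (snd t) = complex_of_real (x * y)"
      using root_relations[of t] xy by (auto simp: algebra_simps eq_neg_iff_add_eq_0)
    then have "t = (- (x + y), x * y)" by (auto simp only: of_real_eq_iff prod_eq_iff fst_conv snd_conv)
    moreover have "x \<noteq> y" using t xy by auto
    ultimately show "t \<in> \<Phi> ` A" using xy
      by (cases "x < y") (auto simp: A_def \<Phi>_def image_iff add.commute mult.commute intro!: bexI[of _ "(x, y)"] bexI[of _ "(y, x)"])
  next
    fix t assume "t \<in> \<Phi> ` A"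
    then obtain x y where xy: "t = \<Phi> (x, y)" "x \<in> R" "y \<in> R" "x < y" by (auto simp: A_def)
    then show "t \<in> fibre region_real (2 * m) a"
      unfolding fibre_iff[OF a] RR using roots\<Phi>[of x y] by (auto simp: doubleton_eq_iff)
  qed
  have resP: "res (2 * m) (\<Phi> (x, y)) (quot a (\<Phi> (x, y))) = P x y" if "(x, y) \<in> A" for x y
  proof -
    let ?t = "\<Phi> (x, y)"
    have "?t \<in> fibre region_real (2 * m) a" using fib that by auto
    from res_of_fibre[OF a this]
    have "of_real (res (2 * m) ?t (quot a ?t)) = (\<Prod>r\<in>?R - {rx ?t, ry ?t}. (rx ?t - r) * (ry ?t - r))" .
    also have "\<dots> = (\<Prod>r\<in>?R - {of_real x, of_real y}. (of_real x - r) * (of_real y - r))"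
      using roots\<Phi>[of x y] by (auto simp: doubleton_eq_iff insert_commute mult.commute)
    also have "?R - {of_real x, of_real y} = of_real ` (R - {x, y})"
      unfolding RR by auto
    also have "(\<Prod>r\<in>of_real ` (R - {x, y}). (of_real x - r) * (of_real y - r)) = complex_of_real (P x y)"
      by (subst prod.reindex) (auto simp: inj_on_def P_def)
    finally show ?thesis by (simp only: of_real_eq_iff)
  qed
  have finA: "finite A" by (rule finite_subset[of _ "R \<times> R"]) (use finR in \<open>auto simp: A_def\<close>)
  then show "finite (fibre region_real (2 * m) a)" unfolding fib by simp
  have c: "card {t \<in> fibre region_real (2 * m) a. Q (res (2 * m) t (quot a t))} =
      card {(x, y). x \<in> R \<and> y \<in> R \<and> x < y \<and> Q (P x y)}" for Q
  proof -
    have "{t \<in> fibre region_real (2 * m) a. Q (res (2 * m) t (quot a t))} = \<Phi> ` {p \<in> A. Q (P (fst p) (snd p))}"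
      unfolding fib using resP by (force simp: A_def)
    also have "card \<dots> = card {p \<in> A. Q (P (fst p) (snd p))}"
      using inj by (intro card_image) (auto simp: inj_on_def)
    also have "{p \<in> A. Q (P (fst p) (snd p))} = {(x, y). x \<in> R \<and> y \<in> R \<and> x < y \<and> Q (P x y)}"
      by (auto simp: A_def)
    finally show ?thesis .
  qed
  show "card {t \<in> fibre region_real (2 * m) a. res (2 * m) t (quot a t) > 0} =
         card {t \<in> fibre region_real (2 * m) a. res (2 * m) t (quot a t) < 0} + Suc m"
    unfolding c[of "\<lambda>x. x > 0"] c[of "\<lambda>x. x < 0"] P_def by (rule count_signed_pairs[OF finR cardR])
qed

lemma root_set_cnj: "z \<in> root_set a d \<Longrightarrow> cnj z \<in> root_set a d"
  by (simp add: root_set_def horner_cnj)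

lemma card_root_set:
  "card (root_set a d) = 2 * card {z \<in> root_set a d. Im z > 0} + card {z \<in> root_set a d. Im z = 0}"
proof -
  let ?U = "{z \<in> root_set a d. Im z > 0}" and ?L = "{z \<in> root_set a d. Im z < 0}" and ?R = "{z \<in> root_set a d. Im z = 0}"
  have fin: "finite ?U" "finite ?L" "finite ?R" using finite_root_set[of a d] by simp_all
  have "bij_betw cnj ?U ?L"
    by (rule bij_betw_byWitness[where f' = cnj]) (auto intro: root_set_cnj)
  then have "card ?L = card ?U" by (simp add: bij_betw_same_card)
  moreover have "root_set a d = ?U \<union> ?L \<union> ?R" by auto
  then have "card (root_set a d) = card (?U \<union> ?L \<union> ?R)" by simp
  moreover have "card (?U \<union> ?L \<union> ?R) = card ?U + card ?L + card ?R"
    using fin by (subst card_Un_disjoint; (subst card_Un_disjoint)?) auto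
  ultimately show ?thesis by simp
qed

text \<open>
  The conjugate of a root is a root, since the coefficients are real, and it differs from the given one.
\<close>
lemma nonreal_roots_conjugate:
  assumes "Im (rx t) \<noteq> 0" shows "ry t = cnj (rx t)"
proof -
  have "cnj (rx t)^2 + of_real (fst t) * cnj (rx t) + of_real (snd t) = cnj ((rx t)^2 + of_real (fst t) * rx t + of_real (snd t))"
    by simp
  also have "\<dots> = 0" unfolding quadratic_factor by simp
  finally have "cnj (rx t) = rx t \<or> cnj (rx t) = ry t" unfolding quadratic_factor by simp
  then show ?thesis using assms by (auto simp: complex_eq_iff)
qed

lemma quad_of_nonreal_root:
  assumes "Im (rx t) \<noteq> 0" shows "fst t = - 2 * Re (rx t)" "snd t = (norm (rx t))\<^sup>2"
proof -
  note ry = nonreal_roots_conjugate[OF assms]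
  show "fst t = - 2 * Re (rx t)"
    using arg_cong[OF root_relations(1)[of t], of Re] unfolding ry by simp
  show "snd t = (norm (rx t))\<^sup>2"
    using arg_cong[OF root_relations(2)[of t], of Re] unfolding ry cmod_power2 by (simp add: power2_eq_square)
qed

text \<open>
  The quadratic factors correspond to the roots \<open>z\<close> in the upper half plane, of which there are \<open>m + 1\<close>, and
  the resultant is \<open>q(z) q(cnj z) = \<bar>q(z)\<bar>\<^sup>2 > 0\<close>.
\<close>
lemma fibre_count_nonreal:
  assumes a: "a \<in> polys_in region_nonreal (Suc (Suc (2 * m)))"
  shows "finite (fibre region_nonreal (2 * m) a)"
    and "card {t \<in> fibre region_nonreal (2 * m) a. res (2 * m) t (quot a t) > 0} =
         card {t \<in> fibre region_nonreal (2 * m) a. res (2 * m) t (quot a t) < 0} + Suc m"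
proof -
  let ?R = "root_set a (Suc (Suc (2 * m)))"
  let ?F = "fibre region_nonreal (2 * m) a"
  define U where "U = {z \<in> ?R. Im z > 0}"
  define \<Phi> where "\<Phi> z = (- 2 * Re z, (norm z)\<^sup>2)" for z :: complex
  have nonreal: "Im z \<noteq> 0" if "z \<in> ?R" for z
    using polys_in_decompose(4)[OF a] that by (auto simp: region_nonreal_def)
  have cardU: "card U = Suc m"
  proof -
    have "{z \<in> ?R. Im z = 0} = {}" using nonreal by auto
    then show ?thesis
      using card_root_set[of a "Suc (Suc (2 * m))"] polys_in_decompose(3)[OF a] by (simp only: U_def card.empty)
  qed
  have roots\<Phi>: "{rx (\<Phi> z), ry (\<Phi> z)} = {z, cnj z}" for z
    by (rule roots_unique[symmetric]) (auto simp: \<Phi>_def complex_eq_iff power2_eq_square cmod_power2[unfolded power2_eq_square])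
  note cnj = nonreal_roots_conjugate
  have fib: "?F = \<Phi> ` U"
  proof (intro Set.set_eqI iffI)
    fix t assume "t \<in> ?F"
    then have t: "rx t \<noteq> ry t" "rx t \<in> ?R" "ry t \<in> ?R" using fibre_iff[OF a] by auto
    have ry: "ry t = cnj (rx t)" using cnj nonreal t by auto
    have "t = \<Phi> (rx t)"
      using quad_of_nonreal_root[OF nonreal[OF t(2)]] by (simp add: \<Phi>_def prod_eq_iff)
    moreover have "\<Phi> (rx t) = \<Phi> (ry t)" by (simp add: ry \<Phi>_def)
    moreover have "rx t \<in> U \<or> ry t \<in> U" using t nonreal[OF t(2)] ry by (auto simp: U_def)
    ultimately show "t \<in> \<Phi> ` U" by (metis imageI)
  next
    fix t assume "t \<in> \<Phi> ` U"
    then obtain z where z: "t = \<Phi> z" "z \<in> ?R" "Im z > 0" by (auto simp: U_def)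
    then have "z \<noteq> cnj z" by (auto simp: complex_eq_iff)
    then show "t \<in> ?F"
      unfolding fibre_iff[OF a] using roots\<Phi>[of z] z root_set_cnj[of z a] by (auto simp: doubleton_eq_iff)
  qed
  have "inj_on \<Phi> U"
  proof (rule inj_onI)
    fix z w assume *: "z \<in> U" "w \<in> U" "\<Phi> z = \<Phi> w"
    then have "{z, cnj z} = {w, cnj w}" using roots\<Phi>[of z] roots\<Phi>[of w] by simp
    then show "z = w" using * by (auto simp: doubleton_eq_iff U_def)
  qed
  then have card: "card ?F = Suc m" unfolding fib using cardU by (simp add: card_image)
  show "finite ?F" unfolding fib U_def using finite_root_set[of a] by simp
  have pos: "res (2 * m) t (quot a t) > 0" if "t \<in> ?F" for t
  proof -
    have t: "rx t \<noteq> ry t" "rx t \<in> ?R" "ry t \<in> ?R" using fibre_iff[OF a] that by auto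
    have "res (2 * m) t (quot a t) \<noteq> 0"
      using res_of_fibre[OF a that] finite_root_set by auto
    moreover have "complex_of_real (res (2 * m) t (quot a t)) = of_real ((norm (horner (quot a t) (2 * m) (rx t)))\<^sup>2)"
      unfolding res_eq complex_norm_square using cnj nonreal t by (simp add: horner_cnj)
    ultimately show ?thesis by (simp only: of_real_eq_iff) (simp add: zero_less_power2)
  qed
  then have P: "{t \<in> ?F. res (2 * m) t (quot a t) > 0} = ?F" and N: "{t \<in> ?F. res (2 * m) t (quot a t) < 0} = {}"
    by (auto dest: less_asym)
  show "card {t \<in> ?F. res (2 * m) t (quot a t) > 0} = card {t \<in> ?F. res (2 * m) t (quot a t) < 0} + Suc m"
    unfolding P N card by simp
qed

section \<open>Splitting off one quadratic factor\<close>

text \<open>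
  By compactness, a zero exists if and only if the values on a countable dense subset come arbitrarily
  close to zero.
\<close>
lemma measurable_exists_zero:
  fixes G :: "'m \<Rightarrow> complex \<Rightarrow> complex"
  assumes meas[measurable]: "\<And>z. (\<lambda>m. G m z) \<in> borel_measurable M"
    and cont: "\<And>m. continuous_on UNIV (G m)" and K: "compact K"
  shows "{m \<in> space M. \<exists>z\<in>K. G m z = 0} \<in> sets M"
proof -
  obtain D where D: "countable D" "D \<subseteq> K" "K \<subseteq> closure D"
    using separable[of K] by metis
  have "(\<exists>z\<in>K. G m z = 0) \<longleftrightarrow> (\<forall>n::nat. \<exists>z\<in>D. norm (G m z) < 1 / real (Suc n))" for m
  proof
    assume "\<exists>z\<in>K. G m z = 0"
    then obtain z where z: "z \<in> K" "G m z = 0" by auto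
    show "\<forall>n::nat. \<exists>z\<in>D. norm (G m z) < 1 / real (Suc n)"
    proof
      fix n :: nat
      have "1 / real (Suc n) > 0" by simp
      then obtain d where d: "d > 0" "\<And>w. dist w z < d \<Longrightarrow> dist (G m w) (G m z) < 1 / real (Suc n)"
        using cont[of m] unfolding continuous_on_iff by (metis UNIV_I)
      obtain w where "w \<in> D" "dist w z < d"
        using z D d(1) by (metis closure_approachable subsetD)
      then show "\<exists>z\<in>D. norm (G m z) < 1 / real (Suc n)"
        using d(2)[of w] z by (auto simp: dist_norm)
    qed
  next
    assume *: "\<forall>n::nat. \<exists>z\<in>D. norm (G m z) < 1 / real (Suc n)"
    then have "K \<noteq> {}" using D(2) by blast
    moreover have "continuous_on K (\<lambda>z. norm (G m z))"
      by (intro continuous_intros continuous_on_subset[OF cont]) auto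
    ultimately obtain z where z: "z \<in> K" "\<And>w. w \<in> K \<Longrightarrow> norm (G m z) \<le> norm (G m w)"
      using continuous_attains_inf[OF K] by metis
    have "G m z = 0"
    proof (rule ccontr)
      assume "G m z \<noteq> 0"
      then obtain n where "1 / real (Suc n) < norm (G m z)"
        using reals_Archimedean[of "norm (G m z)"] by (auto simp: inverse_eq_divide)
      moreover obtain w where "w \<in> D" "norm (G m w) < 1 / real (Suc n)" using * by blast
      ultimately show False using z(2)[of w] D(2) by (auto simp: subset_iff)
    qed
    then show "\<exists>z\<in>K. G m z = 0" using z by auto
  qed
  then have "{m \<in> space M. \<exists>z\<in>K. G m z = 0} =
      {m \<in> space M. \<forall>n::nat. \<exists>z\<in>D. norm (G m z) < 1 / real (Suc n)}"
    by simp
  also have "\<dots> \<in> sets M" using D(1) by measurable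
  finally show ?thesis .
qed

lemma borel_measurable_fst_snd [measurable (raw)]:
  fixes f :: "'a \<Rightarrow> real \<times> real"
  assumes "f \<in> borel_measurable N"
  shows "(\<lambda>x. fst (f x)) \<in> borel_measurable N" "(\<lambda>x. snd (f x)) \<in> borel_measurable N"
  using assms by (auto intro!: measurable_compose[OF assms] borel_measurable_continuous_onI continuous_intros)

abbreviation coeffs_measure :: "nat \<Rightarrow> (nat \<Rightarrow> real) measure" where
  "coeffs_measure d \<equiv> \<Pi>\<^sub>M i\<in>{1..d}. lborel"

lemma measurable_horner:
  "(\<And>k. 1 \<le> k \<Longrightarrow> k \<le> n \<Longrightarrow> (\<lambda>x. g x k) \<in> borel_measurable N) \<Longrightarrow> (\<lambda>x. horner (g x) n z) \<in> borel_measurable N"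
  by (induction n) auto

lemma measurable_horner_deriv:
  "(\<And>k. 1 \<le> k \<Longrightarrow> k \<le> n \<Longrightarrow> (\<lambda>x. g x k) \<in> borel_measurable N) \<Longrightarrow> (\<lambda>x. horner_deriv (g x) n z) \<in> borel_measurable N"
proof (induction n)
  case (Suc n)
  have [measurable]: "(\<lambda>x. horner (g x) n z) \<in> borel_measurable N" "(\<lambda>x. horner_deriv (g x) n z) \<in> borel_measurable N"
    using Suc by (auto intro: measurable_horner)
  show ?case by simp
qed simp

lemma continuous_horner: "continuous_on UNIV (horner a n)" "continuous_on UNIV (horner_deriv a n)"
proof -
  show *: "continuous_on UNIV (horner a n)" for n
    by (induction n) (auto intro!: continuous_intros)
  show "continuous_on UNIV (horner_deriv a n)"
    by (induction n) (auto intro!: continuous_intros *)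
qed

lemma measurable_quot_aux:
  assumes [measurable]: "f \<in> N \<rightarrow>\<^sub>M borel" and "\<And>j. 1 \<le> j \<Longrightarrow> j \<le> n \<Longrightarrow> (\<lambda>x. g x j) \<in> borel_measurable N" "k \<le> n"
  shows "(\<lambda>x. quot (g x) (f x) k) \<in> borel_measurable N \<and> (\<lambda>x. lag (quot (g x) (f x)) k) \<in> borel_measurable N"
  using assms(3)
proof (induction k)
  case (Suc k)
  have [measurable]: "(\<lambda>x. quot (g x) (f x) k) \<in> borel_measurable N" "(\<lambda>x. lag (quot (g x) (f x)) k) \<in> borel_measurable N"
    "(\<lambda>x. g x (Suc k)) \<in> borel_measurable N"
    using Suc assms(2) by auto
  show ?case by (simp add: quot_Suc)
qed simp

lemmas measurable_quot = measurable_quot_aux[THEN conjunct1] measurable_quot_aux[THEN conjunct2]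

lemma measurable_res:
  assumes [measurable]: "f \<in> N \<rightarrow>\<^sub>M borel" and "\<And>j. 1 \<le> j \<Longrightarrow> j \<le> d \<Longrightarrow> (\<lambda>x. g x j) \<in> borel_measurable N"
  shows "(\<lambda>x. res d (f x) (g x)) \<in> borel_measurable N"
proof -
  have [measurable]: "(\<lambda>x. quot (g x) (f x) d) \<in> borel_measurable N" "(\<lambda>x. lag (quot (g x) (f x)) d) \<in> borel_measurable N"
    using measurable_quot[OF assms order.refl] by auto
  show ?thesis unfolding res_def by measurable
qed

lemma measurable_coeffs_component:
  assumes "g \<in> N \<rightarrow>\<^sub>M coeffs_measure d" "1 \<le> j" "j \<le> d"
  shows "(\<lambda>x. g x j) \<in> borel_measurable N"
proof -
  have "(\<lambda>x. g x j) \<in> N \<rightarrow>\<^sub>M lborel"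
    using measurable_compose[OF assms(1) measurable_component_singleton[of j "{1..d}" "\<lambda>_. lborel"]] assms by auto
  then show ?thesis by simp
qed

lemma measurable_times_quad:
  assumes f[measurable]: "f \<in> N \<rightarrow>\<^sub>M borel" and g: "g \<in> N \<rightarrow>\<^sub>M coeffs_measure d"
  shows "(\<lambda>x. times_quad d (f x) (g x)) \<in> N \<rightarrow>\<^sub>M coeffs_measure (Suc (Suc d))"
proof (rule measurable_PiM_single')
  have B: "(\<lambda>x. ((g x)(0 := 1)) k) \<in> borel_measurable N" if "k \<le> d" for k
    using measurable_coeffs_component[OF g, of k] that by (cases k) auto
  have C: "(\<lambda>x. lag ((g x)(0 := 1)) k) \<in> borel_measurable N" if "k \<le> Suc d" for k
    using B[of "k - 1"] that by (cases k) auto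
  show "(\<lambda>x. times_quad d (f x) (g x) i) \<in> N \<rightarrow>\<^sub>M lborel" if i: "i \<in> {1..Suc (Suc d)}" for i
  proof -
    have [measurable]: "(\<lambda>x. ((g x)(0 := 1)) d) \<in> borel_measurable N" "(\<lambda>x. lag ((g x)(0 := 1)) d) \<in> borel_measurable N"
      using B C by auto
    have top: "(\<lambda>x. fst (low_coeffs d (f x) ((g x)(0 := 1)))) \<in> borel_measurable N"
      "(\<lambda>x. snd (low_coeffs d (f x) ((g x)(0 := 1)))) \<in> borel_measurable N"
      unfolding low_coeffs_def fst_conv snd_conv by measurable
    consider "i = Suc (Suc d)" | "i = Suc d" | "1 \<le> i" "i \<le> d" using i by force
    then show ?thesis
    proof cases
      case 3
      have [measurable]: "(\<lambda>x. g x i) \<in> borel_measurable N" "(\<lambda>x. ((g x)(0 := 1)) (i - 1)) \<in> borel_measurable N"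
         "(\<lambda>x. lag ((g x)(0 := 1)) (i - 1)) \<in> borel_measurable N"
        using B[of "i - 1"] C[of "i - 1"] measurable_coeffs_component[OF g, of i] 3 by auto
      have "(\<lambda>x. shear (f x) (g x) i) \<in> borel_measurable N"
        unfolding shear_def by measurable
      then show ?thesis using 3 by (simp add: times_quad_def)
    qed (use top in \<open>simp_all add: times_quad_def\<close>)
  qed
qed (auto simp: times_quad_def PiE_def extensional_def)

lemma coeffs_measure_Suc: "coeffs_measure (Suc d) = (\<Pi>\<^sub>M i\<in>insert (Suc d) {1..d}. lborel)"
  by (simp add: atLeastAtMostSuc_conv)

lemma measurable_coeffs_upd:
  assumes "f \<in> N \<rightarrow>\<^sub>M coeffs_measure d" "g \<in> borel_measurable N"
  shows "(\<lambda>x. (f x)(Suc d := g x)) \<in> N \<rightarrow>\<^sub>M coeffs_measure (Suc d)"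
  unfolding coeffs_measure_Suc using assms
  by (intro measurable_fun_upd[where J = "{1..d}"]) auto

interpretation coeffs: product_sigma_finite "\<lambda>_::nat. lborel :: real measure"
  by standard

lemma nn_integral_coeffs_Suc:
  assumes "f \<in> borel_measurable (coeffs_measure (Suc d))"
  shows "integral\<^sup>N (coeffs_measure (Suc d)) f = (\<integral>\<^sup>+a. \<integral>\<^sup>+y. f (a(Suc d := y)) \<partial>lborel \<partial>coeffs_measure d)"
  using coeffs.product_nn_integral_insert[of "{1..d}" "Suc d" f] assms
  unfolding coeffs_measure_Suc by simp

lemma sigma_finite_coeffs: "sigma_finite_measure (coeffs_measure d)"
  by (rule coeffs.sigma_finite) simp

lemma measurable_nn_integral_upd:
  assumes f: "f \<in> borel_measurable (coeffs_measure (Suc d))"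
  shows "(\<lambda>a. \<integral>\<^sup>+y. f (a(Suc d := y)) \<partial>lborel) \<in> borel_measurable (coeffs_measure d)"
proof -
  have "(\<lambda>p. (fst p)(Suc d := snd p)) \<in> coeffs_measure d \<Otimes>\<^sub>M lborel \<rightarrow>\<^sub>M coeffs_measure (Suc d)"
    by (rule measurable_coeffs_upd) auto
  from measurable_compose[OF this f]
  have "case_prod (\<lambda>a y. f (a(Suc d := y))) \<in> borel_measurable (coeffs_measure d \<Otimes>\<^sub>M lborel)"
    by (simp add: case_prod_unfold)
  then show ?thesis by (rule lborel.borel_measurable_nn_integral)
qed

lemma nn_integral_coeffs_Suc_Suc:
  assumes f: "f \<in> borel_measurable (coeffs_measure (Suc (Suc d)))"
  shows "integral\<^sup>N (coeffs_measure (Suc (Suc d))) f =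
    (\<integral>\<^sup>+a. \<integral>\<^sup>+c. f (a(Suc d := fst c, Suc (Suc d) := snd c)) \<partial>lborel \<partial>coeffs_measure d)"
proof -
  have "integral\<^sup>N (coeffs_measure (Suc (Suc d))) f =
     (\<integral>\<^sup>+a. \<integral>\<^sup>+x. \<integral>\<^sup>+y. f (a(Suc d := x, Suc (Suc d) := y)) \<partial>lborel \<partial>lborel \<partial>coeffs_measure d)"
    unfolding nn_integral_coeffs_Suc[OF f] by (rule nn_integral_coeffs_Suc[OF measurable_nn_integral_upd[OF f]])
  also have "\<dots> = (\<integral>\<^sup>+a. \<integral>\<^sup>+c. f (a(Suc d := fst c, Suc (Suc d) := snd c)) \<partial>lborel \<partial>coeffs_measure d)"
  proof (rule nn_integral_cong)
    fix a assume "a \<in> space (coeffs_measure d)"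
    then have "(\<lambda>c. a(Suc d := fst c, Suc (Suc d) := snd c)) \<in> lborel \<Otimes>\<^sub>M lborel \<rightarrow>\<^sub>M coeffs_measure (Suc (Suc d))"
      by (intro measurable_coeffs_upd) auto
    from measurable_compose[OF this f]
    have "(\<lambda>c. f (a(Suc d := fst c, Suc (Suc d) := snd c))) \<in> borel_measurable (lborel \<Otimes>\<^sub>M lborel)" .
    from lborel.nn_integral_fst[OF this]
    show "(\<integral>\<^sup>+x. \<integral>\<^sup>+y. f (a(Suc d := x, Suc (Suc d) := y)) \<partial>lborel \<partial>lborel) =
          (\<integral>\<^sup>+c. f (a(Suc d := fst c, Suc (Suc d) := snd c)) \<partial>lborel)"
      by (simp add: lborel_prod)
  qed
  finally show ?thesis .
qed

definition quot_coeffs :: "nat \<Rightarrow> real \<times> real \<Rightarrow> (nat \<Rightarrow> real) \<Rightarrow> nat \<Rightarrow> real" where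
  "quot_coeffs d t a = restrict (quot a t) {1..d}"

lemma measurable_quot_coeffs:
  assumes f: "f \<in> N \<rightarrow>\<^sub>M borel" and g: "g \<in> N \<rightarrow>\<^sub>M coeffs_measure d"
  shows "(\<lambda>x. quot_coeffs d (f x) (g x)) \<in> N \<rightarrow>\<^sub>M coeffs_measure d"
  unfolding quot_coeffs_def
proof (rule measurable_restrict)
  fix i assume i: "i \<in> {1..d}"
  have "(\<lambda>x. quot (g x) (f x) i) \<in> borel_measurable N"
    by (rule measurable_quot(1)[OF f measurable_coeffs_component[OF g]]) (use i in auto)
  then show "(\<lambda>x. quot (g x) (f x) i) \<in> N \<rightarrow>\<^sub>M lborel" by simp
qed

text \<open>
  For a fixed divisor the quotient is a unipotent triangular affine map of the coefficients: each new coefficient is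
  translated by an amount depending on the earlier ones. Hence it preserves Lebesgue measure.
\<close>
lemma nn_integral_quot_coeffs:
  assumes "f \<in> borel_measurable (coeffs_measure d)"
  shows "(\<integral>\<^sup>+a. f (quot_coeffs d t a) \<partial>coeffs_measure d) = integral\<^sup>N (coeffs_measure d) f"
  using assms
proof (induction d arbitrary: f)
  case 0
  show ?case
    by (rule nn_integral_cong) (auto simp: quot_coeffs_def space_PiM)
next
  case (Suc d)
  have meas: "(\<lambda>a. f (quot_coeffs (Suc d) t a)) \<in> borel_measurable (coeffs_measure (Suc d))"
    using measurable_compose[OF measurable_quot_coeffs[of "\<lambda>_. t" _ "\<lambda>a. a"] Suc.prems] by simp
  have "(\<integral>\<^sup>+a. f (quot_coeffs (Suc d) t a) \<partial>coeffs_measure (Suc d)) =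
        (\<integral>\<^sup>+a. \<integral>\<^sup>+y. f (quot_coeffs (Suc d) t (a(Suc d := y))) \<partial>lborel \<partial>coeffs_measure d)"
    by (rule nn_integral_coeffs_Suc[OF meas])
  also have "\<dots> = (\<integral>\<^sup>+a. \<integral>\<^sup>+y. f ((quot_coeffs d t a)(Suc d := y)) \<partial>lborel \<partial>coeffs_measure d)"
  proof (rule nn_integral_cong)
    fix a assume a: "a \<in> space (coeffs_measure d)"
    define \<kappa> where "\<kappa> = - fst t * quot a t d - snd t * lag (quot a t) d"
    have eq: "quot_coeffs (Suc d) t (a(Suc d := y)) = (quot_coeffs d t a)(Suc d := \<kappa> + 1 * y)" for y
    proof (rule ext)
      fix k
      have c: "quot (a(Suc d := y)) t j = quot a t j" if "j \<le> d" for j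
        using that by (intro quot_cong) auto
      then have "lag (quot (a(Suc d := y)) t) d = lag (quot a t) d" by (cases d) auto
      then show "quot_coeffs (Suc d) t (a(Suc d := y)) k = ((quot_coeffs d t a)(Suc d := \<kappa> + 1 * y)) k"
        using c by (auto simp: quot_coeffs_def quot_Suc \<kappa>_def)
    qed
    have q: "quot_coeffs d t a \<in> space (coeffs_measure d)"
      by (simp add: quot_coeffs_def space_PiM)
    have "(\<lambda>y. f ((quot_coeffs d t a)(Suc d := y))) \<in> borel_measurable borel"
      by (rule measurable_compose[OF measurable_coeffs_upd Suc.prems]) (use q in auto)
    from nn_integral_real_affine[OF this, of 1 \<kappa>]
    show "(\<integral>\<^sup>+y. f (quot_coeffs (Suc d) t (a(Suc d := y))) \<partial>lborel) = (\<integral>\<^sup>+y. f ((quot_coeffs d t a)(Suc d := y)) \<partial>lborel)"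
      unfolding eq by simp
  qed
  also have "\<dots> = (\<integral>\<^sup>+a. \<integral>\<^sup>+y. f (a(Suc d := y)) \<partial>lborel \<partial>coeffs_measure d)"
    by (rule Suc.IH[OF measurable_nn_integral_upd[OF Suc.prems]])
  also have "\<dots> = integral\<^sup>N (coeffs_measure (Suc d)) f"
    by (rule nn_integral_coeffs_Suc[OF Suc.prems, symmetric])
  finally show ?case .
qed

text \<open>
  Dividing and multiplying back restores the upper \<open>d\<close> coefficients, and the lowest two become the ones that
  make the polynomial divisible.
\<close>
lemma times_quad_quot_coeffs:
  assumes "a \<in> {1..d} \<rightarrow>\<^sub>E UNIV"
  shows "times_quad d t (quot_coeffs d t a) =
     a(Suc d := fst (low_coeffs d t (quot a t)), Suc (Suc d) := snd (low_coeffs d t (quot a t)))"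
proof -
  let ?b = "quot_coeffs d t a"
  have B: "(?b(0 := 1)) k = quot a t k" if "k \<le> d" for k
    using that by (auto simp: quot_coeffs_def)
  have C: "lag (?b(0 := 1)) k = lag (quot a t) k" if "k \<le> Suc d" for k
    using B[of "k - 1"] that by (cases k) auto
  have top: "low_coeffs d t (?b(0 := 1)) = low_coeffs d t (quot a t)"
    using B[of d] C[of d] by (simp add: low_coeffs_def)
  have "shear t ?b k = a k" if "1 \<le> k" "k \<le> d" for k
  proof -
    have "shear t ?b k = shear t (quot a t) k"
      using that B[of "k - 1"] C[of "k - 1"] by (simp add: shear_def quot_coeffs_def fun_upd_def)
        (auto simp: lag_def split: nat.split)
    then show ?thesis using shear_quot[OF that(1)] by simp
  qed
  then show ?thesis
    unfolding times_quad_def top using assms by (auto simp: fun_eq_iff PiE_def extensional_def restrict_def)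
qed

definition not_simple :: "nat \<Rightarrow> (nat \<Rightarrow> real) set" where
  "not_simple d = {a \<in> {1..d} \<rightarrow>\<^sub>E UNIV. \<exists>z. horner a d z = 0 \<and> horner_deriv a d z = 0}"

text \<open>
  A multiple root is a common zero of the polynomial and its derivative.
\<close>
lemma not_simple_measurable: "not_simple d \<in> sets (coeffs_measure d)"
proof -
  let ?M = "coeffs_measure d"
  have comp: "(\<lambda>a. a k) \<in> borel_measurable ?M" if "1 \<le> k" "k \<le> d" for k
    by (rule measurable_coeffs_component[OF _ that]) simp
  have [measurable]: "(\<lambda>a. horner a d z) \<in> borel_measurable ?M" "(\<lambda>a. horner_deriv a d z) \<in> borel_measurable ?M" for z
    by (intro measurable_horner measurable_horner_deriv comp; simp)+
  have G: "(\<lambda>a. complex_of_real (norm (horner a d z) + norm (horner_deriv a d z))) \<in> borel_measurable ?M" for z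
    by measurable
  have sets: "{a \<in> space ?M. \<exists>z\<in>cball 0 (real n). complex_of_real (norm (horner a d z) + norm (horner_deriv a d z)) = 0} \<in> sets ?M" for n
    by (intro measurable_exists_zero continuous_intros continuous_horner G compact_cball)
  have nz: "complex_of_real (norm x + norm y) = 0 \<longleftrightarrow> x = 0 \<and> y = 0" for x y :: complex
    by (metis add_nonneg_eq_0_iff norm_eq_zero norm_ge_zero of_real_eq_0_iff)
  have cov: "\<exists>n. z \<in> cball 0 (real n)" for z :: complex
    using real_arch_simple[of "norm z"] by (simp add: dist_norm)
  have sp: "space ?M = {1..d} \<rightarrow>\<^sub>E UNIV" by (simp add: space_PiM)
  have "not_simple d = (\<Union>n. {a \<in> space ?M. \<exists>z\<in>cball 0 (real n). complex_of_real (norm (horner a d z) + norm (horner_deriv a d z)) = 0})"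
    (is "_ = ?Y")
  proof (rule Set.set_eqI)
    fix a
    have "a \<in> ?Y \<longleftrightarrow> a \<in> space ?M \<and> (\<exists>z. horner a d z = 0 \<and> horner_deriv a d z = 0)"
      unfolding nz using cov by blast
    then show "a \<in> not_simple d \<longleftrightarrow> a \<in> ?Y" unfolding not_simple_def sp by simp
  qed
  also have "\<dots> \<in> sets ?M" using sets by (intro sets.countable_UN) auto
  finally show ?thesis .
qed

text \<open>
  The two cases of the theorem differ in the region \<open>Z\<close> of the admitted roots only. Compactness of the
  pieces of the complement serves measurability; the decisive assumption is the last one, the signed count of
  quadratic factors.
\<close>
locale root_region =
  fixes Z :: "complex set" and K :: "nat \<Rightarrow> complex set"
  assumes compact_K: "\<And>n. compact (K n)" and compl_Z: "- Z = (\<Union>n. K n)"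
    and Z_disc: "\<And>z. z \<in> Z \<Longrightarrow> norm z < 1"
    and finite_fibre: "\<And>m a. a \<in> polys_in Z (Suc (Suc (2 * m))) \<Longrightarrow> finite (fibre Z (2 * m) a)"
    and fibre_count: "\<And>m a. a \<in> polys_in Z (Suc (Suc (2 * m))) \<Longrightarrow>
         card {t \<in> fibre Z (2 * m) a. res (2 * m) t (quot a t) > 0} =
         card {t \<in> fibre Z (2 * m) a. res (2 * m) t (quot a t) < 0} + Suc m"
begin

lemma polys_in_measurable [measurable]: "polys_in Z d \<in> sets (coeffs_measure d)"
proof -
  let ?M = "coeffs_measure d"
  have comp: "(\<lambda>a. a k) \<in> borel_measurable ?M" if "1 \<le> k" "k \<le> d" for k
    by (rule measurable_coeffs_component[OF _ that]) simp
  have 1: "{a \<in> space ?M. \<exists>z\<in>K n. horner a d z = 0} \<in> sets ?M" for n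
    by (intro measurable_exists_zero measurable_horner comp continuous_horner compact_K) auto
  have sp: "space ?M = {1..d} \<rightarrow>\<^sub>E UNIV" by (simp add: space_PiM)
  have "polys_in Z d = space ?M - ((\<Union>n. {a \<in> space ?M. \<exists>z\<in>K n. horner a d z = 0}) \<union> not_simple d)"
    (is "_ = space ?M - (?X \<union> _)")
  proof (rule Set.set_eqI)
    fix a
    have X: "a \<in> ?X \<longleftrightarrow> a \<in> space ?M \<and> (\<exists>z. z \<notin> Z \<and> horner a d z = 0)"
      using compl_Z by blast
    have N: "a \<in> not_simple d \<longleftrightarrow> a \<in> space ?M \<and> (\<exists>z. horner a d z = 0 \<and> horner_deriv a d z = 0)"
      unfolding not_simple_def sp by simp
    have P: "a \<in> polys_in Z d \<longleftrightarrow> a \<in> space ?M \<and> (\<forall>z. horner a d z = 0 \<longrightarrow> z \<in> Z \<and> horner_deriv a d z \<noteq> 0)"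
      unfolding polys_in_def sp by simp
    show "a \<in> polys_in Z d \<longleftrightarrow> a \<in> space ?M - (?X \<union> not_simple d)"
      unfolding Diff_iff Un_iff X N P by blast
  qed
  also have "\<dots> \<in> sets ?M" using 1 not_simple_measurable by (intro sets.Diff sets.Un sets.countable_UN sets.top) auto
  finally show ?thesis .
qed

lemma quads_in_measurable [measurable]: "quads_in Z \<in> sets borel"
proof -
  let ?p = "\<lambda>t z. z\<^sup>2 + complex_of_real (fst t) * z + of_real (snd t)"
  have 1: "{t \<in> space borel. \<exists>z\<in>K n. ?p t z = 0} \<in> sets borel" for n
    by (rule measurable_exists_zero[where M = borel and G = ?p]) (auto intro!: continuous_intros compact_K)
  have 2: "{t \<in> space borel. (fst t)\<^sup>2 = 4 * snd t} \<in> sets (borel :: (real \<times> real) measure)" by measurable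
  have "quads_in Z = UNIV - ((\<Union>n. {t \<in> space borel. \<exists>z\<in>K n. ?p t z = 0}) \<union> {t \<in> space borel. (fst t)\<^sup>2 = 4 * snd t})"
  proof -
    have "t \<in> (\<Union>n. {t \<in> space borel. \<exists>z\<in>K n. ?p t z = 0}) \<longleftrightarrow> rx t \<notin> Z \<or> ry t \<notin> Z" for t
    proof -
      have "t \<in> (\<Union>n. {t \<in> space borel. \<exists>z\<in>K n. ?p t z = 0}) \<longleftrightarrow> (\<exists>z\<in>- Z. ?p t z = 0)"
        unfolding compl_Z by auto
      then show ?thesis unfolding quadratic_factor by auto
    qed
    then show ?thesis by (auto simp: quads_in_def rx_eq_ry_iff)
  qed
  also have "\<dots> \<in> sets borel" using 1 2 by (intro sets.Diff sets.Un sets.countable_UN) auto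
  finally show ?thesis .
qed

text \<open>
  The integrand of the recursion, with \<open>\<sigma> = 1\<close> for its positive and \<open>\<sigma> = -1\<close> for its negative part:
  \<open>ennreal\<close> sends negative numbers to zero.
\<close>
definition signed_part :: "nat \<Rightarrow> real \<Rightarrow> ((nat \<Rightarrow> real) \<Rightarrow> ennreal) \<Rightarrow> real \<times> real \<Rightarrow> (nat \<Rightarrow> real) \<Rightarrow> ennreal" where
  "signed_part d \<sigma> h t b = indicator (quads_in Z) t * indicator (polys_in Z d) b * ennreal (\<sigma> * res d t b) * h (times_quad d t b)"

lemma measurable_signed_part:
  assumes h: "h \<in> borel_measurable (coeffs_measure (Suc (Suc d)))"
  shows "(\<lambda>(t, b). signed_part d \<sigma> h t b) \<in> borel_measurable (borel \<Otimes>\<^sub>M coeffs_measure d)"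
proof -
  have [measurable]: "(\<lambda>p. res d (fst p) (snd p)) \<in> borel_measurable (borel \<Otimes>\<^sub>M coeffs_measure d)"
    by (intro measurable_res measurable_coeffs_component[of snd]) auto
  have "(\<lambda>p. times_quad d (fst p) (snd p)) \<in> borel \<Otimes>\<^sub>M coeffs_measure d \<rightarrow>\<^sub>M coeffs_measure (Suc (Suc d))"
    by (intro measurable_times_quad) auto
  from measurable_compose[OF this h]
  have [measurable]: "(\<lambda>p. h (times_quad d (fst p) (snd p))) \<in> borel_measurable (borel \<Otimes>\<^sub>M coeffs_measure d)" .
  show ?thesis unfolding signed_part_def case_prod_unfold by measurable
qed

text \<open>
  The upper coefficients \<open>a\<close> are fixed, and the signed area formula is applied to the map from a quadratic
  factor to the two lowest coefficients. The preimages of such a pair are the quadratic factors of the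
  completed polynomial, which has signed count \<open>m + 1\<close>.
\<close>
lemma slice_formula:
  assumes a: "a \<in> space (coeffs_measure (2 * m))" and h: "h \<in> borel_measurable (coeffs_measure (Suc (Suc (2 * m))))"
  defines "d \<equiv> 2 * m"
  shows "(\<integral>\<^sup>+t. signed_part d 1 h t (quot_coeffs d t a) \<partial>lborel) =
     (\<integral>\<^sup>+t. signed_part d (- 1) h t (quot_coeffs d t a) \<partial>lborel) +
     of_nat (Suc m) * (\<integral>\<^sup>+c. indicator (polys_in Z (Suc (Suc d))) (a(Suc d := fst c, Suc (Suc d) := snd c)) *
        h (a(Suc d := fst c, Suc (Suc d) := snd c)) \<partial>lborel)"
proof -
  have aE: "a \<in> {1..d} \<rightarrow>\<^sub>E UNIV" using a by (simp add: space_PiM d_def)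
  define A where "A c = a(Suc d := fst c, Suc (Suc d) := snd c)" for c :: "real \<times> real"
  have Am: "A \<in> borel \<rightarrow>\<^sub>M coeffs_measure (Suc (Suc d))"
    unfolding A_def using a by (intro measurable_coeffs_upd) (auto simp: d_def)
  define f where "f c = indicator (polys_in Z (Suc (Suc d))) (A c) * h (A c)" for c
  have [measurable]: "(\<lambda>c. h (A c)) \<in> borel_measurable borel"
    using measurable_compose[OF Am] h by (simp add: d_def)
  have [measurable]: "(\<lambda>c. indicator (polys_in Z (Suc (Suc d))) (A c) :: ennreal) \<in> borel_measurable borel"
    by (rule measurable_compose[OF Am]) measurable
  have fm: "f \<in> borel_measurable borel" unfolding f_def by measurable
  let ?c = "\<lambda>t. quot (quot a t) t"
  let ?J = "\<lambda>t. ?c t d * (?c t d + fst t * lag (?c t) d) - lag (?c t) d * (- snd t * lag (?c t) d)"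
  have J: "?J t = res d t (quot a t)" for t
    by (simp add: res_def algebra_simps power2_eq_square)
  have cq: "continuous_on UNIV (\<lambda>t. quot a t k)" for k by (rule continuous_quot(1)) auto
  have cont: "continuous_on UNIV (\<lambda>t. ?c t d)" "continuous_on UNIV (\<lambda>t. lag (?c t) d)"
    by (rule continuous_quot[OF cq])+
  have Aq: "quot (A c) t k = quot a t k" if "k \<le> d" for c t k
    using that by (intro quot_cong) (auto simp: A_def)
  have Aq': "lag (quot (A c) t) d = lag (quot a t) d" for c t
    using Aq[of "d - 1" c t] by (cases d) auto
  have Ares: "res d t (quot (A c) t) = res d t (quot a t)" for c t
    by (rule res_cong) (simp add: Aq)
  have Afib: "fibre Z d (A c) = {t \<in> quads_in Z. low_coeffs d t (quot a t) = c}" for c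
    using Aq[of d c] Aq'[of c] by (auto simp: fibre_def low_coeffs_def A_def)
  have f0: "A c \<in> polys_in Z (Suc (Suc (2 * m)))" if "f c \<noteq> 0" for c
    using that by (auto simp: f_def d_def split: split_indicator_asm)
  have *: "(\<integral>\<^sup>+t. indicator (quads_in Z) t * ennreal (?J t) * f (low_coeffs d t (quot a t)) \<partial>lborel) =
         (\<integral>\<^sup>+t. indicator (quads_in Z) t * ennreal (- ?J t) * f (low_coeffs d t (quot a t)) \<partial>lborel) +
         of_nat (Suc m) * (\<integral>\<^sup>+z. f z \<partial>lborel)"
  proof (rule signed_area_formula_plane[OF low_coeffs_has_derivative _ _ _ _ quads_in_measurable fm])
    show "finite {t \<in> quads_in Z. low_coeffs d t (quot a t) = z \<and> ?J t \<noteq> 0}" if "f z \<noteq> 0" for z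
      using finite_fibre[OF f0[OF that]] unfolding d_def[symmetric] Afib
      by (rule finite_subset[rotated]) auto
    show "card {t \<in> quads_in Z. low_coeffs d t (quot a t) = z \<and> 0 < ?J t} =
       card {t \<in> quads_in Z. low_coeffs d t (quot a t) = z \<and> ?J t < 0} + Suc m" if "f z \<noteq> 0" for z
      using fibre_count[OF f0[OF that]] unfolding d_def[symmetric] Afib Ares J by simp
  qed (intro continuous_intros cont)+
  have key: "indicator (quads_in Z) t * ennreal (\<sigma> * res d t (quot a t)) * f (low_coeffs d t (quot a t)) =
      signed_part d \<sigma> h t (quot_coeffs d t a)" for t \<sigma>
  proof -
    have r: "res d t (quot_coeffs d t a) = res d t (quot a t)"
      by (rule res_cong) (simp add: quot_coeffs_def)
    have A: "A (low_coeffs d t (quot a t)) = times_quad d t (quot_coeffs d t a)"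
      unfolding times_quad_quot_coeffs[OF aE] A_def ..
    show ?thesis
    proof (cases "t \<in> quads_in Z \<and> res d t (quot a t) \<noteq> 0")
      case True
      then have "times_quad d t (quot_coeffs d t a) \<in> polys_in Z (Suc (Suc d)) \<longleftrightarrow> quot_coeffs d t a \<in> polys_in Z d"
        using r by (intro times_quad_in_polys_in_iff) (auto simp: quot_coeffs_def)
      then show ?thesis
        by (simp add: signed_part_def f_def A r indicator_def mult_ac)
    qed (auto simp: signed_part_def r)
  qed
  show ?thesis
    using * key[of _ 1] key[of _ "- 1"] unfolding J f_def[unfolded A_def, symmetric] by simp
qed

text \<open>
  Integrate \<open>slice_formula\<close> over the upper coefficients. After exchanging the integrals the quadratic factor
  is fixed, and the upper coefficients can be replaced by those of the quotient, as \<open>nn_integral_quot_coeffs\<close> says.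
\<close>
theorem nn_recursion:
  assumes h: "h \<in> borel_measurable (coeffs_measure (Suc (Suc (2 * m))))"
  shows "(\<integral>\<^sup>+t. \<integral>\<^sup>+b. signed_part (2 * m) 1 h t b \<partial>coeffs_measure (2 * m) \<partial>lborel) =
     (\<integral>\<^sup>+t. \<integral>\<^sup>+b. signed_part (2 * m) (- 1) h t b \<partial>coeffs_measure (2 * m) \<partial>lborel) +
     of_nat (Suc m) * (\<integral>\<^sup>+a. indicator (polys_in Z (Suc (Suc (2 * m)))) a * h a \<partial>coeffs_measure (Suc (Suc (2 * m))))"
proof -
  let ?d = "2 * m"
  interpret C: sigma_finite_measure "coeffs_measure ?d" by (rule sigma_finite_coeffs)
  interpret P: pair_sigma_finite lborel "coeffs_measure ?d" ..
  have meas: "(\<lambda>(t, a). signed_part ?d \<sigma> h t (quot_coeffs ?d t a)) \<in> borel_measurable (lborel \<Otimes>\<^sub>M coeffs_measure ?d)" for \<sigma>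
  proof -
    have "(\<lambda>p. (fst p, quot_coeffs ?d (fst p) (snd p))) \<in> borel \<Otimes>\<^sub>M coeffs_measure ?d \<rightarrow>\<^sub>M borel \<Otimes>\<^sub>M coeffs_measure ?d"
      by (intro measurable_Pair measurable_quot_coeffs) auto
    from measurable_compose[OF this measurable_signed_part[OF h, of \<sigma>]]
    have "(\<lambda>(t, a). signed_part ?d \<sigma> h t (quot_coeffs ?d t a)) \<in> borel_measurable (borel \<Otimes>\<^sub>M coeffs_measure ?d)"
      by (simp add: case_prod_unfold)
    then show ?thesis by (simp cong: measurable_cong_sets sets_pair_measure_cong)
  qed
  have swap: "(\<integral>\<^sup>+t. \<integral>\<^sup>+b. signed_part ?d \<sigma> h t b \<partial>coeffs_measure ?d \<partial>lborel) =
      (\<integral>\<^sup>+a. \<integral>\<^sup>+t. signed_part ?d \<sigma> h t (quot_coeffs ?d t a) \<partial>lborel \<partial>coeffs_measure ?d)" for \<sigma>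
  proof -
    have "(\<integral>\<^sup>+b. signed_part ?d \<sigma> h t b \<partial>coeffs_measure ?d) =
        (\<integral>\<^sup>+a. signed_part ?d \<sigma> h t (quot_coeffs ?d t a) \<partial>coeffs_measure ?d)" for t
      using measurable_compose[OF measurable_Pair1'[of t borel "coeffs_measure ?d"] measurable_signed_part[OF h, of \<sigma>]]
      by (intro nn_integral_quot_coeffs[symmetric]) simp
    then show ?thesis
      using P.Fubini'[OF meas[of \<sigma>]] by simp
  qed
  have inner: "(\<lambda>a. \<integral>\<^sup>+t. signed_part ?d \<sigma> h t (quot_coeffs ?d t a) \<partial>lborel) \<in> borel_measurable (coeffs_measure ?d)" for \<sigma>
    using lborel.borel_measurable_nn_integral[of "\<lambda>a t. signed_part ?d \<sigma> h t (quot_coeffs ?d t a)" "coeffs_measure ?d"]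
      measurable_pair_swap[OF meas[of \<sigma>]] by (simp add: case_prod_unfold)
  define F where "F a = indicator (polys_in Z (Suc (Suc ?d))) a * h a" for a
  have F: "F \<in> borel_measurable (coeffs_measure (Suc (Suc ?d)))"
    unfolding F_def using h by measurable
  let ?I = "\<lambda>a. \<integral>\<^sup>+c. F (a(Suc ?d := fst c, Suc (Suc ?d) := snd c)) \<partial>lborel"
  have Im: "?I \<in> borel_measurable (coeffs_measure ?d)"
  proof -
    have "(\<lambda>p. (fst p)(Suc ?d := fst (snd p), Suc (Suc ?d) := snd (snd p))) \<in>
       coeffs_measure ?d \<Otimes>\<^sub>M (lborel :: (real \<times> real) measure) \<rightarrow>\<^sub>M coeffs_measure (Suc (Suc ?d))"
      by (intro measurable_coeffs_upd) (auto simp: borel_prod[symmetric])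
    from measurable_compose[OF this F]
    show ?thesis by (intro lborel.borel_measurable_nn_integral) (simp add: case_prod_unfold)
  qed
  have "(\<integral>\<^sup>+a. \<integral>\<^sup>+t. signed_part ?d 1 h t (quot_coeffs ?d t a) \<partial>lborel \<partial>coeffs_measure ?d) =
    (\<integral>\<^sup>+a. (\<integral>\<^sup>+t. signed_part ?d (- 1) h t (quot_coeffs ?d t a) \<partial>lborel) + of_nat (Suc m) * ?I a \<partial>coeffs_measure ?d)"
    unfolding F_def by (intro nn_integral_cong slice_formula h)
  also have "\<dots> = (\<integral>\<^sup>+a. \<integral>\<^sup>+t. signed_part ?d (- 1) h t (quot_coeffs ?d t a) \<partial>lborel \<partial>coeffs_measure ?d) +
      of_nat (Suc m) * (\<integral>\<^sup>+a. ?I a \<partial>coeffs_measure ?d)"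
    using inner Im by (simp add: nn_integral_add nn_integral_cmult)
  also have "(\<integral>\<^sup>+a. ?I a \<partial>coeffs_measure ?d) = integral\<^sup>N (coeffs_measure (Suc (Suc ?d))) F"
    by (rule nn_integral_coeffs_Suc_Suc[OF F, symmetric])
  finally show ?thesis unfolding swap F_def .
qed

end

section \<open>Volumes as determinants\<close>

(* Rewriting 1 to Suc 0 would change the index set {1..d} that occurs in every coefficient space. *)
declare One_nat_def [simp del]

fun prod_quads :: "nat \<Rightarrow> (nat \<Rightarrow> real \<times> real) \<Rightarrow> nat \<Rightarrow> real" where
  "prod_quads 0 u = (\<lambda>_. undefined)"
| "prod_quads (Suc s) u = times_quad (2 * s) (u s) (prod_quads s u)"

text \<open>
  By multiplicativity of the resultant, this is the product of the resultants of all pairs of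
  quadratics \<open>u j\<close>, \<open>u k\<close> with \<open>j < k < s\<close>.
\<close>
fun prod_res :: "nat \<Rightarrow> (nat \<Rightarrow> real \<times> real) \<Rightarrow> real" where
  "prod_res 0 u = 1"
| "prod_res (Suc s) u = prod_res s u * res (2 * s) (u s) (prod_quads s u)"

lemma prod_quads_cong: "(\<And>j. j < s \<Longrightarrow> u j = u' j) \<Longrightarrow> prod_quads s u = prod_quads s u'"
  by (induction s) auto

lemma prod_res_cong: "(\<And>j. j < s \<Longrightarrow> u j = u' j) \<Longrightarrow> prod_res s u = prod_res s u'"
proof (induction s)
  case (Suc s)
  then show ?case using prod_quads_cong[of s u u'] by auto
qed simp

lemma prod_quads_extensional: "prod_quads s u \<in> {1..2 * s} \<rightarrow>\<^sub>E UNIV"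
proof (cases s)
  case (Suc m)
  then show ?thesis by (auto simp: times_quad_def PiE_def extensional_def)
qed (auto simp: PiE_def extensional_def)

text \<open>
  The Lucas sequence \<open>(y\<^sup>n - x\<^sup>n) / (y - x)\<close> of the roots \<open>x, y\<close> of \<open>t\<close>, which is a polynomial in the coefficients.
\<close>
fun lucas :: "real \<times> real \<Rightarrow> nat \<Rightarrow> real" where
  "lucas t 0 = 0"
| "lucas t (Suc 0) = 1"
| "lucas t (Suc (Suc n)) = - fst t * lucas t (Suc n) - snd t * lucas t n"

lemma lucas_eq: "of_real (lucas t n) * (ry t - rx t) = ry t ^ n - rx t ^ n"
proof (induction t n rule: lucas.induct)
  case (3 t n)
  have "of_real (lucas t (Suc (Suc n))) * (ry t - rx t) =
      - of_real (fst t) * (of_real (lucas t (Suc n)) * (ry t - rx t)) - of_real (snd t) * (of_real (lucas t n) * (ry t - rx t))"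
    by (simp add: algebra_simps)
  also have "\<dots> = (rx t + ry t) * (ry t ^ Suc n - rx t ^ Suc n) - (rx t * ry t) * (ry t ^ n - rx t ^ n)"
    unfolding 3 root_relations by simp
  also have "\<dots> = ry t ^ Suc (Suc n) - rx t ^ Suc (Suc n)"
    by (simp add: algebra_simps)
  finally show ?case .
qed auto

text \<open>
  The quotient \<open>(x\<^sup>a y\<^sup>b - x\<^sup>b y\<^sup>a) / (y - x)\<close>, likewise written without reference to the roots \<open>x, y\<close>.
\<close>
definition wedge :: "nat \<Rightarrow> nat \<Rightarrow> real \<times> real \<Rightarrow> real" where
  "wedge a b t = (if a \<le> b then snd t ^ a * lucas t (b - a) else - (snd t ^ b * lucas t (a - b)))"

lemma wedge_eq: "of_real (wedge a b t) * (ry t - rx t) = rx t ^ a * ry t ^ b - rx t ^ b * ry t ^ a"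
proof -
  have *: "of_real (snd t ^ a * lucas t (b - a)) * (ry t - rx t) = rx t ^ a * ry t ^ b - rx t ^ b * ry t ^ a"
    if "a \<le> b" for a b
  proof -
    have "of_real (snd t ^ a * lucas t (b - a)) * (ry t - rx t) = (rx t * ry t) ^ a * (ry t ^ (b - a) - rx t ^ (b - a))"
      using lucas_eq[of t "b - a"] unfolding root_relations by simp
    also have "\<dots> = rx t ^ a * (ry t ^ a * ry t ^ (b - a)) - (rx t ^ a * rx t ^ (b - a)) * ry t ^ a"
      by (simp add: algebra_simps power_mult_distrib)
    also have "\<dots> = rx t ^ a * ry t ^ b - rx t ^ b * ry t ^ a"
      using that by (simp flip: power_add)
    finally show ?thesis .
  qed
  show ?thesis
  proof (cases "a \<le> b")
    case False
    then show ?thesis using *[of b a] by (simp add: wedge_def)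
  qed (use * in \<open>simp add: wedge_def\<close>)
qed

lemma wedge_antisym: "wedge b a t = - wedge a b t"
  by (auto simp: wedge_def)

lemma measurable_wedge [measurable]: "wedge a b \<in> borel_measurable borel"
proof -
  have [measurable]: "(\<lambda>t. lucas t n) \<in> borel_measurable borel" for n
    by (induction n rule: induct_nat_012) auto
  show ?thesis
    by (cases "a \<le> b") (simp_all add: wedge_def[abs_def])
qed

definition root_seq :: "(nat \<Rightarrow> real \<times> real) \<Rightarrow> nat \<Rightarrow> complex" where
  "root_seq u l = (if even l then rx (u (l div 2)) else ry (u (l div 2)))"

lemma root_seq_simps [simp]:
  "root_seq u (2 * j) = rx (u j)" "root_seq u (Suc (2 * j)) = ry (u j)" "root_seq u (2 * j + 1) = ry (u j)"
  by (auto simp: root_seq_def)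

lemma horner_prod_quads: "horner (prod_quads s u) (2 * s) z = (\<Prod>l<2 * s. z - root_seq u l)"
proof (induction s)
  case (Suc s)
  have "horner (prod_quads (Suc s) u) (2 * Suc s) z = (z - rx (u s)) * (z - ry (u s)) * horner (prod_quads s u) (2 * s) z"
    using horner_times_quad[of "2 * s" "u s" "prod_quads s u" z] unfolding quadratic_factor by simp
  moreover have "(\<Prod>l<2 * Suc s. z - root_seq u l) = (\<Prod>l<2 * s. z - root_seq u l) * (z - rx (u s)) * (z - ry (u s))"
    by simp
  ultimately show ?case unfolding Suc.IH by (simp only: mult_ac)
qed simp

text \<open>
  In the Vandermonde product, the differences within one pair of roots are separated from those between
  different pairs, and the latter form the resultants.
\<close>
lemma prod_res_vandermonde:
  "of_real (prod_res s u) * (\<Prod>j<s. ry (u j) - rx (u j)) = (\<Prod>l<2 * s. \<Prod>k<l. root_seq u l - root_seq u k)"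
proof (induction s)
  case (Suc s)
  have "of_real (prod_res (Suc s) u) * (\<Prod>j<Suc s. ry (u j) - rx (u j)) =
     (of_real (prod_res s u) * (\<Prod>j<s. ry (u j) - rx (u j))) *
     (\<Prod>l<2 * s. rx (u s) - root_seq u l) * ((\<Prod>l<2 * s. ry (u s) - root_seq u l) * (ry (u s) - rx (u s)))"
    unfolding prod_res.simps of_real_mult res_eq horner_prod_quads prod.lessThan_Suc by (simp only: mult_ac)
  also have "\<dots> = (\<Prod>l<2 * Suc s. \<Prod>k<l. root_seq u l - root_seq u k)"
  proof -
    have "(\<Prod>l<2 * Suc s. \<Prod>k<l. root_seq u l - root_seq u k) = (\<Prod>l<2 * s. \<Prod>k<l. root_seq u l - root_seq u k) *
      (\<Prod>l<2 * s. rx (u s) - root_seq u l) * ((\<Prod>l<2 * s. ry (u s) - root_seq u l) * (ry (u s) - rx (u s)))"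
      by (simp add: mult.assoc)
    then show ?thesis unfolding Suc.IH by simp
  qed
  finally show ?case .
qed simp

lemma fdet_transpose: "fdet n (\<lambda>i j. A j i) = fdet n A"
proof -
  have "Matrix.mat n n (\<lambda>(i, j). A j i) = transpose_mat (Matrix.mat n n (\<lambda>(i, j). A i j))"
    by (rule eq_matI) auto
  then show ?thesis unfolding fdet_def by (simp add: Determinant.det_transpose[where n = n])
qed

text \<open>
  The Leibniz expansion of the Vandermonde determinant has the matrices \<open>x\<^sup>a y\<^sup>b\<close>, one for each pair of roots.
  They may be antisymmetrised, and then the factor \<open>y - x\<close> cancels in each of them.
\<close>
lemma prod_res_eq_pair_alt:
  assumes "\<And>j. j < s \<Longrightarrow> rx (u j) \<noteq> ry (u j)"
  shows "prod_res s u = pair_alt s (\<lambda>j a b. wedge a b (u j) / 2)"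
proof -
  let ?D = "\<Prod>j<s. ry (u j) - rx (u j)"
  have "of_real (prod_res s u) * ?D = fdet (2 * s) (\<lambda>i j. root_seq u i ^ j)"
    unfolding prod_res_vandermonde fdet_vandermonde[symmetric] by (rule fdet_transpose)
  also have "\<dots> = pair_alt s (\<lambda>j a b. rx (u j) ^ a * ry (u j) ^ b)"
    unfolding fdet_leibniz pair_alt_def prod_pairs by simp
  also have "\<dots> = pair_alt s (\<lambda>j a b. (ry (u j) - rx (u j)) * of_real (wedge a b (u j) / 2))"
  proof (rule pair_alt_cong_symmetric)
    fix j a b
    have w: "(ry (u j) - rx (u j)) * of_real (wedge a b (u j) / 2) = (rx (u j) ^ a * ry (u j) ^ b - rx (u j) ^ b * ry (u j) ^ a) / 2" for a b
      unfolding wedge_eq[symmetric] by simp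
    show "rx (u j) ^ a * ry (u j) ^ b - (ry (u j) - rx (u j)) * of_real (wedge a b (u j) / 2) =
      rx (u j) ^ b * ry (u j) ^ a - (ry (u j) - rx (u j)) * of_real (wedge b a (u j) / 2)"
      unfolding w by (simp add: field_simps)
  qed
  also have "\<dots> = of_real (pair_alt s (\<lambda>j a b. wedge a b (u j) / 2)) * ?D"
    unfolding pair_alt_def prod.distrib of_real_sum sum_distrib_right
    by (intro sum.cong refl) (simp add: mult_ac)
  finally have "of_real (prod_res s u) * ?D = of_real (pair_alt s (\<lambda>j a b. wedge a b (u j) / 2)) * ?D" .
  moreover have "?D \<noteq> 0" using assms by (auto simp: prod_zero_iff dest!: eq_commute[THEN iffD1, of "ry _"])
  ultimately have "complex_of_real (prod_res s u) = of_real (pair_alt s (\<lambda>j a b. wedge a b (u j) / 2))"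
    by simp
  then show ?thesis by (simp only: of_real_eq_iff)
qed

context root_region
begin

definition poly_space :: "nat \<Rightarrow> (nat \<Rightarrow> real) measure" where
  "poly_space d = restrict_space (coeffs_measure d) (polys_in Z d)"

definition quad_space :: "(real \<times> real) measure" where
  "quad_space = restrict_space lborel (quads_in Z)"

lemma polys_in_subset: "polys_in Z d \<subseteq> space (coeffs_measure d)"
  by (auto simp: polys_in_def space_PiM)

lemma space_poly_space [simp]: "space (poly_space d) = polys_in Z d"
  using polys_in_subset by (auto simp: poly_space_def space_restrict_space)

lemma space_quad_space [simp]: "space quad_space = quads_in Z"
  by (simp add: quad_space_def space_restrict_space)

lemma measurable_poly_space: "f \<in> coeffs_measure d \<rightarrow>\<^sub>M N \<Longrightarrow> f \<in> poly_space d \<rightarrow>\<^sub>M N"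
  unfolding poly_space_def by (rule measurable_restrict_space1)

lemma measurable_quad_space: "f \<in> borel \<rightarrow>\<^sub>M N \<Longrightarrow> f \<in> quad_space \<rightarrow>\<^sub>M N"
  unfolding quad_space_def by (rule measurable_restrict_space1) simp

lemma quads_in_bound:
  assumes "t \<in> quads_in Z" shows "\<bar>fst t\<bar> \<le> 2" "\<bar>snd t\<bar> \<le> 1"
proof -
  have n: "norm (rx t) < 1" "norm (ry t) < 1"
    using assms Z_disc by (auto simp: quads_in_def)
  have "\<bar>fst t\<bar> = norm (rx t + ry t)" unfolding root_relations by simp
  also have "\<dots> \<le> 2" using n norm_triangle_ineq[of "rx t" "ry t"] by simp
  finally show "\<bar>fst t\<bar> \<le> 2" .
  have "\<bar>snd t\<bar> = norm (rx t) * norm (ry t)"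
    unfolding norm_mult[symmetric] root_relations by simp
  also have "\<dots> \<le> 1" using n by (intro mult_le_one) auto
  finally show "\<bar>snd t\<bar> \<le> 1" .
qed

text \<open>
  Distances within the unit disc are at most \<open>2\<close>, and the resultant is a product of \<open>2d\<close> of them.
\<close>
lemma res_bound:
  assumes "t \<in> quads_in Z" "b \<in> polys_in Z d"
  shows "\<bar>res d t b\<bar> \<le> 4 ^ d"
proof -
  have "norm (horner b d z) \<le> 2 ^ d" if "norm z < 1" for z
  proof -
    have "norm (horner b d z) = (\<Prod>r\<in>root_set b d. norm (z - r))"
      unfolding polys_in_decompose(2)[OF assms(2)] by (rule prod_norm[symmetric])
    also have "\<dots> \<le> (\<Prod>r\<in>root_set b d. 2)"
    proof (rule prod_mono, safe)
      fix r assume "r \<in> root_set b d"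
      then have "norm r < 1" using polys_in_decompose(4)[OF assms(2)] Z_disc by auto
      then show "norm (z - r) \<le> 2" using that norm_triangle_ineq4[of z r] by simp
    qed simp
    also have "\<dots> = 2 ^ d" using polys_in_decompose(3)[OF assms(2)] by simp
    finally show ?thesis .
  qed
  then have "norm (horner b d (rx t)) * norm (horner b d (ry t)) \<le> 2 ^ d * 2 ^ d"
    using assms(1) Z_disc by (intro mult_mono) (auto simp: quads_in_def)
  also have "norm (horner b d (rx t)) * norm (horner b d (ry t)) = \<bar>res d t b\<bar>"
    unfolding norm_mult[symmetric] res_eq[symmetric] by simp
  also have "2 ^ d * 2 ^ d = (4 :: real) ^ d" by (simp flip: power_mult_distrib)
  finally show ?thesis .
qed

lemma emeasure_quads_in_finite: "emeasure lborel (quads_in Z) < \<infinity>"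
proof -
  have "quads_in Z \<subseteq> cbox (- 2, - 1) (2, 1)"
    using quads_in_bound by (auto simp: cbox_Pair_eq abs_le_iff) (metis fst_conv neg_le_iff_le minus_minus minus_le_iff snd_conv)+
  then have "bounded (quads_in Z)" by (metis bounded_cbox bounded_subset)
  then show ?thesis by (rule emeasure_bounded_finite)
qed

sublocale quad_space: finite_measure quad_space
  by standard (use emeasure_quads_in_finite in \<open>auto simp: quad_space_def emeasure_restrict_space space_restrict_space\<close>)

text \<open>
  The recursion bounds the volume in degree \<open>2m + 2\<close> by that in degree \<open>2m\<close> times a finite constant.
\<close>
lemma emeasure_polys_in_finite: "emeasure (coeffs_measure (2 * m)) (polys_in Z (2 * m)) < \<infinity>"
proof (induction m)
  case 0
  have "emeasure (coeffs_measure 0) (polys_in Z 0) \<le> emeasure (coeffs_measure 0) (space (coeffs_measure 0))"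
    by (rule emeasure_space)
  also have "\<dots> < \<infinity>" by (simp add: PiM_empty)
  finally show ?case by simp
next
  case (Suc m)
  let ?d = "2 * m"
  have "emeasure (coeffs_measure (Suc (Suc ?d))) (polys_in Z (Suc (Suc ?d))) =
      1 * (\<integral>\<^sup>+a. indicator (polys_in Z (Suc (Suc ?d))) a * 1 \<partial>coeffs_measure (Suc (Suc ?d)))"
    by simp
  also have "\<dots> \<le> of_nat (Suc m) * (\<integral>\<^sup>+a. indicator (polys_in Z (Suc (Suc ?d))) a * 1 \<partial>coeffs_measure (Suc (Suc ?d)))"
    by (intro mult_right_mono) (auto simp: ennreal_of_nat_eq_real_of_nat)
  also have "\<dots> \<le> (\<integral>\<^sup>+t. \<integral>\<^sup>+b. signed_part ?d 1 (\<lambda>_. 1) t b \<partial>coeffs_measure ?d \<partial>lborel)"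
    by (subst nn_recursion) auto
  also have "\<dots> \<le> (\<integral>\<^sup>+t. \<integral>\<^sup>+b. (indicator (quads_in Z) t * ennreal (4 ^ ?d)) * indicator (polys_in Z ?d) b \<partial>coeffs_measure ?d \<partial>lborel)"
  proof (intro nn_integral_mono)
    fix t b
    show "signed_part ?d 1 (\<lambda>_. 1) t b \<le> (indicator (quads_in Z) t * ennreal (4 ^ ?d)) * indicator (polys_in Z ?d) b"
      using res_bound[of t b ?d] by (auto simp: signed_part_def split: split_indicator intro!: ennreal_leI)
  qed
  also have "\<dots> = (\<integral>\<^sup>+t. indicator (quads_in Z) t * (ennreal (4 ^ ?d) * emeasure (coeffs_measure ?d) (polys_in Z ?d)) \<partial>lborel)"
    by (intro nn_integral_cong, subst nn_integral_cmult_indicator) (simp_all add: mult.assoc)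
  also have "\<dots> = emeasure lborel (quads_in Z) * (ennreal (4 ^ ?d) * emeasure (coeffs_measure ?d) (polys_in Z ?d))"
    by (simp add: nn_integral_multc)
  also have "\<dots> < \<infinity>" using Suc.IH emeasure_quads_in_finite by (auto simp: ennreal_mult_less_top)
  finally show ?case by simp
qed

lemma finite_poly_space: "finite_measure (poly_space (2 * m))"
  by standard (use emeasure_polys_in_finite[of m] polys_in_subset[of "2 * m"] in
    \<open>auto simp: poly_space_def emeasure_restrict_space space_restrict_space Int_absorb2\<close>)

definition weighted :: "nat \<Rightarrow> ((nat \<Rightarrow> real) \<Rightarrow> real) \<Rightarrow> real \<times> real \<Rightarrow> (nat \<Rightarrow> real) \<Rightarrow> real" where
  "weighted d h t b = res d t b * h (times_quad d t b)"

lemma measurable_weighted: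
  assumes h: "h \<in> borel_measurable (coeffs_measure (Suc (Suc d)))"
    and f: "f \<in> N \<rightarrow>\<^sub>M borel" and g: "g \<in> N \<rightarrow>\<^sub>M coeffs_measure d"
  shows "(\<lambda>x. weighted d h (f x) (g x)) \<in> borel_measurable N"
proof -
  have [measurable]: "(\<lambda>x. res d (f x) (g x)) \<in> borel_measurable N"
    by (intro measurable_res measurable_coeffs_component[OF g] f)
  have [measurable]: "(\<lambda>x. h (times_quad d (f x) (g x))) \<in> borel_measurable N"
    by (rule measurable_compose[OF measurable_times_quad[OF f g] h])
  show ?thesis unfolding weighted_def by measurable
qed

lemma measurable_weighted_pair:
  assumes h: "h \<in> borel_measurable (coeffs_measure (Suc (Suc d)))"
  shows "(\<lambda>p. weighted d h (fst p) (snd p)) \<in> borel_measurable (quad_space \<Otimes>\<^sub>M poly_space d)"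
proof (rule measurable_weighted[OF h])
  have "(\<lambda>t. t) \<in> quad_space \<rightarrow>\<^sub>M borel" by (rule measurable_quad_space) simp
  from measurable_compose[OF measurable_fst[of quad_space "poly_space d"] this] show "fst \<in> quad_space \<Otimes>\<^sub>M poly_space d \<rightarrow>\<^sub>M borel" by simp
  have "(\<lambda>t. t) \<in> poly_space d \<rightarrow>\<^sub>M coeffs_measure d" by (rule measurable_poly_space) simp
  from measurable_compose[OF measurable_snd[of quad_space "poly_space d"] this] show "snd \<in> quad_space \<Otimes>\<^sub>M poly_space d \<rightarrow>\<^sub>M coeffs_measure d" by simp
qed

lemma integrable_weighted_pair:
  assumes h: "h \<in> borel_measurable (coeffs_measure (Suc (Suc (2 * m))))" and B: "\<And>a. \<bar>h a\<bar> \<le> B"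
  shows "integrable (quad_space \<Otimes>\<^sub>M poly_space (2 * m)) (\<lambda>p. weighted (2 * m) h (fst p) (snd p))"
proof -
  interpret P: finite_measure "poly_space (2 * m)" by (rule finite_poly_space)
  interpret finite_measure "quad_space \<Otimes>\<^sub>M poly_space (2 * m)"
    by (rule finite_measure_pair_measure) unfold_locales
  show ?thesis
  proof (rule integrable_const_bound[where B = "4 ^ (2 * m) * B"])
    show "AE p in quad_space \<Otimes>\<^sub>M poly_space (2 * m). norm (weighted (2 * m) h (fst p) (snd p)) \<le> 4 ^ (2 * m) * B"
    proof (rule AE_I2)
      fix p assume "p \<in> space (quad_space \<Otimes>\<^sub>M poly_space (2 * m))"
      then have "\<bar>res (2 * m) (fst p) (snd p)\<bar> \<le> 4 ^ (2 * m)"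
        by (intro res_bound) (auto simp: space_pair_measure)
      then show "norm (weighted (2 * m) h (fst p) (snd p)) \<le> 4 ^ (2 * m) * B"
        unfolding weighted_def real_norm_def abs_mult using B by (intro mult_mono) auto
    qed
  qed (rule measurable_weighted_pair[OF h])
qed

text \<open>
  Now all integrals are finite, so that the two sides of \<open>nn_recursion\<close> can be subtracted.
\<close>
lemma recursion_nonneg:
  assumes h: "h \<in> borel_measurable (coeffs_measure (Suc (Suc (2 * m))))" and B: "\<And>a. \<bar>h a\<bar> \<le> B" and nn: "\<And>a. 0 \<le> h a"
  shows "real (Suc m) * (\<integral>a. h a \<partial>poly_space (Suc (Suc (2 * m)))) =
    (\<integral>p. weighted (2 * m) h (fst p) (snd p) \<partial>(quad_space \<Otimes>\<^sub>M poly_space (2 * m)))"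
proof -
  let ?d = "2 * m" and ?h = "\<lambda>a. ennreal (h a)"
  interpret P: finite_measure "poly_space ?d" by (rule finite_poly_space)
  interpret S: pair_sigma_finite quad_space "poly_space ?d" ..
  have h': "?h \<in> borel_measurable (coeffs_measure (Suc (Suc ?d)))" using h by measurable
  define X where "X \<sigma> = (\<integral>\<^sup>+t. \<integral>\<^sup>+b. signed_part ?d \<sigma> ?h t b \<partial>coeffs_measure ?d \<partial>lborel)" for \<sigma>
  have X: "(\<integral>\<^sup>+p. ennreal (\<sigma> * weighted ?d h (fst p) (snd p)) \<partial>(quad_space \<Otimes>\<^sub>M poly_space ?d)) = X \<sigma>" for \<sigma>
  proof -
    have [measurable]: "(\<lambda>p. ennreal (\<sigma> * weighted ?d h (fst p) (snd p))) \<in> borel_measurable (quad_space \<Otimes>\<^sub>M poly_space ?d)"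
      using measurable_weighted_pair[OF h] by measurable
    have "(\<integral>\<^sup>+p. ennreal (\<sigma> * weighted ?d h (fst p) (snd p)) \<partial>(quad_space \<Otimes>\<^sub>M poly_space ?d)) =
       (\<integral>\<^sup>+t. \<integral>\<^sup>+b. ennreal (\<sigma> * weighted ?d h t b) \<partial>poly_space ?d \<partial>quad_space)"
      by (subst P.nn_integral_fst[symmetric]) auto
    also have "\<dots> = (\<integral>\<^sup>+t. (\<integral>\<^sup>+b. ennreal (\<sigma> * weighted ?d h t b) * indicator (polys_in Z ?d) b \<partial>coeffs_measure ?d) * indicator (quads_in Z) t \<partial>lborel)"
      unfolding quad_space_def poly_space_def
      by (simp add: nn_integral_restrict_space)
    also have "\<dots> = X \<sigma>"
      unfolding X_def
    proof (intro nn_integral_cong)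
      fix t
      have "signed_part ?d \<sigma> ?h t b = ennreal (\<sigma> * weighted ?d h t b) * indicator (polys_in Z ?d) b * indicator (quads_in Z) t" for b
        using ennreal_mult''[OF nn, of "\<sigma> * res ?d t b" "times_quad ?d t b"]
        by (simp add: signed_part_def weighted_def mult.assoc split: split_indicator)
      then show "(\<integral>\<^sup>+b. ennreal (\<sigma> * weighted ?d h t b) * indicator (polys_in Z ?d) b \<partial>coeffs_measure ?d) * indicator (quads_in Z) t
         = (\<integral>\<^sup>+b. signed_part ?d \<sigma> ?h t b \<partial>coeffs_measure ?d)"
        by (auto split: split_indicator)
    qed
    finally show ?thesis .
  qed
  define Y where "Y = (\<integral>\<^sup>+a. ?h a \<partial>poly_space (Suc (Suc ?d)))"
  have Y: "Y = (\<integral>\<^sup>+a. indicator (polys_in Z (Suc (Suc ?d))) a * ?h a \<partial>coeffs_measure (Suc (Suc ?d)))"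
    unfolding Y_def poly_space_def by (simp add: nn_integral_restrict_space mult.commute)
  have rec: "X 1 = X (- 1) + of_nat (Suc m) * Y"
    unfolding X_def Y by (rule nn_recursion[OF h'])
  have int: "integrable (quad_space \<Otimes>\<^sub>M poly_space ?d) (\<lambda>p. weighted ?d h (fst p) (snd p))"
    by (rule integrable_weighted_pair[OF h B])
  have fin: "X 1 < \<infinity>" "X (- 1) < \<infinity>"
    using integrableD(2)[OF int] integrableD(3)[OF int] X[of 1] X[of "- 1"] by (auto simp: less_top)
  have "1 * Y \<le> of_nat (Suc m) * Y"
    by (intro mult_right_mono) (auto simp: ennreal_of_nat_eq_real_of_nat)
  also have "\<dots> \<le> X 1" unfolding rec by simp
  finally have Yfin: "Y < \<infinity>" using fin by simp
  then have SY: "of_nat (Suc m) * Y < \<infinity>"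
    by (auto simp: ennreal_mult_less_top ennreal_of_nat_eq_real_of_nat simp del: of_nat_Suc)
  have "(\<integral>p. weighted ?d h (fst p) (snd p) \<partial>(quad_space \<Otimes>\<^sub>M poly_space ?d)) = enn2real (X 1) - enn2real (X (- 1))"
    using real_lebesgue_integral_def[OF int] X[of 1] X[of "- 1"] by simp
  also have "\<dots> = real (Suc m) * enn2real Y"
    unfolding rec using fin SY
    by (simp add: enn2real_plus enn2real_mult ennreal_of_nat_eq_real_of_nat del: of_nat_Suc)
  also have "enn2real Y = (\<integral>a. h a \<partial>poly_space (Suc (Suc ?d)))"
    unfolding Y_def using nn measurable_poly_space[OF h] by (intro integral_eq_nn_integral[symmetric]) auto
  finally show ?thesis by simp
qed

text \<open>
  Adding a constant to \<open>h\<close> reduces the claim to nonnegative functions; both sides are linear.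
\<close>
theorem recursion:
  assumes h: "h \<in> borel_measurable (coeffs_measure (Suc (Suc (2 * m))))" and B: "\<And>a. \<bar>h a\<bar> \<le> B"
  shows "real (Suc m) * (\<integral>a. h a \<partial>poly_space (Suc (Suc (2 * m)))) =
    (\<integral>t. \<integral>b. weighted (2 * m) h t b \<partial>poly_space (2 * m) \<partial>quad_space)"
proof -
  let ?d = "2 * m"
  interpret P: finite_measure "poly_space ?d" by (rule finite_poly_space)
  interpret P': finite_measure "poly_space (Suc (Suc ?d))" using finite_poly_space[of "Suc m"] by simp
  interpret S: pair_sigma_finite quad_space "poly_space ?d" ..
  have B0: "B \<ge> 0" using B[of undefined] by simp
  let ?\<Phi> = "\<lambda>h. \<integral>p. weighted ?d h (fst p) (snd p) \<partial>(quad_space \<Otimes>\<^sub>M poly_space ?d)"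
  let ?\<Psi> = "\<lambda>h. \<integral>a. h a \<partial>poly_space (Suc (Suc ?d))"
  have hB: "\<bar>h a + B\<bar> \<le> 2 * B" "0 \<le> h a + B" for a using B[of a] by auto
  have hm: "(\<lambda>a. h a + B) \<in> borel_measurable (coeffs_measure (Suc (Suc ?d)))" using h by measurable
  have "real (Suc m) * ?\<Psi> (\<lambda>a. h a + B) = ?\<Phi> (\<lambda>a. h a + B)"
    by (rule recursion_nonneg[OF hm hB])
  moreover have "real (Suc m) * ?\<Psi> (\<lambda>_. B) = ?\<Phi> (\<lambda>_. B)"
    by (rule recursion_nonneg[where B = B]) (use B0 in auto)
  moreover have "?\<Psi> (\<lambda>a. h a + B) = ?\<Psi> h + ?\<Psi> (\<lambda>_. B)"
    by (intro Bochner_Integration.integral_add P'.integrable_const P'.integrable_const_bound[where B = B])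
       (use B measurable_poly_space[OF h] in auto)
  moreover have "?\<Phi> (\<lambda>a. h a + B) = ?\<Phi> h + ?\<Phi> (\<lambda>_. B)"
  proof -
    have "?\<Phi> (\<lambda>a. h a + B) = (\<integral>p. weighted ?d h (fst p) (snd p) + weighted ?d (\<lambda>_. B) (fst p) (snd p) \<partial>(quad_space \<Otimes>\<^sub>M poly_space ?d))"
      by (intro Bochner_Integration.integral_cong) (auto simp: weighted_def algebra_simps)
    also have "\<dots> = ?\<Phi> h + ?\<Phi> (\<lambda>_. B)"
      by (intro Bochner_Integration.integral_add integrable_weighted_pair[OF h B] integrable_weighted_pair[where B = B])
         (use B0 in auto)
    finally show ?thesis .
  qed
  ultimately have "real (Suc m) * ?\<Psi> h = ?\<Phi> h" by (simp add: algebra_simps)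
  also have "?\<Phi> h = (\<integral>t. \<integral>b. weighted ?d h t b \<partial>poly_space ?d \<partial>quad_space)"
    using S.integral_fst'[of "\<lambda>p. weighted ?d h (fst p) (snd p)"] integrable_weighted_pair[OF h B] by simp
  finally show ?thesis .
qed

definition tuple_space :: "nat \<Rightarrow> (nat \<Rightarrow> real \<times> real) measure" where
  "tuple_space s = (\<Pi>\<^sub>M j\<in>{..<s}. quad_space)"

lemma space_tuple_space: "space (tuple_space s) = {..<s} \<rightarrow>\<^sub>E quads_in Z"
  by (simp add: tuple_space_def space_PiM)

sublocale tuples: product_sigma_finite "\<lambda>_::nat. quad_space"
  by standard

lemma finite_tuple_space: "finite_measure (tuple_space s)"
proof
  have "emeasure (tuple_space s) (space (tuple_space s)) = (\<Prod>j<s. emeasure quad_space (quads_in Z))"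
    by (subst space_tuple_space, unfold tuple_space_def, subst tuples.emeasure_PiM) (use sets.top[of quad_space] in auto)
  also have "\<dots> \<noteq> \<infinity>"
    using quad_space.emeasure_finite[of "quads_in Z"] by (auto simp: power_eq_top_ennreal)
  finally show "emeasure (tuple_space s) (space (tuple_space s)) \<noteq> \<infinity>" .
qed

lemma measurable_tuple_component: "j < s \<Longrightarrow> (\<lambda>u. u j) \<in> tuple_space s \<rightarrow>\<^sub>M borel"
proof -
  assume "j < s"
  then have 1: "(\<lambda>u. u j) \<in> tuple_space s \<rightarrow>\<^sub>M quad_space"
    unfolding tuple_space_def by (intro measurable_component_singleton) auto
  have "(\<lambda>t. t) \<in> quad_space \<rightarrow>\<^sub>M borel" by (rule measurable_quad_space) simp
  from measurable_compose[OF 1 this] show ?thesis .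
qed

lemma measurable_prod_quads: "s \<le> n \<Longrightarrow> prod_quads s \<in> tuple_space n \<rightarrow>\<^sub>M coeffs_measure (2 * s)"
proof (induction s)
  case 0
  have "(\<lambda>u. \<lambda>_. undefined) \<in> tuple_space n \<rightarrow>\<^sub>M coeffs_measure (2 * 0)"
    by (rule measurable_const) (auto simp: space_PiM)
  then show ?case by (simp add: fun_eq_iff[symmetric] cong: measurable_cong)
next
  case (Suc s)
  have "(\<lambda>u. times_quad (2 * s) (u s) (prod_quads s u)) \<in> tuple_space n \<rightarrow>\<^sub>M coeffs_measure (Suc (Suc (2 * s)))"
    using Suc by (intro measurable_times_quad measurable_tuple_component) auto
  moreover have "prod_quads (Suc s) = (\<lambda>u. times_quad (2 * s) (u s) (prod_quads s u))" by (rule ext) simp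
  ultimately show ?case by simp
qed

lemma measurable_prod_res: "s \<le> n \<Longrightarrow> prod_res s \<in> borel_measurable (tuple_space n)"
proof (induction s)
  case (Suc s)
  have [measurable]: "prod_res s \<in> borel_measurable (tuple_space n)" using Suc by simp
  have [measurable]: "(\<lambda>u. res (2 * s) (u s) (prod_quads s u)) \<in> borel_measurable (tuple_space n)"
    using Suc.prems by (intro measurable_res measurable_coeffs_component[OF measurable_prod_quads] measurable_tuple_component) auto
  have "(\<lambda>u. prod_res s u * res (2 * s) (u s) (prod_quads s u)) \<in> borel_measurable (tuple_space n)" by measurable
  then show ?case by (simp cong: measurable_cong)
qed (simp cong: measurable_cong)

lemma prod_quads_in_polys_in:
  assumes "\<And>j. j < s \<Longrightarrow> u j \<in> quads_in Z" "prod_res s u \<noteq> 0"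
  shows "prod_quads s u \<in> polys_in Z (2 * s)"
  using assms
proof (induction s)
  case 0
  then show ?case by (simp add: polys_in_def)
next
  case (Suc s)
  then show ?case
    using times_quad_in_polys_in_iff[of "u s" Z "prod_quads s u" "2 * s"] prod_quads_extensional by simp
qed

lemma prod_res_bounded: "\<exists>C. \<forall>u. (\<forall>j<s. u j \<in> quads_in Z) \<longrightarrow> \<bar>prod_res s u\<bar> \<le> C"
proof (induction s)
  case (Suc s)
  then obtain C where C: "\<And>u. (\<forall>j<s. u j \<in> quads_in Z) \<Longrightarrow> \<bar>prod_res s u\<bar> \<le> C" by auto
  have "\<bar>prod_res (Suc s) u\<bar> \<le> \<bar>C\<bar> * 4 ^ (2 * s)" if u: "\<forall>j<Suc s. u j \<in> quads_in Z" for u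
  proof (cases "prod_res s u = 0")
    case False
    then have "prod_quads s u \<in> polys_in Z (2 * s)" using u by (intro prod_quads_in_polys_in) auto
    then have "\<bar>res (2 * s) (u s) (prod_quads s u)\<bar> \<le> 4 ^ (2 * s)" using u by (intro res_bound) auto
    moreover have "\<bar>prod_res s u\<bar> \<le> \<bar>C\<bar>" using C[of u] u by fastforce
    ultimately show ?thesis by (simp add: abs_mult mult_mono)
  qed simp
  then show ?case by blast
qed auto

text \<open>
  The induction hypothesis is applied to \<open>h\<close> composed with the multiplication by the last quadratic and
  weighted with the resultant, which is why \<open>h\<close> has to be a general bounded function even though
  the volume only needs \<open>h = 1\<close>.
\<close>
theorem iterated_recursion:
  assumes "h \<in> borel_measurable (coeffs_measure (2 * s))" "\<And>a. \<bar>h a\<bar> \<le> B"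
  shows "fact s * (\<integral>a. h a \<partial>poly_space (2 * s)) = (\<integral>u. h (prod_quads s u) * prod_res s u \<partial>tuple_space s)"
  using assms
proof (induction s arbitrary: h B)
  case 0
  have sp: "polys_in Z 0 = {\<lambda>_. undefined}" by (auto simp: polys_in_def)
  have "(\<integral>a. h a \<partial>poly_space 0) = h (\<lambda>_. undefined)"
    unfolding poly_space_def sp by (simp add: PiM_empty restrict_count_space lebesgue_integral_count_space_finite)
  moreover have "(\<integral>u. h (prod_quads 0 u) * prod_res 0 u \<partial>tuple_space 0) = h (\<lambda>_. undefined)"
    by (simp add: tuple_space_def PiM_empty lebesgue_integral_count_space_finite)
  ultimately show ?case by simp
next
  case (Suc s)
  let ?d = "2 * s"
  have h: "h \<in> borel_measurable (coeffs_measure (Suc (Suc ?d)))" using Suc.prems(1) by simp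
  have B0: "B \<ge> 0" using Suc.prems(2)[of undefined] by simp
  define G where "G u = h (prod_quads (Suc s) u) * prod_res (Suc s) u" for u
  have G_upd: "G (u(s := t)) = weighted ?d h t (prod_quads s u) * prod_res s u" for u t
    using prod_quads_cong[of s "u(s := t)" u] prod_res_cong[of s "u(s := t)" u] by (simp add: G_def weighted_def)
  interpret Ts: finite_measure "tuple_space s" by (rule finite_tuple_space)
  interpret TS: finite_measure "tuple_space (Suc s)" by (rule finite_tuple_space)
  interpret PQ: pair_sigma_finite "tuple_space s" quad_space ..
  interpret PQf: finite_measure "tuple_space s \<Otimes>\<^sub>M quad_space"
    by (rule finite_measure_pair_measure) unfold_locales
  obtain C where C: "\<And>u. (\<forall>j<Suc s. u j \<in> quads_in Z) \<Longrightarrow> \<bar>prod_res (Suc s) u\<bar> \<le> C"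
    using prod_res_bounded[of "Suc s"] by auto
  have GB: "\<bar>G u\<bar> \<le> B * C" if "u \<in> {..<Suc s} \<rightarrow>\<^sub>E quads_in Z" for u
    unfolding G_def abs_mult using that Suc.prems(2) C B0 by (intro mult_mono) auto
  have Gm: "G \<in> borel_measurable (tuple_space (Suc s))"
    unfolding G_def
    by (intro borel_measurable_times measurable_compose[OF measurable_prod_quads Suc.prems(1)] measurable_prod_res) auto
  have Gint: "integrable (tuple_space (Suc s)) G"
    by (rule TS.integrable_const_bound[where B = "B * C"])
       (use GB Gm in \<open>auto simp: space_tuple_space intro!: AE_I2\<close>)
  have upd: "(\<lambda>p. (fst p)(s := snd p)) \<in> tuple_space s \<Otimes>\<^sub>M quad_space \<rightarrow>\<^sub>M tuple_space (Suc s)"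
    unfolding tuple_space_def by (intro measurable_fun_upd[where J = "{..<s}"]) auto
  have Gpair: "integrable (tuple_space s \<Otimes>\<^sub>M quad_space) (\<lambda>(u, t). G (u(s := t)))"
  proof (rule PQf.integrable_const_bound[where B = "B * C"])
    show "AE p in tuple_space s \<Otimes>\<^sub>M quad_space. norm (case p of (u, t) \<Rightarrow> G (u(s := t))) \<le> B * C"
    proof (rule AE_I2)
      fix p assume "p \<in> space (tuple_space s \<Otimes>\<^sub>M quad_space)"
      then have "(fst p)(s := snd p) \<in> {..<Suc s} \<rightarrow>\<^sub>E quads_in Z"
        using measurable_space[OF upd] by (auto simp: space_tuple_space)
      then show "norm (case p of (u, t) \<Rightarrow> G (u(s := t))) \<le> B * C"
        using GB by (auto simp: case_prod_unfold)
    qed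
    show "(\<lambda>(u, t). G (u(s := t))) \<in> borel_measurable (tuple_space s \<Otimes>\<^sub>M quad_space)"
      using measurable_compose[OF upd Gm] by (simp add: case_prod_unfold)
  qed
  have inner: "fact s * (\<integral>b. weighted ?d h t b \<partial>poly_space ?d) = (\<integral>u. G (u(s := t)) \<partial>tuple_space s)"
    if t: "t \<in> quads_in Z" for t
  proof -
    \<comment> \<open>the resultant is bounded on \<open>polys_in Z ?d\<close> only, so the weight is cut off outside\<close>
    define h' where "h' b = indicator (polys_in Z ?d) b * weighted ?d h t b" for b
    have "(\<lambda>b. weighted ?d h t b) \<in> borel_measurable (coeffs_measure ?d)"
      by (rule measurable_weighted[OF h]) auto
    then have h'm: "h' \<in> borel_measurable (coeffs_measure ?d)" unfolding h'_def by measurable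
    have h'b: "\<bar>h' b\<bar> \<le> 4 ^ ?d * B" for b
    proof (cases "b \<in> polys_in Z ?d")
      case True
      then show ?thesis
        using res_bound[OF t True] Suc.prems(2)[of "times_quad ?d t b"]
        by (auto simp: h'_def weighted_def abs_mult intro!: mult_mono)
    qed (use B0 in \<open>simp add: h'_def\<close>)
    have "(\<integral>b. weighted ?d h t b \<partial>poly_space ?d) = (\<integral>b. h' b \<partial>poly_space ?d)"
      by (intro Bochner_Integration.integral_cong) (auto simp: h'_def)
    moreover have "fact s * (\<integral>b. h' b \<partial>poly_space ?d) = (\<integral>u. h' (prod_quads s u) * prod_res s u \<partial>tuple_space s)"
      by (rule Suc.IH[OF h'm h'b])
    moreover have "(\<integral>u. h' (prod_quads s u) * prod_res s u \<partial>tuple_space s) = (\<integral>u. G (u(s := t)) \<partial>tuple_space s)"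
    proof (intro Bochner_Integration.integral_cong refl)
      fix u assume "u \<in> space (tuple_space s)"
      \<comment> \<open>the cutoff is invisible, because the factor \<open>prod_res s u\<close> vanishes where it is felt\<close>
      then have "prod_res s u \<noteq> 0 \<Longrightarrow> prod_quads s u \<in> polys_in Z ?d"
        by (intro prod_quads_in_polys_in) (auto simp: space_tuple_space)
      then show "h' (prod_quads s u) * prod_res s u = G (u(s := t))"
        unfolding G_upd by (auto simp: h'_def)
    qed
    ultimately show ?thesis by simp
  qed
  have "fact (Suc s) * (\<integral>a. h a \<partial>poly_space (2 * Suc s)) =
      fact s * (real (Suc s) * (\<integral>a. h a \<partial>poly_space (Suc (Suc ?d))))"
    by (simp add: mult_ac)
  also have "\<dots> = fact s * (\<integral>t. \<integral>b. weighted ?d h t b \<partial>poly_space ?d \<partial>quad_space)"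
    unfolding recursion[OF h Suc.prems(2)] ..
  also have "\<dots> = (\<integral>t. fact s * (\<integral>b. weighted ?d h t b \<partial>poly_space ?d) \<partial>quad_space)"
    by simp
  also have "\<dots> = (\<integral>t. \<integral>u. G (u(s := t)) \<partial>tuple_space s \<partial>quad_space)"
    by (intro Bochner_Integration.integral_cong refl inner) simp
  also have "\<dots> = (\<integral>u. \<integral>t. G (u(s := t)) \<partial>quad_space \<partial>tuple_space s)"
    by (rule PQ.Fubini_integral[OF Gpair])
  also have "\<dots> = (\<integral>u. G u \<partial>tuple_space (Suc s))"
    using tuples.product_integral_insert[of "{..<s}" s G] Gint
    by (simp add: tuple_space_def lessThan_Suc)
  finally show ?case unfolding G_def .
qed

text \<open>
  These numbers are the entries \<open>M(a, b)\<close> of the antisymmetric matrix whose Pfaffian is the volume.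
\<close>
definition moment :: "nat \<Rightarrow> nat \<Rightarrow> real" where
  "moment a b = (\<integral>t. wedge a b t \<partial>quad_space)"

lemma integrable_wedge: "integrable quad_space (wedge a b)"
proof -
  have L: "\<bar>lucas t n\<bar> \<le> 3 ^ n" if t: "t \<in> quads_in Z" for t n
  proof (induction n rule: induct_nat_012)
    case (ge2 n)
    have "\<bar>lucas t (Suc (Suc n))\<bar> \<le> \<bar>fst t\<bar> * \<bar>lucas t (Suc n)\<bar> + \<bar>snd t\<bar> * \<bar>lucas t n\<bar>"
      by (simp add: abs_mult[symmetric])
    also have "\<dots> \<le> 2 * 3 ^ Suc n + 1 * 3 ^ n"
      using quads_in_bound[OF t] ge2 by (intro add_mono mult_mono) auto
    also have "\<dots> \<le> 3 ^ Suc (Suc n)" by simp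
    finally show ?case .
  qed auto
  have "\<bar>wedge a b t\<bar> \<le> 3 ^ (a + b)" if t: "t \<in> quads_in Z" for t
  proof -
    have "\<bar>snd t ^ i * lucas t (j - i)\<bar> \<le> 3 ^ (a + b)" if "j \<le> a + b" for i j
    proof -
      have "\<bar>snd t ^ i * lucas t (j - i)\<bar> \<le> 1 * 3 ^ (j - i)"
        unfolding abs_mult power_abs using quads_in_bound[OF t] L[OF t]
        by (intro mult_mono power_le_one) auto
      also have "\<dots> \<le> 3 ^ (a + b)" using that by (simp add: power_increasing)
      finally show ?thesis .
    qed
    then show ?thesis by (auto simp: wedge_def)
  qed
  then show ?thesis
    by (intro quad_space.integrable_const_bound[where B = "3 ^ (a + b)"])
       (auto intro!: AE_I2 measurable_quad_space)
qed

text \<open>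
  Fubini's theorem factorises each term of the Leibniz expansion into moments. As these vanish for equal
  parities, half of the moment matrix differs from its even-odd block by a symmetric matrix.
\<close>
theorem volume_eq_fdet:
  assumes par: "\<And>a b. even (a + b) \<Longrightarrow> moment a b = 0"
  shows "measure (coeffs_measure (2 * s)) (polys_in Z (2 * s)) = fdet s (\<lambda>i j. moment (2 * i) (2 * j + 1))"
proof -
  interpret P: finite_measure "poly_space (2 * s)" by (rule finite_poly_space)
  have "measure (coeffs_measure (2 * s)) (polys_in Z (2 * s)) = measure (poly_space (2 * s)) (polys_in Z (2 * s))"
    unfolding poly_space_def using polys_in_subset[of "2 * s"]
    by (subst measure_restrict_space) (auto simp: Int_absorb2)
  also have "\<dots> = (\<integral>a. 1 \<partial>poly_space (2 * s))" by simp
  finally have "fact s * measure (coeffs_measure (2 * s)) (polys_in Z (2 * s)) = (\<integral>u. prod_res s u \<partial>tuple_space s)"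
    using iterated_recursion[of "\<lambda>_. 1" s 1] by simp
  also have "\<dots> = (\<integral>u. pair_alt s (\<lambda>j a b. wedge a b (u j) / 2) \<partial>tuple_space s)"
    by (intro Bochner_Integration.integral_cong refl prod_res_eq_pair_alt)
       (auto simp: space_tuple_space quads_in_def)
  also have "\<dots> = pair_alt s (\<lambda>j a b. moment a b / 2)"
  proof -
    have int: "integrable quad_space (\<lambda>t. wedge a b t / 2)" for a b
      by (intro integrable_divide integrable_wedge)
    have "integrable (tuple_space s) (\<lambda>u. \<Prod>j<s. wedge (\<sigma> (2 * j)) (\<sigma> (2 * j + 1)) (u j) / 2)" for \<sigma>
      unfolding tuple_space_def by (intro tuples.product_integrable_prod int) auto
    moreover have "(\<integral>u. (\<Prod>j<s. wedge (\<sigma> (2 * j)) (\<sigma> (2 * j + 1)) (u j) / 2) \<partial>tuple_space s) =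
        (\<Prod>j<s. moment (\<sigma> (2 * j)) (\<sigma> (2 * j + 1)) / 2)" for \<sigma>
      unfolding tuple_space_def moment_def
      by (subst tuples.product_integral_prod) (auto intro!: int)
    ultimately show ?thesis
      unfolding pair_alt_def by (subst Bochner_Integration.integral_sum) auto
  qed
  also have "\<dots> = pair_alt s (\<lambda>j a b. if even a \<and> odd b then moment a b else 0)"
  proof (rule pair_alt_cong_symmetric)
    fix j :: nat and a b :: nat
    have "moment b a = - moment a b"
    proof -
      have "wedge b a = (\<lambda>t. - wedge a b t)" by (rule ext) (rule wedge_antisym)
      then show ?thesis by (simp add: moment_def)
    qed
    then show "moment a b / 2 - (if even a \<and> odd b then moment a b else 0) =
          moment b a / 2 - (if even b \<and> odd a then moment b a else 0)"
      using par[of a b] by auto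
  qed
  also have "\<dots> = fact s * fdet s (\<lambda>i j. moment (2 * i) (2 * j + 1))"
    by (subst pair_alt_even_odd) auto
  finally show ?thesis by simp
qed

end

section \<open>The moments of the two regions\<close>

text \<open>
  The complement of the open segment is not closed. Besides the closed exterior of the disc it consists of
  the nonreal points, which the closed sets \<open>{z. \<bar>Im z\<bar> \<ge> 1 / (n + 1)}\<close> exhaust.
\<close>
interpretation real_region: root_region region_real
  "\<lambda>n. cball 0 (real n) \<inter> ({z. \<bar>Im z\<bar> \<ge> 1 / real (Suc n)} \<union> {z. norm z \<ge> 1})"
proof
  show "compact (cball 0 (real n) \<inter> ({z::complex. \<bar>Im z\<bar> \<ge> 1 / real (Suc n)} \<union> {z. norm z \<ge> 1}))" for n
    by (intro compact_Int_closed compact_cball closed_Un closed_Collect_le continuous_intros)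
  show "- region_real = (\<Union>n. cball 0 (real n) \<inter> ({z. \<bar>Im z\<bar> \<ge> 1 / real (Suc n)} \<union> {z. norm z \<ge> 1}))"
  proof (intro Set.set_eqI iffI)
    fix z assume "z \<in> - region_real"
    then consider "Im z \<noteq> 0" | "norm z \<ge> 1" by (force simp: region_real_def)
    then show "z \<in> (\<Union>n. cball 0 (real n) \<inter> ({z. \<bar>Im z\<bar> \<ge> 1 / real (Suc n)} \<union> {z. norm z \<ge> 1}))"
    proof cases
      case 1
      then obtain n where n: "1 / real (Suc n) < \<bar>Im z\<bar>"
        using reals_Archimedean[of "\<bar>Im z\<bar>"] by (auto simp: inverse_eq_divide)
      obtain k where k: "norm z \<le> real k" using real_arch_simple by blast
      have "1 / real (Suc (max n k)) \<le> 1 / real (Suc n)" by (intro divide_left_mono) auto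
      then have "1 / real (Suc (max n k)) \<le> \<bar>Im z\<bar>" using n by linarith
      moreover have "norm z \<le> real (max n k)" using k by simp
      ultimately show ?thesis by (intro UN_I[of "max n k"]) auto
    next
      case 2
      obtain k where "norm z \<le> real k" using real_arch_simple by blast
      then show ?thesis using 2 by (intro UN_I[of k]) auto
    qed
  next
    fix z assume "z \<in> (\<Union>n. cball 0 (real n) \<inter> ({z. \<bar>Im z\<bar> \<ge> 1 / real (Suc n)} \<union> {z. norm z \<ge> 1}))"
    then obtain n where "1 / real (Suc n) \<le> \<bar>Im z\<bar> \<or> norm z \<ge> 1" by auto
    moreover have "1 / real (Suc n) > 0" by simp
    ultimately have "Im z \<noteq> 0 \<or> norm z \<ge> 1" by (metis abs_zero not_le)
    then show "z \<in> - region_real" by (auto simp: region_real_def)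
  qed
  show "norm z < 1" if "z \<in> region_real" for z using that by (simp add: region_real_def)
qed (fact fibre_count_real)+

interpretation nonreal_region: root_region region_nonreal
  "\<lambda>n. cball 0 (real n) \<inter> ({z. Im z = 0} \<union> {z. norm z \<ge> 1})"
proof
  show "compact (cball 0 (real n) \<inter> ({z::complex. Im z = 0} \<union> {z. norm z \<ge> 1}))" for n
    by (intro compact_Int_closed compact_cball closed_Un closed_Collect_le closed_Collect_eq continuous_intros)
  show "- region_nonreal = (\<Union>n. cball 0 (real n) \<inter> ({z. Im z = 0} \<union> {z. norm z \<ge> 1}))"
  proof (intro Set.set_eqI iffI)
    fix z assume "z \<in> - region_nonreal"
    moreover obtain k where "norm z \<le> real k" using real_arch_simple by blast
    ultimately show "z \<in> (\<Union>n. cball 0 (real n) \<inter> ({z. Im z = 0} \<union> {z. norm z \<ge> 1}))"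
      by (intro UN_I[of k]) (auto simp: region_nonreal_def)
  qed (auto simp: region_nonreal_def)
  show "norm z < 1" if "z \<in> region_nonreal" for z using that by (simp add: region_nonreal_def)
qed (fact fibre_count_nonreal)+

lemma quads_in_iff_roots:
  fixes x y :: complex
  assumes "x + y = - of_real (fst t)" "x * y = of_real (snd t)"
  shows "t \<in> quads_in Z \<longleftrightarrow> x \<in> Z \<and> y \<in> Z \<and> x \<noteq> y"
  using roots_unique[OF assms] by (auto simp: quads_in_def doubleton_eq_iff)

lemma wedge_at_roots:
  fixes x y :: complex
  assumes "x + y = - of_real (fst t)" "x * y = of_real (snd t)"
  shows "of_real (wedge a b t) * (y - x) = x ^ a * y ^ b - x ^ b * y ^ a"
proof -
  consider "x = rx t" "y = ry t" | "x = ry t" "y = rx t"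
    using roots_unique[OF assms] by (auto simp: doubleton_eq_iff)
  then show ?thesis
  proof cases
    case 2
    have "of_real (wedge a b t) * (y - x) = - (of_real (wedge a b t) * (ry t - rx t))"
      using 2 by (simp add: algebra_simps)
    then show ?thesis unfolding wedge_eq using 2 by (simp add: mult_ac)
  qed (simp add: wedge_eq)
qed

text \<open>
  The signed area formula with exactly one, positively oriented preimage of each point; equality of the two
  measures then holds for all integrands at once.
\<close>
lemma integral_injective_plane:
  fixes g :: "real \<times> real \<Rightarrow> real \<times> real" and a b c d :: "real \<times> real \<Rightarrow> real" and F :: "real \<times> real \<Rightarrow> real"
  defines "J \<equiv> \<lambda>p. a p * d p - b p * c p"
  assumes der: "\<And>p. (g has_derivative (\<lambda>h. (a p * fst h + b p * snd h, c p * fst h + d p * snd h))) (at p)"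
    and cont: "continuous_on UNIV a" "continuous_on UNIV b" "continuous_on UNIV c" "continuous_on UNIV d"
    and S[measurable]: "S \<in> sets borel" and T[measurable]: "T \<in> sets borel"
    and bij: "bij_betw g S T" and pos: "\<And>p. p \<in> S \<Longrightarrow> J p > 0"
    and F[measurable]: "F \<in> borel_measurable borel"
  shows "(\<integral>t. F t \<partial>restrict_space lborel T) = (\<integral>p. indicator S p * (J p * F (g p)) \<partial>lborel)"
proof -
  have "continuous_on UNIV g"
    by (rule has_derivative_continuous_on[OF has_derivative_at_withinI[OF der]])
  then have g[measurable]: "g \<in> borel_measurable borel" by (rule borel_measurable_continuous_onI)
  have J[measurable]: "J \<in> borel_measurable borel"
    unfolding J_def by (intro borel_measurable_continuous_onI continuous_intros cont)
  let ?N1 = "distr (density lborel (\<lambda>p. ennreal (indicator S p * J p))) borel g"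
  let ?N2 = "density lborel (\<lambda>t. ennreal (indicator T t))"
  have "?N1 = ?N2"
  proof (rule measure_eqI)
    fix X assume "X \<in> sets ?N1"
    then have X[measurable]: "X \<in> sets borel" by simp
    let ?f = "\<lambda>z. indicator (X \<inter> T) z :: ennreal"
    have fib: "\<exists>p. {t \<in> S. g t = z} = {p} \<and> J p > 0" if nz: "?f z \<noteq> 0" for z
    proof -
      from nz have "z \<in> g ` S" using bij by (simp add: bij_betw_def split: split_indicator_asm)
      then obtain p where p: "p \<in> S" "g p = z" by blast
      have "inj_on g S" using bij by (simp add: bij_betw_def)
      then have "{t \<in> S. g t = z} = {p}" using p by (blast dest: inj_onD)
      then show ?thesis using pos[OF p(1)] by blast
    qed
    have main: "(\<integral>\<^sup>+t. indicator S t * ennreal (J t) * ?f (g t) \<partial>lborel) =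
         (\<integral>\<^sup>+t. indicator S t * ennreal (- J t) * ?f (g t) \<partial>lborel) + of_nat 1 * (\<integral>\<^sup>+z. ?f z \<partial>lborel)"
      unfolding J_def
    proof (rule signed_area_formula_plane[OF der cont S])
      fix z assume "?f z \<noteq> 0"
      then obtain p where p: "{t \<in> S. g t = z} = {p}" "J p > 0" using fib by blast
      have sub: "{t \<in> S. g t = z \<and> Q (J t)} = {t \<in> {t \<in> S. g t = z}. Q (J t)}" for Q by blast
      have "{t \<in> S. g t = z \<and> J t \<noteq> 0} = {p}" "{t \<in> S. g t = z \<and> J t > 0} = {p}" "{t \<in> S. g t = z \<and> J t < 0} = {}"
        unfolding sub[of "\<lambda>x. x \<noteq> 0"] sub[of "\<lambda>x. x > 0"] sub[of "\<lambda>x. x < 0"] p(1) using p(2) by auto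
      note eqs = this[unfolded J_def]
      show "finite {t \<in> S. g t = z \<and> a t * d t - b t * c t \<noteq> 0}"
          "card {t \<in> S. g t = z \<and> a t * d t - b t * c t > 0} =
          card {t \<in> S. g t = z \<and> a t * d t - b t * c t < 0} + 1"
        unfolding eqs by simp_all
    qed measurable
    have "emeasure ?N1 X = (\<integral>\<^sup>+t. ennreal (indicator S t * J t) * indicator (g -` X) t \<partial>lborel)"
      using measurable_sets[OF g X] by (simp add: emeasure_distr emeasure_density)
    also have "\<dots> = (\<integral>\<^sup>+t. indicator S t * ennreal (J t) * ?f (g t) \<partial>lborel)"
      using bij by (intro nn_integral_cong) (auto simp: bij_betw_def split: split_indicator)
    also have "\<dots> = (\<integral>\<^sup>+t. indicator S t * ennreal (- J t) * ?f (g t) \<partial>lborel) + of_nat 1 * (\<integral>\<^sup>+z. ?f z \<partial>lborel)"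
      by (rule main)
    also have "(\<integral>\<^sup>+t. indicator S t * ennreal (- J t) * ?f (g t) \<partial>lborel) = (\<integral>\<^sup>+t. 0 \<partial>(lborel :: (real \<times> real) measure))"
    proof (rule nn_integral_cong)
      fix t
      have "ennreal (- J t) = 0" if "t \<in> S" using pos[OF that] by (intro ennreal_neg) simp
      then show "indicator S t * ennreal (- J t) * ?f (g t) = 0" by (cases "t \<in> S") auto
    qed
    also have "(\<integral>\<^sup>+z. ?f z \<partial>lborel) = (\<integral>\<^sup>+t. ennreal (indicator T t) * indicator X t \<partial>lborel)"
      by (intro nn_integral_cong) (auto split: split_indicator)
    also have "\<dots> = emeasure ?N2 X" by (simp add: emeasure_density)
    finally show "emeasure ?N1 X = emeasure ?N2 X" by simp
  qed simp
  then have "integral\<^sup>L ?N1 F = integral\<^sup>L ?N2 F" by simp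
  moreover have "integral\<^sup>L ?N1 F = (\<integral>p. indicator S p * (J p * F (g p)) \<partial>lborel)"
  proof -
    have nn: "0 \<le> indicator S p * J p" for p
      using pos[of p] by (cases "p \<in> S") auto
    have "integral\<^sup>L ?N1 F = (\<integral>p. F (g p) \<partial>density lborel (\<lambda>p. ennreal (indicator S p * J p)))"
      by (rule integral_distr) measurable
    also have "\<dots> = (\<integral>p. (indicator S p * J p) *\<^sub>R F (g p) \<partial>lborel)"
      by (rule integral_density) (use nn in \<open>auto intro!: AE_I2\<close>)
    finally show ?thesis by (simp add: mult.assoc)
  qed
  moreover have "integral\<^sup>L ?N2 F = (\<integral>t. F t \<partial>restrict_space lborel T)"
  proof -
    have "integral\<^sup>L ?N2 F = (\<integral>t. indicator T t *\<^sub>R F t \<partial>lborel)"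
      by (rule integral_density) auto
    then show ?thesis by (simp add: integral_restrict_space)
  qed
  ultimately show ?thesis by simp
qed

lemma integral_plane_iterated:
  fixes f :: "real \<times> real \<Rightarrow> real"
  assumes f: "f \<in> borel_measurable borel" and B: "\<And>p. \<bar>f p\<bar> \<le> B" and supp: "\<And>p. p \<notin> cbox l u \<Longrightarrow> f p = 0"
  shows "(\<integral>p. f p \<partial>lborel) = (\<integral>x. \<integral>y. f (x, y) \<partial>lborel \<partial>lborel)"
    and "(\<integral>p. f p \<partial>lborel) = (\<integral>y. \<integral>x. f (x, y) \<partial>lborel \<partial>lborel)"
proof -
  have int: "integrable (lborel \<Otimes>\<^sub>M lborel) f"
    unfolding lborel_prod
    by (rule integrableI_bounded_set[where A = "cbox l u" and B = B])
       (use f B supp in \<open>auto intro!: AE_I2 simp: emeasure_lborel_cbox_eq\<close>)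
  show "(\<integral>p. f p \<partial>lborel) = (\<integral>x. \<integral>y. f (x, y) \<partial>lborel \<partial>lborel)"
    using lborel_pair.integral_fst'[OF int] by (simp add: lborel_prod)
  show "(\<integral>p. f p \<partial>lborel) = (\<integral>y. \<integral>x. f (x, y) \<partial>lborel \<partial>lborel)"
    using lborel_pair.integral_snd[of "\<lambda>x y. f (x, y)"] int by (simp add: lborel_prod)
qed

text \<open>
  Use the roots \<open>x < y\<close> as coordinates: the Jacobian determinant \<open>y - x\<close> cancels the denominator of \<open>wedge\<close>.
\<close>
lemma moment_real_integral:
  "real_region.moment a b = (\<integral>p. indicator {p. - 1 < fst p \<and> fst p < snd p \<and> snd p < 1} p * (fst p ^ a * snd p ^ b - fst p ^ b * snd p ^ a) \<partial>lborel)"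
proof -
  let ?S = "{p::real \<times> real. - 1 < fst p \<and> fst p < snd p \<and> snd p < 1}"
  let ?g = "\<lambda>p::real \<times> real. (- (fst p + snd p), fst p * snd p)"
  have S: "?S \<in> sets borel" by measurable
  have roots: "complex_of_real x + of_real y = - of_real (fst (?g (x, y)))" "complex_of_real x * of_real y = of_real (snd (?g (x, y)))" for x y
    by simp_all
  have bij: "bij_betw ?g ?S (quads_in region_real)"
    unfolding bij_betw_def
  proof
    show "inj_on ?g ?S"
    proof (rule inj_onI)
      fix p q assume pq: "p \<in> ?S" "q \<in> ?S" and eq: "?g p = ?g q"
      have "{complex_of_real (fst p), of_real (snd p)} = {rx (?g p), ry (?g p)}"
        by (rule roots_unique) simp_all
      moreover have "{complex_of_real (fst q), of_real (snd q)} = {rx (?g p), ry (?g p)}"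
        unfolding eq by (rule roots_unique) simp_all
      ultimately have "{complex_of_real (fst p), of_real (snd p)} = {of_real (fst q), of_real (snd q)}"
        by (rule trans[OF _ sym])
      then show "p = q" using pq by (auto simp: doubleton_eq_iff prod_eq_iff)
    qed
    show "?g ` ?S = quads_in region_real"
    proof (intro Set.set_eqI iffI)
      fix t assume "t \<in> ?g ` ?S"
      then obtain x y where "t = ?g (x, y)" "- 1 < x" "x < y" "y < 1" by auto
      then show "t \<in> quads_in region_real"
        using quads_in_iff_roots[OF roots[of x y]] by (auto simp: region_real_def abs_less_iff)
    next
      fix t assume t: "t \<in> quads_in region_real"
      define x where "x = Re (rx t)"
      define y where "y = Re (ry t)"
      have eq: "rx t = of_real x" "ry t = of_real y" and "rx t \<noteq> ry t" "norm (rx t) < 1" "norm (ry t) < 1"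
        using t by (auto simp: quads_in_def region_real_def complex_eq_iff x_def y_def)
      then have xy: "x \<noteq> y" "\<bar>x\<bar> < 1" "\<bar>y\<bar> < 1" "rx t = of_real x" "ry t = of_real y"
        by (auto simp only: eq norm_of_real)
      have "complex_of_real (fst t) = - (rx t + ry t)" "complex_of_real (snd t) = rx t * ry t"
        unfolding root_relations by simp_all
      then have "complex_of_real (fst t) = of_real (- (x + y))" "complex_of_real (snd t) = of_real (x * y)"
        unfolding xy by simp_all
      then have t': "t = (- (x + y), x * y)" by (simp only: of_real_eq_iff prod_eq_iff fst_conv snd_conv)
      show "t \<in> ?g ` ?S"
      proof (cases "x < y")
        case True
        then show ?thesis using t' xy by (intro image_eqI[of _ _ "(x, y)"]) auto
      next
        case False
        then show ?thesis using t' xy by (intro image_eqI[of _ _ "(y, x)"]) auto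
      qed
    qed
  qed
  have "real_region.moment a b = (\<integral>t. wedge a b t \<partial>restrict_space lborel (quads_in region_real))"
    by (simp add: real_region.moment_def real_region.quad_space_def)
  also have "\<dots> = (\<integral>p. indicator ?S p * (((- 1) * fst p - (- 1) * snd p) * wedge a b (?g p)) \<partial>lborel)"
  proof (rule integral_injective_plane[OF _ _ _ _ _ S real_region.quads_in_measurable bij])
    show "(?g has_derivative (\<lambda>h. ((- 1) * fst h + (- 1) * snd h, snd p * fst h + fst p * snd h))) (at p)" for p
      by (rule has_derivative_eq_rhs, (rule derivative_intros)+) (auto simp: algebra_simps)
  qed (auto intro!: continuous_intros)
  also have "\<dots> = (\<integral>p. indicator ?S p * (fst p ^ a * snd p ^ b - fst p ^ b * snd p ^ a) \<partial>lborel)"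
  proof (rule Bochner_Integration.integral_cong[OF refl])
    fix p :: "real \<times> real"
    have "of_real (wedge a b (?g p) * (snd p - fst p)) = complex_of_real (fst p ^ a * snd p ^ b - fst p ^ b * snd p ^ a)"
      using wedge_at_roots[OF roots[of "fst p" "snd p"], of a b] by simp
    then have "wedge a b (?g p) * (snd p - fst p) = fst p ^ a * snd p ^ b - fst p ^ b * snd p ^ a"
      by (simp only: of_real_eq_iff)
    moreover have "((- 1) * fst p - (- 1) * snd p) * wedge a b (?g p) = wedge a b (?g p) * (snd p - fst p)"
      by (simp add: algebra_simps)
    ultimately show "indicator ?S p * (((- 1) * fst p - (- 1) * snd p) * wedge a b (?g p)) =
         indicator ?S p * (fst p ^ a * snd p ^ b - fst p ^ b * snd p ^ a)" by simp
  qed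
  finally show ?thesis .
qed

lemma integral_power_sym: "(\<integral>x. x ^ k * indicator {- 1..1} x \<partial>lborel) = (if even k then 2 / (real k + 1) else 0)"
  by (subst integral_power) (auto simp: add.commute)

lemma moment_real:
  "real_region.moment a b = (if even a \<and> odd b then 4 / ((real a + 1) * (real a + real b + 2))
     else if odd a \<and> even b then - 4 / ((real b + 1) * (real a + real b + 2)) else 0)"
proof -
  let ?S = "{p::real \<times> real. - 1 < fst p \<and> fst p < snd p \<and> snd p < 1}"
  let ?f = "\<lambda>p::real \<times> real. indicator ?S p * (fst p ^ a * snd p ^ b - fst p ^ b * snd p ^ a) :: real"
  have S[measurable]: "?S \<in> sets borel" by measurable
  have fm: "?f \<in> borel_measurable borel" by measurable
  have fB: "\<bar>?f p\<bar> \<le> 2" for p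
  proof (cases "p \<in> ?S")
    case True
    then have "\<bar>fst p\<bar> \<le> 1" "\<bar>snd p\<bar> \<le> 1" by auto
    then have "\<bar>fst p ^ i * snd p ^ j\<bar> \<le> 1" for i j
      unfolding abs_mult power_abs by (intro mult_le_one power_le_one) auto
    from this[of a b] this[of b a] True show ?thesis by simp
  qed simp
  have inner: "(\<integral>x. ?f (x, y) \<partial>lborel) =
     indicator {- 1..1} y *
      (y ^ b * (y ^ Suc a - (- 1) ^ Suc a) / real (Suc a) - y ^ a * (y ^ Suc b - (- 1) ^ Suc b) / real (Suc b))"
    if "y \<noteq> - 1" "y \<noteq> 1" for y
  proof (cases "- 1 < y \<and> y < 1")
    case True
    have i: "integrable lborel (\<lambda>x::real. x ^ k * indicator {- 1..y} x)" for k
    proof -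
      have "set_integrable lborel {- 1..y} (\<lambda>x::real. x ^ k)"
        by (intro borel_integrable_atLeastAtMost' continuous_intros)
      then show ?thesis by (simp add: set_integrable_def mult.commute)
    qed
    have "(\<integral>x. ?f (x, y) \<partial>lborel) = (\<integral>x. y ^ b * (x ^ a * indicator {- 1..y} x) - y ^ a * (x ^ b * indicator {- 1..y} x) \<partial>lborel)"
    proof (rule integral_cong_AE)
      have "AE x in lborel. x \<noteq> - 1" "AE x in lborel. x \<noteq> y" by (rule AE_lborel_singleton)+
      then show "AE x in lborel. ?f (x, y) = y ^ b * (x ^ a * indicator {- 1..y} x) - y ^ a * (x ^ b * indicator {- 1..y} x)"
      proof eventually_elim
        fix x :: real assume x: "x \<noteq> - 1" "x \<noteq> y"
        show "?f (x, y) = y ^ b * (x ^ a * indicator {- 1..y} x) - y ^ a * (x ^ b * indicator {- 1..y} x)"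
        proof (cases "- 1 < x \<and> x < y")
          case True
          then show ?thesis using \<open>- 1 < y \<and> y < 1\<close> by (simp add: mult.commute)
        next
          case False
          then have "x \<notin> {- 1..y}" "(x, y) \<notin> ?S" using x by auto
          then show ?thesis by simp
        qed
      qed
      have "(\<lambda>x. (x, y)) \<in> borel_measurable borel"
        by (intro borel_measurable_continuous_onI continuous_intros)
      from measurable_compose[OF this fm] show "(\<lambda>x. ?f (x, y)) \<in> borel_measurable lborel" by simp
    qed simp
    also have "\<dots> = y ^ b * (\<integral>x. x ^ a * indicator {- 1..y} x \<partial>lborel) - y ^ a * (\<integral>x. x ^ b * indicator {- 1..y} x \<partial>lborel)"
      using i[of a] i[of b] by simp
    also have "\<dots> = y ^ b * (y ^ Suc a - (- 1) ^ Suc a) / real (Suc a) - y ^ a * (y ^ Suc b - (- 1) ^ Suc b) / real (Suc b)"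
      using True by (subst (1 2) integral_power) auto
    finally show ?thesis using True by simp
  next
    case False
    then have z: "(\<lambda>x. ?f (x, y)) = (\<lambda>x. 0)" by (intro ext) auto
    have "y \<notin> {- 1..1}" using False that by auto
    then show ?thesis unfolding z by simp
  qed
  have i1: "integrable lborel (\<lambda>x::real. x ^ k * indicator {- 1..1} x)" for k
  proof -
    have "set_integrable lborel {- 1..1} (\<lambda>x::real. x ^ k)"
      by (intro borel_integrable_atLeastAtMost' continuous_intros)
    then show ?thesis by (simp add: set_integrable_def mult.commute)
  qed
  let ?A = "real a + 1" and ?B = "real b + 1"
  have "real_region.moment a b = (\<integral>y. \<integral>x. ?f (x, y) \<partial>lborel \<partial>lborel)"
    unfolding moment_real_integral
    by (rule integral_plane_iterated(2)[OF fm fB, of "(- 1, - 1)" "(1, 1)"]) (auto simp: cbox_Pair_eq indicator_def split: if_splits)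
  also have "\<dots> = (\<integral>y. (1 / ?A - 1 / ?B) * (y ^ (a + b + 1) * indicator {- 1..1} y)
      + (- 1) ^ a / ?A * (y ^ b * indicator {- 1..1} y) - (- 1) ^ b / ?B * (y ^ a * indicator {- 1..1} y) \<partial>lborel)"
  proof (rule integral_cong_AE)
    have "AE y in lborel. y \<noteq> (- 1::real)" "AE y in lborel. y \<noteq> (1::real)" by (rule AE_lborel_singleton)+
    then show "AE y in lborel. (\<integral>x. ?f (x, y) \<partial>lborel) = (1 / ?A - 1 / ?B) * (y ^ (a + b + 1) * indicator {- 1..1} y)
      + (- 1) ^ a / ?A * (y ^ b * indicator {- 1..1} y) - (- 1) ^ b / ?B * (y ^ a * indicator {- 1..1} y)"
    proof eventually_elim
      fix y :: real assume y: "y \<noteq> - 1" "y \<noteq> 1"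
      show "(\<integral>x. ?f (x, y) \<partial>lborel) = (1 / ?A - 1 / ?B) * (y ^ (a + b + 1) * indicator {- 1..1} y)
        + (- 1) ^ a / ?A * (y ^ b * indicator {- 1..1} y) - (- 1) ^ b / ?B * (y ^ a * indicator {- 1..1} y)"
      proof (cases "y \<in> {- 1..1}")
        case True
        define A B where "A = ?A" and "B = ?B"
        have AB: "real (Suc a) = A" "real (Suc b) = B" by (simp_all add: A_def B_def)
        have P: "y ^ b * (y ^ Suc a - (- 1) ^ Suc a) = y ^ (a + b + 1) + (- 1) ^ a * y ^ b"
          "y ^ a * (y ^ Suc b - (- 1) ^ Suc b) = y ^ (a + b + 1) + (- 1) ^ b * y ^ a"
          by (simp_all add: algebra_simps power_add)
        have "(y ^ (a + b + 1) + (- 1) ^ a * y ^ b) / A - (y ^ (a + b + 1) + (- 1) ^ b * y ^ a) / B =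
            (1 / A - 1 / B) * y ^ (a + b + 1) + (- 1) ^ a / A * y ^ b - (- 1) ^ b / B * y ^ a"
          by (simp add: add_divide_distrib left_diff_distrib)
        then show ?thesis
          unfolding inner[OF y] P AB A_def[symmetric] B_def[symmetric] using True by simp
      next
        case False
        then show ?thesis unfolding inner[OF y] by simp
      qed
    qed
    have "(\<lambda>p::real \<times> real. (snd p, fst p)) \<in> borel_measurable borel"
      by (intro borel_measurable_continuous_onI continuous_intros)
    from measurable_compose[OF this fm]
    have "case_prod (\<lambda>y x. ?f (x, y)) \<in> borel_measurable (lborel \<Otimes>\<^sub>M lborel)"
      by (simp add: lborel_prod case_prod_unfold)
    then show "(\<lambda>y. \<integral>x. ?f (x, y) \<partial>lborel) \<in> borel_measurable lborel"
      by (rule lborel.borel_measurable_lebesgue_integral)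
  qed simp
  also have "\<dots> = (1 / ?A - 1 / ?B) * (\<integral>y. y ^ (a + b + 1) * indicator {- 1..1} y \<partial>lborel)
      + (- 1) ^ a / ?A * (\<integral>y. y ^ b * indicator {- 1..1} y \<partial>lborel) - (- 1) ^ b / ?B * (\<integral>y. y ^ a * indicator {- 1..1} y \<partial>lborel)"
    using i1[of "a + b + 1"] i1[of a] i1[of b] by simp
  also have "\<dots> = (if even a \<and> odd b then 4 / (?A * (real a + real b + 2))
     else if odd a \<and> even b then - 4 / (?B * (real a + real b + 2)) else 0)"
  proof -
    define A B N where "A = ?A" and "B = ?B" and "N = real a + real b + 2"
    have pos: "A > 0" "B > 0" "N > 0" and N: "N = A + B" by (auto simp: A_def B_def N_def)
    have e1: "(1 / A - 1 / B) * (2 / N) + 2 / (A * B) = 4 / (A * N)"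
      using pos unfolding N by (simp add: divide_simps)
    have e2: "(1 / A - 1 / B) * (2 / N) - 2 / (A * B) = - 4 / (B * N)"
      using pos unfolding N by (simp add: divide_simps)
    have I: "(\<integral>y. y ^ (a + b + 1) * indicator {- 1..1} y \<partial>lborel) = (if even (a + b) then 0 else 2 / N)"
      unfolding integral_power_sym by (simp add: N_def)
    have Ia: "(\<integral>y. y ^ a * indicator {- 1..1} y \<partial>lborel) = (if even a then 2 / A else 0)"
      and Ib: "(\<integral>y. y ^ b * indicator {- 1..1} y \<partial>lborel) = (if even b then 2 / B else 0)"
      unfolding integral_power_sym A_def B_def by (rule refl)+
    have "(1 / A - 1 / B) * (if even (a + b) then 0 else 2 / N) + (- 1) ^ a / A * (if even b then 2 / B else 0)
        - (- 1) ^ b / B * (if even a then 2 / A else 0) =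
        (if even a \<and> odd b then 4 / (A * N) else if odd a \<and> even b then - 4 / (B * N) else 0)"
      by (cases "even a"; cases "even b"; use e1 e2 in \<open>simp add: mult.commute[of B A]\<close>)
    then show ?thesis unfolding I Ia Ib A_def[symmetric] B_def[symmetric] N_def[symmetric] .
  qed
  finally show ?thesis .
qed

text \<open>
  Use polar coordinates \<open>(\<theta>, r)\<close> of the root in the upper half plane. The Jacobian determinant
  \<open>4 r\<^sup>2 sin \<theta>\<close> cancels the denominator \<open>- 2 i r sin \<theta>\<close> of \<open>wedge\<close>, and the numerator is
  \<open>- 2 i r\<^bsup>a+b\<^esup> sin ((b - a) \<theta>)\<close>.
\<close>
lemma moment_nonreal_integral:
  "nonreal_region.moment a b = (\<integral>p. indicator {p. 0 < fst p \<and> fst p < pi \<and> 0 < snd p \<and> snd p < 1} p *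
     (4 * snd p ^ (a + b + 1) * sin ((real b - real a) * fst p)) \<partial>lborel)"
proof -
  let ?S = "{p::real \<times> real. 0 < fst p \<and> fst p < pi \<and> 0 < snd p \<and> snd p < 1}"
  let ?g = "\<lambda>p::real \<times> real. (- 2 * snd p * cos (fst p), (snd p)\<^sup>2)"
  let ?z = "\<lambda>p::real \<times> real. of_real (snd p) * cis (fst p)"
  have S: "?S \<in> sets borel" by measurable
  have roots: "?z p + cnj (?z p) = - of_real (fst (?g p))" "?z p * cnj (?z p) = of_real (snd (?g p))" for p
  proof -
    show "?z p + cnj (?z p) = - of_real (fst (?g p))"
      unfolding complex_add_cnj by simp
    show "?z p * cnj (?z p) = of_real (snd (?g p))"
      unfolding complex_norm_square[symmetric] by (simp add: norm_mult)
  qed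
  have bij: "bij_betw ?g ?S (quads_in region_nonreal)"
    unfolding bij_betw_def
  proof
    show "inj_on ?g ?S"
    proof (rule inj_onI)
      fix p q assume pq: "p \<in> ?S" "q \<in> ?S" and eq: "?g p = ?g q"
      have "(snd p)\<^sup>2 = (snd q)\<^sup>2" using eq by simp
      then have s: "snd p = snd q" using pq by (simp add: power2_eq_iff_nonneg)
      have bounds: "0 \<le> fst p" "fst p \<le> pi" "0 \<le> fst q" "fst q \<le> pi" "snd q \<noteq> 0"
        using pq by simp_all
      have "snd p * cos (fst p) = snd q * cos (fst q)" using eq by simp
      then have "cos (fst p) = cos (fst q)" unfolding s using bounds(5) by simp
      then have "fst p = fst q" by (rule cos_inj_pi[OF bounds(1-4)])
      with s show "p = q" by (simp add: prod_eq_iff)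
    qed
    show "?g ` ?S = quads_in region_nonreal"
    proof (intro Set.set_eqI iffI)
      fix t assume "t \<in> ?g ` ?S"
      then obtain p where p: "t = ?g p" "p \<in> ?S" by blast
      define z where "z = ?z p"
      have "sin (fst p) > 0" using p(2) by (intro sin_gt_zero) auto
      then have z: "Im z \<noteq> 0" "norm z < 1" using p(2) by (simp_all add: z_def norm_mult)
      have "z \<noteq> cnj z"
      proof
        assume "z = cnj z"
        then have "Im z = - Im z" by (metis cnj.simps(2))
        then show False using z(1) by simp
      qed
      moreover have "z \<in> region_nonreal" "cnj z \<in> region_nonreal" using z by (simp_all add: region_nonreal_def)
      ultimately show "t \<in> quads_in region_nonreal"
        using quads_in_iff_roots[OF roots[of p], folded z_def p(1)] by blast
    next
      fix t assume t: "t \<in> quads_in region_nonreal"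
      then have z: "Im (rx t) \<noteq> 0" "norm (rx t) < 1" by (auto simp: quads_in_def region_nonreal_def)
      have ft: "fst t = - 2 * Re (rx t)" "snd t = (norm (rx t))\<^sup>2"
        by (rule quad_of_nonreal_root[OF z(1)])+
      define r where "r = norm (rx t)"
      define \<theta> where "\<theta> = arccos (Re (rx t) / r)"
      have "rx t \<noteq> 0" using z(1) by auto
      then have r: "r > 0" "r < 1" using z(2) by (simp_all add: r_def)
      have "\<bar>Re (rx t)\<bar> < r"
      proof (rule power2_less_imp_less)
        show "\<bar>Re (rx t)\<bar>\<^sup>2 < r\<^sup>2" using z(1) by (simp add: r_def cmod_power2)
      qed (use r in simp)
      then have "- r < Re (rx t)" "Re (rx t) < r" by linarith+
      then have q: "- 1 < Re (rx t) / r" "Re (rx t) / r < 1"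
        using r(1) by (simp_all add: pos_less_divide_eq)
      have \<theta>: "0 < \<theta>" "\<theta> < pi"
        unfolding \<theta>_def using arccos_lt_bounded[OF q] by blast+
      have cos\<theta>: "cos \<theta> = Re (rx t) / r"
        unfolding \<theta>_def by (rule cos_arccos) (use q in linarith)+
      have rc: "r * cos \<theta> = Re (rx t)" unfolding cos\<theta> using r(1) by simp
      have "fst t = - 2 * (r * cos \<theta>)" unfolding rc by (rule ft(1))
      moreover have "snd t = r\<^sup>2" unfolding r_def by (rule ft(2))
      ultimately have "t = ?g (\<theta>, r)" by (cases t) simp
      moreover have "(\<theta>, r) \<in> ?S" using \<theta> r by simp
      ultimately show "t \<in> ?g ` ?S" by (rule image_eqI)
    qed
  qed
  have "nonreal_region.moment a b = (\<integral>t. wedge a b t \<partial>restrict_space lborel (quads_in region_nonreal))"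
    by (simp add: nonreal_region.moment_def nonreal_region.quad_space_def)
  also have "\<dots> = (\<integral>p. indicator ?S p * ((2 * snd p * sin (fst p) * (2 * snd p) - (- 2 * cos (fst p)) * 0) * wedge a b (?g p)) \<partial>lborel)"
  proof (rule integral_injective_plane[OF _ _ _ _ _ S nonreal_region.quads_in_measurable bij])
    show "(?g has_derivative (\<lambda>h. (2 * snd p * sin (fst p) * fst h + - 2 * cos (fst p) * snd h, 0 * fst h + 2 * snd p * snd h))) (at p)" for p
    proof -
      have dsnd: "((\<lambda>p::real \<times> real. snd p) has_derivative (\<lambda>h. snd h)) (at p)"
        by (rule has_derivative_snd[OF has_derivative_ident])
      have "((\<lambda>p::real \<times> real. cos (fst p)) has_derivative (\<lambda>h. fst h * - sin (fst p))) (at p)"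
        by (rule has_derivative_eq_rhs[OF has_derivative_cos[OF has_derivative_fst[OF has_derivative_ident]]])
           (simp add: fun_eq_iff)
      from has_derivative_mult[OF has_derivative_mult_right[OF dsnd, of "- 2"] this]
      have "((\<lambda>p::real \<times> real. - 2 * snd p * cos (fst p)) has_derivative
          (\<lambda>h. 2 * snd p * sin (fst p) * fst h + - 2 * cos (fst p) * snd h)) (at p)"
        by (rule has_derivative_eq_rhs) (auto simp: fun_eq_iff)
      moreover from has_derivative_mult[OF dsnd dsnd]
      have "((\<lambda>p::real \<times> real. (snd p)\<^sup>2) has_derivative (\<lambda>h. 0 * fst h + 2 * snd p * snd h)) (at p)"
        unfolding power2_eq_square by (rule has_derivative_eq_rhs) (auto simp: fun_eq_iff)
      ultimately show ?thesis by (rule has_derivative_Pair)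
    qed
    show "0 < 2 * snd p * sin (fst p) * (2 * snd p) - - 2 * cos (fst p) * 0" if "p \<in> ?S" for p
      using that sin_gt_zero[of "fst p"] by simp
    show "continuous_on UNIV (\<lambda>p::real \<times> real. 2 * snd p * sin (fst p))"
      "continuous_on UNIV (\<lambda>p::real \<times> real. - 2 * cos (fst p))"
      "continuous_on UNIV (\<lambda>p::real \<times> real. 0 :: real)" "continuous_on UNIV (\<lambda>p::real \<times> real. 2 * snd p)"
      by (intro continuous_intros)+
  qed measurable
  also have "\<dots> = (\<integral>p. indicator ?S p * (4 * snd p ^ (a + b + 1) * sin ((real b - real a) * fst p)) \<partial>lborel)"
  proof (rule Bochner_Integration.integral_cong[OF refl])
    fix p :: "real \<times> real"
    let ?r = "snd p" and ?\<theta> = "fst p"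
    have zp: "?z p ^ m * cnj (?z p) ^ n = of_real (?r ^ (m + n)) * cis ((real m - real n) * ?\<theta>)" for m n
    proof -
      have 1: "?z p ^ m = of_real (?r ^ m) * cis (real m * ?\<theta>)"
        by (simp add: power_mult_distrib Complex.DeMoivre)
      have 2: "cnj (?z p) ^ n = of_real (?r ^ n) * cis (- (real n * ?\<theta>))"
        by (simp add: power_mult_distrib cis_cnj Complex.DeMoivre)
      have "?z p ^ m * cnj (?z p) ^ n = of_real (?r ^ m) * of_real (?r ^ n) * (cis (real m * ?\<theta>) * cis (- (real n * ?\<theta>)))"
        unfolding 1 2 by (simp only: mult_ac)
      also have "cis (real m * ?\<theta>) * cis (- (real n * ?\<theta>)) = cis ((real m - real n) * ?\<theta>)"
        unfolding cis_mult by (simp add: algebra_simps)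
      finally show ?thesis by (simp only: power_add of_real_mult)
    qed
    have "of_real (wedge a b (?g p)) * (cnj (?z p) - ?z p) =
       of_real (?r ^ (a + b)) * (cis ((real a - real b) * ?\<theta>) - cis ((real b - real a) * ?\<theta>))"
      unfolding wedge_at_roots[OF roots[of p]] zp by (simp add: algebra_simps)
    then have "Im (of_real (wedge a b (?g p)) * (cnj (?z p) - ?z p)) =
       Im (of_real (?r ^ (a + b)) * (cis ((real a - real b) * ?\<theta>) - cis ((real b - real a) * ?\<theta>)))"
      by (rule arg_cong)
    then have Im_eq: "wedge a b (?g p) * (- (?r * sin ?\<theta>) - ?r * sin ?\<theta>) =
        ?r ^ (a + b) * (sin ((real a - real b) * ?\<theta>) - sin ((real b - real a) * ?\<theta>))"
      by (simp add: algebra_simps)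
    have "(real a - real b) * ?\<theta> = - ((real b - real a) * ?\<theta>)" by (simp add: algebra_simps)
    then have "sin ((real a - real b) * ?\<theta>) = - sin ((real b - real a) * ?\<theta>)"
      by (simp only: sin_minus)
    from Im_eq[unfolded this]
    have w: "wedge a b (?g p) * (?r * sin ?\<theta>) = ?r ^ (a + b) * sin ((real b - real a) * ?\<theta>)"
      by (simp only: right_diff_distrib mult_minus_right)
    have "(2 * ?r * sin ?\<theta> * (2 * ?r) - (- 2 * cos ?\<theta>) * 0) * wedge a b (?g p) = 4 * ?r * (wedge a b (?g p) * (?r * sin ?\<theta>))"
      by simp
    also have "\<dots> = 4 * ?r ^ (a + b + 1) * sin ((real b - real a) * ?\<theta>)"
      unfolding w by (simp add: power_add)
    finally show "indicator ?S p * ((2 * snd p * sin (fst p) * (2 * snd p) - (- 2 * cos (fst p)) * 0) * wedge a b (?g p)) =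
         indicator ?S p * (4 * snd p ^ (a + b + 1) * sin ((real b - real a) * fst p))" by (rule arg_cong)
  qed
  finally show ?thesis .
qed

lemma moment_nonreal:
  "nonreal_region.moment a b = (if even (a + b) then 0 else 8 / ((real b + 1)\<^sup>2 - (real a + 1)\<^sup>2))"
proof -
  let ?S = "{p::real \<times> real. 0 < fst p \<and> fst p < pi \<and> 0 < snd p \<and> snd p < 1}"
  let ?n = "real b - real a"
  let ?f = "\<lambda>p::real \<times> real. indicator ?S p * (4 * snd p ^ (a + b + 1) * sin (?n * fst p)) :: real"
  have S[measurable]: "?S \<in> sets borel" by measurable
  have fm: "?f \<in> borel_measurable borel" by measurable
  have fB: "\<bar>?f p\<bar> \<le> 4" for p
  proof (cases "p \<in> ?S")
    case True
    then have "\<bar>snd p ^ (a + b + 1)\<bar> \<le> 1" unfolding power_abs by (intro power_le_one) auto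
    then have "\<bar>snd p ^ (a + b + 1)\<bar> * \<bar>sin (?n * fst p)\<bar> \<le> 1" by (intro mult_le_one) auto
    then show ?thesis using True by (simp add: abs_mult)
  qed simp
  have ae: "AE x in lborel. indicator {0<..<c} x = (indicator {0..c} x :: real)" for c :: real
  proof -
    have "AE x in lborel. x \<noteq> 0" "AE x in lborel. x \<noteq> c" by (rule AE_lborel_singleton)+
    then show ?thesis by eventually_elim (auto split: split_indicator)
  qed
  have open_closed: "(\<integral>x. h x * indicator {0<..<c} x \<partial>lborel) = (\<integral>x. h x * indicator {0..c} x \<partial>lborel)"
    if [measurable]: "h \<in> borel_measurable borel" for h :: "real \<Rightarrow> real" and c
  proof (rule integral_cong_AE)
    show "AE x in lborel. h x * indicator {0<..<c} x = h x * indicator {0..c} x"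
      using ae[of c] by eventually_elim simp
  qed measurable
  have "nonreal_region.moment a b = (\<integral>x. \<integral>y. ?f (x, y) \<partial>lborel \<partial>lborel)"
    unfolding moment_nonreal_integral
    by (rule integral_plane_iterated(1)[OF fm fB, of "(0, 0)" "(pi, 1)"]) (auto simp: cbox_Pair_eq indicator_def split: if_splits)
  also have "\<dots> = (\<integral>x. \<integral>y. (4 * (sin (?n * x) * indicator {0<..<pi} x)) * (y ^ (a + b + 1) * indicator {0<..<1} y) \<partial>lborel \<partial>lborel)"
    by (intro Bochner_Integration.integral_cong refl) (simp split: split_indicator)
  also have "\<dots> = 4 * (\<integral>x. sin (?n * x) * indicator {0<..<pi} x \<partial>lborel) * (\<integral>y. y ^ (a + b + 1) * indicator {0<..<1} y \<partial>lborel)"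
    by simp
  also have "(\<integral>y. y ^ (a + b + 1) * indicator {0<..<1} y \<partial>lborel) = 1 / (real a + real b + 2)"
    by (subst open_closed) (auto simp: integral_power)
  also have "(\<integral>x. sin (?n * x) * indicator {0<..<pi} x \<partial>lborel) = (if even (a + b) then 0 else 2 / ?n)"
  proof (cases "a = b")
    case False
    have "(\<integral>x. sin (?n * x) * indicator {0<..<pi} x \<partial>lborel) = (\<integral>x. sin (?n * x) * indicator {0..pi} x \<partial>lborel)"
      by (rule open_closed) measurable
    also have "\<dots> = - cos (?n * pi) / ?n - (- cos (?n * 0) / ?n)"
    proof (rule integral_FTC_Icc_real)
      show "((\<lambda>x. - cos (?n * x) / ?n) has_real_derivative sin (?n * x)) (at x)" for x
        using False by (auto intro!: derivative_eq_intros)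
      show "isCont (\<lambda>x. sin (?n * x)) x" for x by (intro continuous_intros)
    qed simp
    also have "cos (?n * pi) = (if even (a + b) then 1 else - 1)"
    proof -
      have "cos (?n * pi) = cos (real b * pi - real a * pi)" by (simp add: algebra_simps)
      also have "\<dots> = (- 1) ^ b * (- 1) ^ a" by (simp add: cos_diff cos_npi sin_npi)
      finally show ?thesis by (auto simp: power_add[symmetric])
    qed
    finally show ?thesis by (simp add: diff_divide_distrib)
  qed simp
  also have "4 * (if even (a + b) then 0 else 2 / ?n) * (1 / (real a + real b + 2)) =
      (if even (a + b) then 0 else 8 / ((real b + 1)\<^sup>2 - (real a + 1)\<^sup>2))"
  proof -
    have "(real b + 1)\<^sup>2 - (real a + 1)\<^sup>2 = ?n * (real a + real b + 2)"
      by (simp add: power2_eq_square algebra_simps)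
    then show ?thesis by simp
  qed
  finally show ?thesis .
qed

section \<open>The quotient of the volumes\<close>

text \<open>
  Fix all coefficients except the constant one. The derivative is then fixed too, and each of its finitely many
  zeros is a root of the polynomial for exactly one complex, hence at most one real, constant coefficient.
\<close>
lemma not_simple_null: "not_simple (Suc d) \<in> null_sets (coeffs_measure (Suc d))"
proof -
  let ?N = "not_simple (Suc d)"
  have N[measurable]: "?N \<in> sets (coeffs_measure (Suc d))" by (rule not_simple_measurable)
  have "emeasure (coeffs_measure (Suc d)) ?N = (\<integral>\<^sup>+a. \<integral>\<^sup>+y. indicator ?N (a(Suc d := y)) \<partial>lborel \<partial>coeffs_measure d)"
    by (subst nn_integral_coeffs_Suc[symmetric]) auto
  also have "\<dots> = (\<integral>\<^sup>+a. 0 \<partial>coeffs_measure d)"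
  proof (rule nn_integral_cong)
    fix a
    let ?D = "{z. horner_deriv a (Suc d) z = 0}"
    have "pderiv (monic_poly (Suc d) a) \<noteq> 0"
      by (simp add: pderiv_eq_0_iff degree_monic_poly)
    then have fin: "finite ?D"
      using poly_roots_finite[of "pderiv (monic_poly (Suc d) a)"] by (simp add: poly_pderiv_monic_poly del: horner_deriv.simps)
    have H: "horner (a(Suc d := y)) d z = horner a d z" for y z
      by (rule horner_cong) auto
    have H': "horner_deriv (a(Suc d := y)) (Suc d) z = horner_deriv a (Suc d) z" for y z
    proof -
      have "horner_deriv (a(Suc d := y)) k z = horner_deriv a k z" if "k \<le> d" for k
        using that
      proof (induction k)
        case (Suc k)
        moreover have "horner (a(Suc d := y)) k z = horner a k z" using Suc by (intro horner_cong) auto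
        ultimately show ?case by (simp del: fun_upd_apply)
      qed simp
      then show ?thesis using H by simp
    qed
    have sub: "{y. a(Suc d := y) \<in> ?N} \<subseteq> (\<lambda>z. - Re (z * horner a d z)) ` ?D"
    proof
      fix y assume "y \<in> {y. a(Suc d := y) \<in> ?N}"
      then obtain z where z: "horner (a(Suc d := y)) (Suc d) z = 0" "horner_deriv (a(Suc d := y)) (Suc d) z = 0"
        by (auto simp only: not_simple_def mem_Collect_eq)
      have "z * horner a d z + of_real y = 0" using z(1) H by simp
      then have "Re (z * horner a d z + of_real y) = 0" by simp
      then have "y = - Re (z * horner a d z)" by simp
      then show "y \<in> (\<lambda>z. - Re (z * horner a d z)) ` ?D" using z(2) unfolding H' by blast
    qed
    then have "finite {y. a(Suc d := y) \<in> ?N}" using fin finite_subset by blast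
    then have null: "{y. a(Suc d := y) \<in> ?N} \<in> null_sets lborel"
      by (rule finite_imp_null_set_lborel)
    have "(\<integral>\<^sup>+y. indicator ?N (a(Suc d := y)) \<partial>lborel) = (\<integral>\<^sup>+y. indicator {y. a(Suc d := y) \<in> ?N} y \<partial>lborel)"
      by (intro nn_integral_cong) (simp add: indicator_def)
    also have "\<dots> = emeasure lborel {y. a(Suc d := y) \<in> ?N}"
      using null by (intro nn_integral_indicator) (auto simp: null_sets_def)
    also have "\<dots> = 0" using null by (simp add: null_sets_def)
    finally show "(\<integral>\<^sup>+y. indicator ?N (a(Suc d := y)) \<partial>lborel) = 0" .
  qed
  finally show ?thesis using N by (simp add: null_sets_def)
qed

text \<open>
  Without multiple roots the multiset of roots is a set.
\<close>
lemma nonreal_pairs_simple: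
  assumes a: "a \<in> {1..d} \<rightarrow>\<^sub>E UNIV" "a \<notin> not_simple d"
  shows "nonreal_pairs (monic_poly d a) = card {z \<in> root_set a d. Im z > 0}"
    and "card (root_set a d) = d"
proof -
  have U: "a \<in> polys_in UNIV d" using a by (auto simp: polys_in_def not_simple_def)
  show "card (root_set a d) = d" by (rule polys_in_decompose(3)[OF U])
  have sq: "rsquarefree (monic_poly d a)"
    using a by (auto simp: rsquarefree_roots poly_monic_poly poly_pderiv_monic_poly not_simple_def)
  have "proots (monic_poly d a) = mset_set (root_set a d)"
  proof (rule multiset_eqI)
    fix z
    show "count (proots (monic_poly d a)) z = count (mset_set (root_set a d)) z"
    proof (cases "z \<in> root_set a d")
      case True
      then have "order z (monic_poly d a) = 1"
        using rsquarefree_root_order[OF sq _ monic_poly_nz] by (simp add: root_set_def poly_monic_poly)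
      then show ?thesis using True finite_root_set monic_poly_nz by simp
    next
      case False
      then have "order z (monic_poly d a) = 0"
        by (intro order_0I) (simp add: root_set_def poly_monic_poly)
      then show ?thesis using False finite_root_set monic_poly_nz by simp
    qed
  qed
  then show "nonreal_pairs (monic_poly d a) = card {z \<in> root_set a d. Im z > 0}"
    using finite_root_set by (simp add: nonreal_pairs_def)
qed

text \<open>
  Nonreal roots come in conjugate pairs, so \<open>2s\<close> is twice the number of pairs plus the number of real roots:
  no pair means that all roots are real, and \<open>s\<close> pairs mean that none is.
\<close>
lemma E_set_iff_polys_in:
  assumes a: "a \<in> {1..2 * s} \<rightarrow>\<^sub>E UNIV" "a \<notin> not_simple (2 * s)"
  shows "a \<in> E_set (2 * s) 0 \<longleftrightarrow> a \<in> polys_in region_real (2 * s)"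
    and "a \<in> E_set (2 * s) s \<longleftrightarrow> a \<in> polys_in region_nonreal (2 * s)"
proof -
  let ?R = "root_set a (2 * s)"
  let ?U = "{z \<in> ?R. Im z > 0}" and ?X = "{z \<in> ?R. Im z = 0}"
  have fin: "finite ?U" "finite ?X" using finite_root_set[of a "2 * s"] by simp_all
  have card: "2 * s = 2 * card ?U + card ?X"
    using card_root_set[of a "2 * s"] nonreal_pairs_simple(2)[OF a] by simp
  have E: "a \<in> E_set (2 * s) k \<longleftrightarrow> (\<forall>z\<in>?R. norm z < 1) \<and> card ?U = k" for k
    using a(1) nonreal_pairs_simple(1)[OF a] by (simp add: E_set_def root_set_def poly_monic_poly)
  have P: "a \<in> polys_in Z (2 * s) \<longleftrightarrow> ?R \<subseteq> Z" for Z
    using a by (auto simp: polys_in_def not_simple_def root_set_def)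
  have U0: "card ?U = 0 \<longleftrightarrow> (\<forall>z\<in>?R. Im z = 0)"
  proof
    assume "card ?U = 0"
    then have none: "\<not> Im z > 0" if "z \<in> ?R" for z using fin that by auto
    show "\<forall>z\<in>?R. Im z = 0"
    proof
      fix z assume z: "z \<in> ?R"
      show "Im z = 0" using none[OF z] none[OF root_set_cnj[OF z]] by simp
    qed
  next
    assume "\<forall>z\<in>?R. Im z = 0"
    then have "?U = {}" by auto
    then show "card ?U = 0" by (simp only: card.empty)
  qed
  have "card ?U = s \<longleftrightarrow> card ?X = 0" using card by linarith
  also have "\<dots> \<longleftrightarrow> (\<forall>z\<in>?R. Im z \<noteq> 0)" using fin by auto
  finally have Us: "card ?U = s \<longleftrightarrow> (\<forall>z\<in>?R. Im z \<noteq> 0)" .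
  show "a \<in> E_set (2 * s) 0 \<longleftrightarrow> a \<in> polys_in region_real (2 * s)"
    unfolding E P U0 by (auto simp: region_real_def)
  show "a \<in> E_set (2 * s) s \<longleftrightarrow> a \<in> polys_in region_nonreal (2 * s)"
    unfolding E P Us by (auto simp: region_nonreal_def)
qed

lemma measure_completion_modulo_null:
  assumes A: "A \<in> sets M" and N: "N \<in> null_sets M" and "A \<subseteq> B \<union> N" "B \<subseteq> A \<union> N"
  shows "measure (completion M) B = measure M A"
proof -
  have N': "B \<inter> N \<in> null_sets (completion M)" "N \<in> null_sets (completion M)"
    using null_sets_completion_subset[OF _ null_sets_completionI[OF N], of "B \<inter> N"] null_sets_completionI[OF N] by auto
  have "A - N \<in> sets (completion M)" using A N by (auto simp: null_sets_def)
  then have "measure (completion M) ((A - N) \<union> (B \<inter> N)) = measure (completion M) (A - N)"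
    using N'(1) by (rule measure_Un_null_set)
  also have "(A - N) \<union> (B \<inter> N) = B" using assms(3,4) by (auto dest: subsetD)
  also have "measure (completion M) (A - N) = measure (completion M) A"
    using A N'(2) by (intro measure_Diff_null_set) auto
  finally show ?thesis using A by simp
qed

text \<open>
  The sets of the definition of \<open>v\<close> and those of the form \<open>polys_in\<close> differ by polynomials with a multiple
  root only, and these form a null set.
\<close>
lemma v_eq_fdet:
  assumes "s \<ge> 1"
  shows "v (2 * s) 0 = fdet s (\<lambda>i j. 4 / ((2 * real i + 1) * (2 * real i + 2 * real j + 3)))"
    and "v (2 * s) s = fdet s (\<lambda>i j. 8 / ((2 * real j + 2)\<^sup>2 - (2 * real i + 1)\<^sup>2))"
proof -
  obtain d where d: "2 * s = Suc d" using assms by (cases "2 * s") auto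
  have N: "not_simple (2 * s) \<in> null_sets (coeffs_measure (2 * s))"
    unfolding d by (rule not_simple_null)
  have ext: "E_set (2 * s) k \<subseteq> {1..2 * s} \<rightarrow>\<^sub>E UNIV" "polys_in Z (2 * s) \<subseteq> {1..2 * s} \<rightarrow>\<^sub>E UNIV" for k Z
    by (auto simp: E_set_def polys_in_def)
  have "v (2 * s) 0 = measure (coeffs_measure (2 * s)) (polys_in region_real (2 * s))"
    unfolding v_def lebesgue_dim_def
  proof (rule measure_completion_modulo_null[OF real_region.polys_in_measurable N])
    show "polys_in region_real (2 * s) \<subseteq> E_set (2 * s) 0 \<union> not_simple (2 * s)"
      using E_set_iff_polys_in(1) ext by blast
    show "E_set (2 * s) 0 \<subseteq> polys_in region_real (2 * s) \<union> not_simple (2 * s)"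
      using E_set_iff_polys_in(1) ext by blast
  qed
  also have "\<dots> = fdet s (\<lambda>i j. real_region.moment (2 * i) (2 * j + 1))"
    by (rule real_region.volume_eq_fdet) (auto simp: moment_real)
  finally show "v (2 * s) 0 = fdet s (\<lambda>i j. 4 / ((2 * real i + 1) * (2 * real i + 2 * real j + 3)))"
    by (simp add: moment_real add_ac)
  have "v (2 * s) s = measure (coeffs_measure (2 * s)) (polys_in region_nonreal (2 * s))"
    unfolding v_def lebesgue_dim_def
  proof (rule measure_completion_modulo_null[OF nonreal_region.polys_in_measurable N])
    show "polys_in region_nonreal (2 * s) \<subseteq> E_set (2 * s) s \<union> not_simple (2 * s)"
      using E_set_iff_polys_in(2) ext by blast
    show "E_set (2 * s) s \<subseteq> polys_in region_nonreal (2 * s) \<union> not_simple (2 * s)"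
      using E_set_iff_polys_in(2) ext by blast
  qed
  also have "\<dots> = fdet s (\<lambda>i j. nonreal_region.moment (2 * i) (2 * j + 1))"
    by (rule nonreal_region.volume_eq_fdet) (auto simp: moment_nonreal)
  finally show "v (2 * s) s = fdet s (\<lambda>i j. 8 / ((2 * real j + 2)\<^sup>2 - (2 * real i + 1)\<^sup>2))"
    by (simp add: moment_nonreal add_ac)
qed

lemma prod_shifted: "(\<Prod>i<k. real (m + i + 1)) * fact m = fact (m + k)"
proof (induction k)
  case (Suc k)
  have "(\<Prod>i<Suc k. real (m + i + 1)) * fact m = real (m + k + 1) * ((\<Prod>i<k. real (m + i + 1)) * fact m)"
    by (simp only: prod.lessThan_Suc mult_ac)
  also have "\<dots> = fact (m + Suc k)" unfolding Suc.IH by simp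
  finally show ?case .
qed simp

lemma prod_odd: "(\<Prod>i<n. 2 * real i + 1) * (2 ^ n * fact n) = fact (2 * n)"
proof (induction n)
  case (Suc n)
  have "(\<Prod>i<Suc n. 2 * real i + 1) * (2 ^ Suc n * fact (Suc n)) =
      ((2 * real n + 1) * (2 * real (Suc n))) * ((\<Prod>i<n. 2 * real i + 1) * (2 ^ n * fact n))"
    by (simp only: prod.lessThan_Suc power_Suc fact_Suc of_nat_mult of_nat_fact mult_ac)
  also have "\<dots> = fact (2 * Suc n)" unfolding Suc.IH by (simp add: algebra_simps)
  finally show ?case .
qed simp

text \<open>
  All four products are quotients of factorials, the odd ones through \<open>(1 \<cdot> 3 \<cdots> (2n - 1)) 2\<^sup>n n! = (2n)!\<close>.
\<close>
lemma cauchy_ratio_product: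
  "(\<Prod>i<n. (2 * real n + 2 * real i + 2) * (2 * real n + 2 * real i + 4) /
     ((2 * real n - 2 * real i + 1) * (2 * real n - 2 * real i - 1))) = 16 ^ n / real (n + 1)"
proof -
  let ?P = "\<Prod>i<n. real (n + i + 1)" and ?P' = "\<Prod>i<n. real (Suc n + i + 1)"
  have 1: "(\<Prod>i<n. 2 * real n + 2 * real i + 2) = 2 ^ n * ?P"
  proof -
    have "(\<Prod>i<n. 2 * real n + 2 * real i + 2) = (\<Prod>i<n. 2 * real (n + i + 1))" by (rule prod.cong) auto
    then show ?thesis by (simp only: prod.distrib prod_constant card_lessThan)
  qed
  have 2: "(\<Prod>i<n. 2 * real n + 2 * real i + 4) = 2 ^ n * ?P'"
  proof -
    have "(\<Prod>i<n. 2 * real n + 2 * real i + 4) = (\<Prod>i<n. 2 * real (Suc n + i + 1))" by (rule prod.cong) auto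
    then show ?thesis by (simp only: prod.distrib prod_constant card_lessThan)
  qed
  have 3: "(\<Prod>i<n. 2 * real n - 2 * real i - 1) = (\<Prod>i<n. 2 * real i + 1)"
  proof -
    have "(\<Prod>i<n. 2 * real n - 2 * real i - 1) = (\<Prod>i<n. 2 * real (n - Suc i) + 1)"
      by (rule prod.cong) (auto simp: of_nat_diff)
    then show ?thesis by (simp only: prod.nat_diff_reindex[of "\<lambda>i. 2 * real i + 1"])
  qed
  have 4: "(\<Prod>i<n. 2 * real n - 2 * real i + 1) = (\<Prod>i<n. 2 * real i + 3)"
  proof -
    have "(\<Prod>i<n. 2 * real n - 2 * real i + 1) = (\<Prod>i<n. 2 * real (n - Suc i) + 3)"
      by (rule prod.cong) (auto simp: of_nat_diff)
    then show ?thesis by (simp only: prod.nat_diff_reindex[of "\<lambda>i. 2 * real i + 3"])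
  qed
  have 5: "(\<Prod>i<n. 2 * real i + 3) = (\<Prod>i<n. 2 * real i + 1) * (2 * real n + 1)"
    by (induction n) (auto simp: algebra_simps)
  define Q where "Q = (\<Prod>i<n. 2 * real i + 1)"
  have Q: "Q = fact (2 * n) / (2 ^ n * fact n)"
    using prod_odd[of n] by (simp add: Q_def eq_divide_eq)
  have P: "?P = fact (2 * n) / fact n"
    using prod_shifted[of n n] unfolding mult_2[of n] by (simp only: eq_divide_eq fact_nonzero) simp
  have P': "?P' = fact (2 * n + 1) / fact (n + 1)"
  proof -
    have "Suc n + n = 2 * n + 1" by simp
    then have "?P' * fact (n + 1) = fact (2 * n + 1)"
      using prod_shifted[where m = "Suc n" and k = n] by (simp only: Suc_eq_plus1)
    then show ?thesis by (simp only: eq_divide_eq fact_nonzero) simp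
  qed
  have f: "fact (2 * n + 1) = (2 * real n + 1) * fact (2 * n)" "fact (n + 1) = (real n + 1) * fact n"
    unfolding Suc_eq_plus1[symmetric] fact_Suc by simp_all
  have nz: "fact n > (0::real)" "fact (2 * n) > (0::real)" "2 * real n + 1 > 0" "real n + 1 > 0" by auto
  have "(\<Prod>i<n. (2 * real n + 2 * real i + 2) * (2 * real n + 2 * real i + 4) /
     ((2 * real n - 2 * real i + 1) * (2 * real n - 2 * real i - 1))) =
     (2 ^ n * ?P) * (2 ^ n * ?P') / ((Q * (2 * real n + 1)) * Q)"
    unfolding prod_dividef prod.distrib 1 2 3 4 5 Q_def ..
  also have "\<dots> = (2 ^ n * 2 ^ n) * (2 ^ n * 2 ^ n) / (real n + 1)"
  proof -
    have "(x * (G / F)) * (x * ((a * G) / (b * F))) / ((G / (x * F) * a) * (G / (x * F))) = (x * x) * (x * x) / b"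
      if "x > 0" "F > 0" "G > 0" "a > 0" "b > 0" for x F G a b :: real
      using that by (simp add: divide_simps)
    from this[of "2 ^ n" "fact n" "fact (2 * n)" "2 * real n + 1" "real n + 1"] show ?thesis
      unfolding P P' Q f using nz by simp
  qed
  also have "(2 ^ n * 2 ^ n) * (2 ^ n * 2 ^ n) = (16 :: real) ^ n"
    by (simp flip: power_mult_distrib)
  finally show ?thesis by (simp add: add.commute)
qed

lemma central_binomial_Suc:
  "real ((2 * (n + 1)) choose (n + 1)) = real ((2 * n) choose n) * (2 * (2 * real n + 1) / (real n + 1))"
proof -
  have c: "real ((2 * k) choose k) = fact (2 * k) / (fact k * fact k)" for k
    by (simp add: binomial_fact mult_2)
  have f: "fact (2 * (n + 1)) = 2 * (real n + 1) * ((2 * real n + 1) * fact (2 * n))" "fact (n + 1) = (real n + 1) * fact n"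
  proof -
    have "2 * (n + 1) = Suc (Suc (2 * n))" by simp
    then show "fact (2 * (n + 1)) = 2 * (real n + 1) * ((2 * real n + 1) * fact (2 * n))"
      by (simp only: fact_Suc) (simp add: algebra_simps)
    show "fact (n + 1) = (real n + 1) * fact n"
      unfolding Suc_eq_plus1[symmetric] fact_Suc by simp
  qed
  have "(2 * M * (a * G)) / ((M * F) * (M * F)) = G / (F * F) * (2 * a / M)" if "M > 0" "F > 0" for M F G a :: real
    using that by (simp add: divide_simps)
  from this[of "real n + 1" "fact n" "2 * real n + 1" "fact (2 * n)"] show ?thesis
    unfolding c f by simp
qed

text \<open>
  Both are Cauchy determinants in \<open>p\<^sub>i = 2i + 1\<close> and \<open>q\<^sub>j = 2j + 2\<close>, for the nonreal roots in \<open>- p\<^sub>i\<^sup>2\<close> and \<open>q\<^sub>j\<^sup>2\<close>. Passing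
  from \<open>n\<close> to \<open>n + 1\<close>, the factors of the first recursion divide those of the second, since differences of squares
  split; what is left is \<open>cauchy_ratio_product\<close>. The quotient grows by \<open>16\<^sup>n\<close>, which builds up the power of \<open>2\<close>,
  times the quotient of consecutive central binomial coefficients.
\<close>
lemma fdet_ratio:
  defines "R \<equiv> \<lambda>s. fdet s (\<lambda>i j. 4 / ((2 * real i + 1) * (2 * real i + 2 * real j + 3)))"
    and "C \<equiv> \<lambda>s. fdet s (\<lambda>i j. 8 / ((2 * real j + 2)\<^sup>2 - (2 * real i + 1)\<^sup>2))"
  shows "R s \<noteq> 0 \<and> C s = 2 ^ (2 * s * (s - 1)) * real ((2 * s) choose s) * R s"
proof -
  define p where "p i = 2 * real i + 1" for i
  define q where "q j = 2 * real j + 2" for j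
  let ?r = "\<lambda>n. \<Prod>i<n. (p n - p i) * (q n - q i) / ((p i + q n) * (p n + q i))"
  let ?c = "\<lambda>n. \<Prod>i<n. (- (p n)\<^sup>2 - - (p i)\<^sup>2) * ((q n)\<^sup>2 - (q i)\<^sup>2) / ((- (p i)\<^sup>2 + (q n)\<^sup>2) * (- (p n)\<^sup>2 + (q i)\<^sup>2))"
  have ppos: "p i > 0" and qpos: "q i > 0" for i by (auto simp: p_def q_def)
  have pq: "p i \<noteq> q j" for i j
  proof
    assume "p i = q j"
    then have "real (2 * i + 1) = real (2 * j + 2)" by (simp add: p_def q_def)
    then have "2 * i + 1 = 2 * j + 2" by (simp only: of_nat_eq_iff)
    then show False by presburger
  qed
  have nzC: "- (p i)\<^sup>2 + (q j)\<^sup>2 \<noteq> 0" for i j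
    using pq[of i j] ppos[of i] qpos[of j] by (auto simp: power2_eq_iff)
  have R_eq: "R s = (\<Prod>i<s. 4 / p i) * fdet s (\<lambda>i j. 1 / (p i + q j))" for s
    using fdet_scale[of s "\<lambda>i. 4 / p i" "\<lambda>_. 1" "\<lambda>i j. 1 / (p i + q j)"]
    by (simp add: R_def p_def q_def add_ac)
  have C_eq: "C s = 8 ^ s * fdet s (\<lambda>i j. 1 / (- (p i)\<^sup>2 + (q j)\<^sup>2))" for s
    using fdet_scale[of s "\<lambda>i. 8" "\<lambda>_. 1" "\<lambda>i j. 1 / (- (p i)\<^sup>2 + (q j)\<^sup>2)"]
    by (simp add: C_def p_def q_def)
  have R_Suc: "R (Suc n) = R n * (4 / (p n * (p n + q n))) * ?r n" for n
  proof -
    have "p i + q j \<noteq> 0" for i j using ppos[of i] qpos[of j] by simp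
    from fdet_cauchy_Suc[of n p q, OF this] show ?thesis
      unfolding R_eq prod.lessThan_Suc by simp
  qed
  have C_Suc: "C (Suc n) = C n * (8 / (- (p n)\<^sup>2 + (q n)\<^sup>2)) * ?c n" for n
    using fdet_cauchy_Suc[of n "\<lambda>i. - (p i)\<^sup>2" "\<lambda>j. (q j)\<^sup>2", OF nzC]
    unfolding C_eq by simp
  have r_nz: "?r n \<noteq> 0" for n
  proof -
    have "(p n - p i) * (q n - q i) / ((p i + q n) * (p n + q i)) \<noteq> 0" if "i < n" for i
      using that ppos qpos by (auto simp: p_def q_def)
    then show ?thesis by (auto simp: prod_zero_iff)
  qed
  have step: "8 / (- (p n)\<^sup>2 + (q n)\<^sup>2) * ?c n = (16 ^ n * (2 * (2 * real n + 1) / (real n + 1))) * (4 / (p n * (p n + q n)) * ?r n)" for n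
  proof -
    have fac: "(- (p n)\<^sup>2 - - (p i)\<^sup>2) * ((q n)\<^sup>2 - (q i)\<^sup>2) / ((- (p i)\<^sup>2 + (q n)\<^sup>2) * (- (p n)\<^sup>2 + (q i)\<^sup>2)) =
       (2 * real n + 2 * real i + 2) * (2 * real n + 2 * real i + 4) /
         ((2 * real n - 2 * real i + 1) * (2 * real n - 2 * real i - 1)) *
       ((p n - p i) * (q n - q i) / ((p i + q n) * (p n + q i)))" for i
    proof -
      have a: "- (p n)\<^sup>2 - - (p i)\<^sup>2 = - ((p n - p i) * (p n + p i))" "(q n)\<^sup>2 - (q i)\<^sup>2 = (q n - q i) * (q n + q i)"
        "- (p i)\<^sup>2 + (q n)\<^sup>2 = (q n - p i) * (p i + q n)" "- (p n)\<^sup>2 + (q i)\<^sup>2 = - ((p n - q i) * (p n + q i))"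
        by (simp_all add: power2_eq_square algebra_simps)
      have b: "p n + p i = 2 * real n + 2 * real i + 2" "q n + q i = 2 * real n + 2 * real i + 4"
        "q n - p i = 2 * real n - 2 * real i + 1" "p n - q i = 2 * real n - 2 * real i - 1"
        by (simp_all add: p_def q_def)
      show ?thesis unfolding a b[symmetric] by (simp add: mult_ac)
    qed
    have c: "?c n = 16 ^ n / real (n + 1) * ?r n"
      unfolding fac prod.distrib cauchy_ratio_product ..
    have d: "- (p n)\<^sup>2 + (q n)\<^sup>2 = p n + q n"
      by (simp add: p_def q_def power2_eq_square algebra_simps)
    have pn: "2 * real n + 1 = p n" and n1: "real n + 1 = real (n + 1)" by (simp_all add: p_def)
    have "8 / S * (A / M * r) = (A * (2 * P / M)) * (4 / (P * S) * r)" if "P \<noteq> 0" for S A M r P :: real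
      using that by simp
    from this[of "p n" "p n + q n" "16 ^ n" "real (n + 1)" "?r n"] show ?thesis
      unfolding c d pn n1 using ppos[of n] by simp
  qed
  show ?thesis
  proof (induction s)
    case 0
    show ?case by (simp add: R_def C_def fdet_leibniz)
  next
    case (Suc n)
    let ?k = "4 / (p n * (p n + q n)) * ?r n"
    have "?k \<noteq> 0" using r_nz[of n] ppos[of n] qpos[of n] by auto
    then have "R (Suc n) \<noteq> 0" unfolding R_Suc using Suc.IH by (simp only: mult.assoc mult_eq_0_iff) simp
    moreover have "C (Suc n) = 2 ^ (2 * Suc n * (Suc n - 1)) * real ((2 * Suc n) choose Suc n) * R (Suc n)"
    proof -
      \<comment> \<open>\<open>2(n+1)n - 2n(n-1) = 4n\<close>, and \<open>2\<^sup>4 = 16\<close>\<close>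
      have e: "(2::real) ^ (2 * Suc n * (Suc n - 1)) = 2 ^ (2 * n * (n - 1)) * 16 ^ n"
      proof -
        have "2 * Suc n * (Suc n - 1) = 2 * n * (n - 1) + 4 * n" by (cases n) (auto simp: algebra_simps)
        then show ?thesis by (simp add: power_add power_mult)
      qed
      have "C (Suc n) = C n * (8 / (- (p n)\<^sup>2 + (q n)\<^sup>2) * ?c n)" unfolding C_Suc by simp
      also have "\<dots> = C n * ((16 ^ n * (2 * (2 * real n + 1) / (real n + 1))) * ?k)" unfolding step ..
      also have "\<dots> = 2 ^ (2 * n * (n - 1)) * 16 ^ n * (real ((2 * n) choose n) * (2 * (2 * real n + 1) / (real n + 1))) * (R n * ?k)"
        using Suc.IH by (simp only: mult_ac)
      also have "\<dots> = 2 ^ (2 * Suc n * (Suc n - 1)) * real ((2 * Suc n) choose Suc n) * R (Suc n)"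
      proof -
        have b: "real ((2 * Suc n) choose Suc n) = real ((2 * n) choose n) * (2 * (2 * real n + 1) / (real n + 1))"
          using central_binomial_Suc[of n] by (simp only: Suc_eq_plus1)
        show ?thesis unfolding e b R_Suc by (simp only: mult.assoc)
      qed
      finally show ?thesis .
    qed
    ultimately show ?case ..
  qed
qed

theorem theorem2p1:
  fixes s :: nat
  assumes "s \<ge> 1"
  shows "v (2 * s) s / v (2 * s) 0 \<in> \<int> \<and>
         v (2 * s) s / v (2 * s) 0 = 2 ^ (2 * s * (s - 1)) * real ((2 * s) choose s)"
proof -
  have "v (2 * s) s / v (2 * s) 0 = 2 ^ (2 * s * (s - 1)) * real ((2 * s) choose s)"
    unfolding v_eq_fdet[OF assms] using fdet_ratio[of s] by simp
  moreover have "2 ^ (2 * s * (s - 1)) * real ((2 * s) choose s) \<in> \<int>" by simp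
  ultimately show ?thesis by simp
qed

end
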